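(* Let $U\subset\mathbb{R}^n$ be open and $m$ a positive Radon measure on $U$ with $\mathrm{supp}[m]=U$. Let $(\mathcal{E},D(\mathcal{E}))$ be a semi-Dirichlet form on $L^2(U;m)$ with $C_0^\infty(U)\subset D(\mathcal{E})$ satisfying: for every relatively compact open set $O\subset U$, whenever $f_n,f\in C_0^\infty(O)$ are such that $f_n$ and all its partial derivatives converge uniformly to $f$ and its corresponding partial derivatives, one has $\mathcal{E}(f,g)=\lim_{n}\mathcal{E}(f_n,g)$ and $\mathcal{E}(g,f)=\lim_n\mathcal{E}(g,f_n)$ for every $g\in C_0^\infty(U)$. Let $J$ and $K$ be the jumping and killing measures of $\mathcal{E}$ and let $\delta>0$ with $U^\delta\ne\emptyset$. Then there exist signed Radon measures $\{\nu_{ij}\}_{i,j=1}^n$ on $U$ such that for every compact $F\subset U$, $\nu_{ij}(F)=\nu_{ji}(F)$ and $\sum_{i,j}\xi_i\xi_j\nu_{ij}(F)\ge0$ for all $\xi\in\mathbb{R}^n$, and distributions (generalized functions) $\{\Psi^\delta_i\}_{i=1}^n$ on $U^\delta$, such that for all $u,v\in C_0^\infty(U^\delta)$, \begin{align*} \mathcal{E}(u,v)&=\frac12\sum_{i,j=1}^n\int_U\frac{\partial u}{\partial x_i}\frac{\partial v}{\partial x_j}\,\nu_{ij}(dx)+\sum_{i=1}^n\Big\langle\Psi^\delta_i,\frac{\partial u}{\partial x_i}v\Big\rangle\\ &\quad+\int_{U\times U\setminus d}\sum_{i=1}^n(y_i-x_i)\Big(\frac{\partial u}{\partial y_i}(y)v(y)-\frac{\partial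 u}{\partial x_i}(x)v(x)\Big)I_{\{|x-y|\le\delta\}}(x,y)\,J(dxdy)\\ &\quad+\int_{U\times U\setminus d}2\Big(u(y)-u(x)-\sum_{i=1}^n(y_i-x_i)\frac{\partial u}{\partial y_i}(y)I_{\{|x-y|\le\delta\}}(x,y)\Big)v(y)\,J(dxdy)\\ &\quad+\int_U u(x)v(x)\,K(dx). \end{align*}
   Context: $d$ is the diagonal of $U\times U$. The jumping measure $J$ (a positive Radon measure on $U\times U\setminus d$) and killing measure $K$ (a positive Radon measure on $U$) are the unique such measures with $\mathcal{E}(u,v)=\int_{U\times U\setminus d}2(u(y)-u(x))v(y)J(dxdy)+\int_U u(x)v(x)K(dx)$ for all $v\in C_0^\infty(U)$ and all $u\in C_0^\infty(U)$ constant on a neighbourhood of $\mathrm{supp}[v]$. $U^\delta:=\{x\in U:\inf_{y\in\partial U}|x-y|>\delta\}$. A generalized function on $U^\delta$ is a linear functional $\Psi$ on $C_0^\infty(U^\delta)$ such that for every relatively compact open $O\subset U^\delta$, if $f_n,f\in C_0^\infty(O)$ and $f_n$ with all partial derivatives converges uniformly to $f$ with its partial derivatives, then $\langle\Psi,f_n\rangle\to\langle\Psi,f\rangle$. *)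

theory Defs
  imports "HOL-Analysis.Analysis"
begin

definition pd :: "'a::euclidean_space \<Rightarrow> ('a \<Rightarrow> real) \<Rightarrow> 'a \<Rightarrow> real" where
  "pd b f x = frechet_derivative f (at x) b"

fun pderivs :: "'a::euclidean_space list \<Rightarrow> ('a \<Rightarrow> real) \<Rightarrow> ('a \<Rightarrow> real)" where
  "pderivs [] f = f"
| "pderivs (b # bs) f = pd b (pderivs bs f)"

definition smooth_fun :: "('a::euclidean_space \<Rightarrow> real) \<Rightarrow> bool" where
  "smooth_fun f \<longleftrightarrow> (\<forall>bs. set bs \<subseteq> Basis \<longrightarrow> (\<forall>x. pderivs bs f differentiable at x))"

definition fsupp :: "('a::euclidean_space \<Rightarrow> real) \<Rightarrow> 'a set" where
  "fsupp f = closure {x. f x \<noteq> 0}"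

text \<open>C_0^infty(Ob): smooth functions on R^n (extended by 0) whose support is a compact subset of Ob.\<close>
definition C0inf :: "'a::euclidean_space set \<Rightarrow> ('a \<Rightarrow> real) set" where
  "C0inf Ob = {f. smooth_fun f \<and> compact (fsupp f) \<and> fsupp f \<subseteq> Ob}"

definition smooth_conv :: "(nat \<Rightarrow> 'a::euclidean_space \<Rightarrow> real) \<Rightarrow> ('a \<Rightarrow> real) \<Rightarrow> bool" where
  "smooth_conv fs f \<longleftrightarrow> (\<forall>bs. set bs \<subseteq> Basis \<longrightarrow>
      uniform_limit UNIV (\<lambda>n. pderivs bs (fs n)) (pderivs bs f) sequentially)"

definition rel_compact_open :: "'a::euclidean_space set \<Rightarrow> 'a set \<Rightarrow> bool" where
  "rel_compact_open Ob U \<longleftrightarrow> open Ob \<and> compact (closure Ob) \<and> closure Ob \<subseteq> U"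

definition radon_on :: "'b::topological_space set \<Rightarrow> 'b measure \<Rightarrow> bool" where
  "radon_on S M \<longleftrightarrow> sets M = sets borel \<and> emeasure M (- S) = 0 \<and>
     (\<forall>C. compact C \<and> C \<subseteq> S \<longrightarrow> emeasure M C < \<infinity>)"

definition full_support :: "'a::euclidean_space set \<Rightarrow> 'a measure \<Rightarrow> bool" where
  "full_support U m \<longleftrightarrow> (\<forall>x\<in>U. \<forall>e>0. emeasure m (ball x e \<inter> U) > 0)"

text \<open>Signed Radon measure on U represented as a difference of two positive Radon measures.\<close>
definition signed_val :: "'a measure \<times> 'a measure \<Rightarrow> 'a set \<Rightarrow> real" where
  "signed_val \<nu> F = measure (fst \<nu>) F - measure (snd \<nu>) F"

definition signed_int :: "'a measure \<times> 'a measure \<Rightarrow> ('a \<Rightarrow> real) \<Rightarrow> real" where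
  "signed_int \<nu> f = (\<integral>x. f x \<partial>fst \<nu>) - (\<integral>x. f x \<partial>snd \<nu>)"

definition L2 :: "'a measure \<Rightarrow> ('a \<Rightarrow> real) set" where
  "L2 m = {f. f \<in> borel_measurable m \<and> integrable m (\<lambda>x. (f x)\<^sup>2)}"

definition Ealpha :: "'a measure \<Rightarrow> (('a \<Rightarrow> real) \<Rightarrow> ('a \<Rightarrow> real) \<Rightarrow> real) \<Rightarrow> real
    \<Rightarrow> ('a \<Rightarrow> real) \<Rightarrow> ('a \<Rightarrow> real) \<Rightarrow> real" where
  "Ealpha m E a u v = E u v + a * (\<integral>x. u x * v x \<partial>m)"

text \<open>A semi-Dirichlet form (lower bounded closed form satisfying the weak sector condition
  and the semi-Dirichlet Markov property E(Uu, u - Uu) >= 0, Uu = (0 max u) min 1).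
  L^2 classes are represented by functions; D is closed under m-a.e. modification and E
  does not depend on the chosen representatives.\<close>
definition semi_dirichlet_form :: "'a measure \<Rightarrow> ('a \<Rightarrow> real) set
    \<Rightarrow> (('a \<Rightarrow> real) \<Rightarrow> ('a \<Rightarrow> real) \<Rightarrow> real) \<Rightarrow> bool" where
  "semi_dirichlet_form m D E \<longleftrightarrow>
     D \<subseteq> L2 m \<and>
     (\<forall>f\<in>D. \<forall>g\<in>borel_measurable m. (AE x in m. f x = g x) \<longrightarrow> g \<in> D) \<and>
     (\<forall>u\<in>D. \<forall>u'\<in>D. \<forall>v\<in>D. (AE x in m. u x = u' x) \<longrightarrow> E u v = E u' v \<and> E v u = E v u') \<and>
     (\<lambda>_. 0) \<in> D \<and>
     (\<forall>u\<in>D. \<forall>v\<in>D. (\<lambda>x. u x + v x) \<in> D) \<and>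
     (\<forall>u\<in>D. \<forall>c. (\<lambda>x. c * u x) \<in> D) \<and>
     (\<forall>u\<in>D. \<forall>u'\<in>D. \<forall>v\<in>D. \<forall>a b.
        E (\<lambda>x. a * u x + b * u' x) v = a * E u v + b * E u' v \<and>
        E v (\<lambda>x. a * u x + b * u' x) = a * E v u + b * E v u') \<and>
     (\<forall>f\<in>L2 m. \<forall>e>0. \<exists>g\<in>D. (\<integral>x. (f x - g x)\<^sup>2 \<partial>m) < e) \<and>
     (\<exists>\<alpha>0\<ge>0.
        (\<forall>u\<in>D. Ealpha m E \<alpha>0 u u \<ge> 0) \<and>
        (\<exists>C. \<forall>u\<in>D. \<forall>v\<in>D. \<bar>Ealpha m E (\<alpha>0 + 1) u v\<bar>
              \<le> C * sqrt (Ealpha m E (\<alpha>0 + 1) u u) * sqrt (Ealpha m E (\<alpha>0 + 1) v v)) \<and>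
        (\<forall>f. (\<forall>k. f k \<in> D) \<longrightarrow>
           (\<forall>e>0. \<exists>N. \<forall>p\<ge>N. \<forall>q\<ge>N.
              Ealpha m E (\<alpha>0 + 1) (\<lambda>x. f p x - f q x) (\<lambda>x. f p x - f q x) < e) \<longrightarrow>
           (\<exists>g\<in>D. (\<lambda>k. Ealpha m E (\<alpha>0 + 1) (\<lambda>x. f k x - g x) (\<lambda>x. f k x - g x))
                     \<longlonglongrightarrow> 0))) \<and>
     (\<forall>u\<in>D. (\<lambda>x. min (max (u x) 0) 1) \<in> D \<and>
        E (\<lambda>x. min (max (u x) 0) 1) (\<lambda>x. u x - min (max (u x) 0) 1) \<ge> 0)"

definition smooth_continuous_form :: "'a::euclidean_space set
    \<Rightarrow> (('a \<Rightarrow> real) \<Rightarrow> ('a \<Rightarrow> real) \<Rightarrow> real) \<Rightarrow> bool" where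
  "smooth_continuous_form U E \<longleftrightarrow>
     (\<forall>Ob. rel_compact_open Ob U \<longrightarrow>
       (\<forall>fs f. (\<forall>n. fs n \<in> C0inf Ob) \<and> f \<in> C0inf Ob \<and> smooth_conv fs f \<longrightarrow>
          (\<forall>g\<in>C0inf U. (\<lambda>n. E (fs n) g) \<longlonglongrightarrow> E f g \<and> (\<lambda>n. E g (fs n)) \<longlonglongrightarrow> E g f)))"

definition offdiag :: "'a set \<Rightarrow> ('a \<times> 'a) set" where
  "offdiag U = (U \<times> U) - {p. fst p = snd p}"

definition jump_kill :: "'a::euclidean_space set
    \<Rightarrow> (('a \<Rightarrow> real) \<Rightarrow> ('a \<Rightarrow> real) \<Rightarrow> real) \<Rightarrow> ('a \<times> 'a) measure \<Rightarrow> 'a measure \<Rightarrow> bool" where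
  "jump_kill U E J K \<longleftrightarrow> radon_on (offdiag U) J \<and> radon_on U K \<and>
     (\<forall>u\<in>C0inf U. \<forall>v\<in>C0inf U.
        (\<exists>W c. open W \<and> fsupp v \<subseteq> W \<and> (\<forall>x\<in>W. u x = c)) \<longrightarrow>
        integrable J (\<lambda>p. 2 * (u (snd p) - u (fst p)) * v (snd p)) \<and>
        E u v = (\<integral>p. 2 * (u (snd p) - u (fst p)) * v (snd p) \<partial>J) + (\<integral>x. u x * v x \<partial>K))"

text \<open>U^delta (with inf over the empty set being +infinity).\<close>
definition Udelta :: "'a::euclidean_space set \<Rightarrow> real \<Rightarrow> 'a set" where
  "Udelta U \<delta> = (if frontier U = {} then U else {x\<in>U. infdist x (frontier U) > \<delta>})"

definition generalized_function :: "'a::euclidean_space set \<Rightarrow> (('a \<Rightarrow> real) \<Rightarrow> real) \<Rightarrow> bool" where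
  "generalized_function V \<Psi> \<longleftrightarrow>
     (\<forall>f\<in>C0inf V. \<forall>g\<in>C0inf V. \<forall>a b. \<Psi> (\<lambda>x. a * f x + b * g x) = a * \<Psi> f + b * \<Psi> g) \<and>
     (\<forall>Ob. rel_compact_open Ob V \<longrightarrow>
       (\<forall>fs f. (\<forall>n. fs n \<in> C0inf Ob) \<and> f \<in> C0inf Ob \<and> smooth_conv fs f \<longrightarrow>
          (\<lambda>n. \<Psi> (fs n)) \<longlonglongrightarrow> \<Psi> f))"

end

theory Submission
  imports Defs "HOL-Computational_Algebra.Polynomial"
begin

text \<open>
  Extend \<open>E\<close> linearly to kernels \<open>\<Phi>(x, y) = \<Sum>\<^sub>k a\<^sub>k(x) b\<^sub>k(y)\<close> by
  \<open>E(\<Phi>) = \<Sum>\<^sub>k E(a\<^sub>k, b\<^sub>k)\<close>. The Markov property is used only through the following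
  principle: if \<open>\<Phi> \<ge> 0\<close> and \<open>\<Phi>\<close> vanishes on the diagonal, then \<open>E(\<Phi>) \<le> 0\<close>. For the approximating
  forms \<open>(u, v) \<mapsto> E(\<beta>G\<^sub>\<beta>u, v)\<close> this is the positivity of the resolvent \<open>G\<^sub>\<beta>\<close>,
  and \<open>\<beta>\<close> tends to infinity.

  The principle yields that \<open>|x - y|\<^sup>2\<close> is locally \<open>J\<close>-integrable on \<open>U \<times> U\<close>, and that
  \<open>B(\<Phi>) = - E(\<Phi>) - 2 \<integral> \<Phi> dJ\<close>, defined for kernels with \<open>\<Phi> = O(|x - y|\<^sup>2)\<close>, is nonnegative
  as soon as \<open>\<Phi> \<ge> 0\<close> near the diagonal; in particular \<open>B(\<Phi>) = 0\<close> if \<open>\<Phi> = O(|x - y|\<^sup>3)\<close>. So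
  \<open>w \<mapsto> B((x\<^sub>i - y\<^sub>i)(x\<^sub>j - y\<^sub>j) w(y))\<close> is the measure \<open>\<nu>\<^sub>i\<^sub>j\<close>, and the decomposition is the identity
  \<open>B(\<Phi>) = 0\<close> for \<open>\<Phi>\<close> the second-order Taylor remainder of \<open>u\<close> at \<open>y\<close>, times \<open>v(y)\<close>.
\<close>

section \<open>Smooth functions\<close>

text \<open>Coordinates and Taylor polynomials have no compact support, so kernels are multiplied by
  a test function \<open>\<eta> x\<close> equal to 1 near the support at hand. Each construction
  then rests on independence of \<open>\<eta>\<close>: two choices differ by a kernel vanishing near
  the diagonal.

  The orders of the expansion at \<open>y\<close> behave differently. Order zero,
  \<open>\<eta>(x) u(y) v(y)\<close>, is an admissible pair in the definition of \<open>J\<close>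
  and \<open>K\<close> and yields the killing term. Order one is only \<open>O(|x - y|)\<close>, so
  its \<open>J\<close>-integral may diverge; hence the truncation at \<delta> and a distribution
  instead of a measure. Order two gives \<open>\<partial>\<^sub>j \<partial>\<^sub>i u v\<close>
  against \<open>\<nu>\<^sub>i\<^sub>j\<close>, whereas the claim has
  \<open>\<partial>\<^sub>i u \<partial>\<^sub>j v\<close>. The sum of both is
  \<open>\<partial>\<^sub>j (\<partial>\<^sub>i u v)\<close>, a function of
  \<open>\<partial>\<^sub>i u v\<close> alone, so the discrepancy belongs to
  \<open>\<Psi>\<^sub>i\<close>.

  The set \<open>U^\<delta>\<close> guarantees that the points within \<delta> of a support form a
  compact subset of \<open>U\<close>.\<close>

lemma sum_lessThan_add:
  fixes h :: "nat \<Rightarrow> real"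
  shows "(\<Sum>k<n+m. h k) = (\<Sum>k<n. h k) + (\<Sum>k<m. h (n + k))"
  by (induction m) auto

lemma pderivs_append: "pderivs (bs @ cs) f = pderivs bs (pderivs cs f)"
  by (induction bs) auto

lemma smooth_differentiable: "smooth_fun f \<Longrightarrow> f differentiable (at x)"
  unfolding smooth_fun_def by (metis empty_set empty_subsetI pderivs.simps(1))

lemma smooth_pderivs:
  assumes "smooth_fun f" "set bs \<subseteq> Basis"
  shows "smooth_fun (pderivs bs f)"
  unfolding smooth_fun_def
proof (intro allI impI)
  fix cs x assume "set cs \<subseteq> (Basis::'a set)"
  then show "pderivs cs (pderivs bs f) differentiable at x"
    using assms unfolding smooth_fun_def pderivs_append[symmetric] by (metis le_sup_iff set_append)
qed

lemma smooth_pd: "smooth_fun f \<Longrightarrow> b \<in> Basis \<Longrightarrow> smooth_fun (pd b f)"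
  using smooth_pderivs[of f "[b]"] by simp

text \<open>Induction on the list of directions keeps every iterated derivative in \<open>S\<close>.
  Smoothness thus reduces to exhibiting an invariant class, with no formula for higher
  derivatives.\<close>

lemma smooth_coinduct:
  assumes "f \<in> S"
    and "\<And>f x. f \<in> S \<Longrightarrow> f differentiable (at x)"
    and "\<And>f b. f \<in> S \<Longrightarrow> b \<in> Basis \<Longrightarrow> pd b f \<in> S"
  shows "smooth_fun f"
proof -
  have "pderivs bs f \<in> S" if "set bs \<subseteq> Basis" for bs
    using that by (induction bs) (auto simp: assms)
  then show ?thesis unfolding smooth_fun_def using assms(2) by blast
qed

lemma has_derivative_pd: "(f has_derivative D) (at x) \<Longrightarrow> pd b f x = D b"
  unfolding pd_def by (metis frechet_derivative_at)

lemma smooth_has_derivative: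
  "smooth_fun f \<Longrightarrow> (f has_derivative (\<lambda>h. \<Sum>i\<in>Basis. (h \<bullet> i) * pd i f x)) (at x)"
proof -
  assume "smooth_fun f"
  then have d: "f differentiable (at x)" by (rule smooth_differentiable)
  then have l: "linear (frechet_derivative f (at x))" by (rule linear_frechet_derivative)
  have "frechet_derivative f (at x) h = (\<Sum>i\<in>Basis. (h \<bullet> i) * pd i f x)" for h
  proof -
    have "frechet_derivative f (at x) h = frechet_derivative f (at x) (\<Sum>i\<in>Basis. (h \<bullet> i) *\<^sub>R i)"
      by (simp add: euclidean_representation)
    also have "\<dots> = (\<Sum>i\<in>Basis. (h \<bullet> i) * pd i f x)"
      by (simp add: linear_sum[OF l] linear_cmul[OF l] pd_def)
    finally show ?thesis .
  qed
  then show ?thesis using d frechet_derivative_works by (metis (no_types, lifting) ext)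
qed

lemma smooth_continuous: "smooth_fun f \<Longrightarrow> continuous_on S f"
  by (meson smooth_differentiable differentiable_imp_continuous_within continuous_at_imp_continuous_on)

lemma differentiable_pd_add:
  assumes "\<And>x. f differentiable (at x)" "\<And>x. g differentiable (at x)"
  shows "pd b (\<lambda>x. f x + g x) = (\<lambda>x. pd b f x + pd b g x)"
proof
  fix x
  have "(f has_derivative frechet_derivative f (at x)) (at x)"
    "(g has_derivative frechet_derivative g (at x)) (at x)"
    using assms frechet_derivative_works by blast+
  from has_derivative_pd[OF has_derivative_add[OF this]]
  show "pd b (\<lambda>x. f x + g x) x = pd b f x + pd b g x" by (simp add: pd_def)
qed

lemma pd_add: "smooth_fun f \<Longrightarrow> smooth_fun g \<Longrightarrow> pd b (\<lambda>x. f x + g x) = (\<lambda>x. pd b f x + pd b g x)"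
  by (intro differentiable_pd_add smooth_differentiable)

lemma pd_mult: "smooth_fun f \<Longrightarrow> smooth_fun g \<Longrightarrow>
  pd b (\<lambda>x. f x * g x) = (\<lambda>x. pd b f x * g x + f x * pd b g x)"
proof
  fix x assume "smooth_fun f" "smooth_fun g"
  then have "(f has_derivative frechet_derivative f (at x)) (at x)"
    "(g has_derivative frechet_derivative g (at x)) (at x)"
    using smooth_differentiable frechet_derivative_works by blast+
  from has_derivative_pd[OF has_derivative_mult[OF this]]
  show "pd b (\<lambda>x. f x * g x) x = pd b f x * g x + f x * pd b g x" by (simp add: pd_def)
qed

lemma pd_const: "pd b (\<lambda>x. c) = (\<lambda>x. 0)"
  by (auto simp: pd_def)

lemma pd_inner: "pd b (\<lambda>x. (x - a) \<bullet> i) = (\<lambda>x. b \<bullet> i)"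
proof
  fix x
  have "((\<lambda>x. (x - a) \<bullet> i) has_derivative (\<lambda>h. h \<bullet> i)) (at x)"
    by (auto intro!: derivative_eq_intros)
  then show "pd b (\<lambda>x. (x - a) \<bullet> i) x = b \<bullet> i" by (rule has_derivative_pd)
qed

lemma smooth_const [simp]: "smooth_fun (\<lambda>x::'a::euclidean_space. c)"
  by (rule smooth_coinduct[where S="{f. \<exists>c. f = (\<lambda>x. c)}"]) (auto simp: pd_const)

lemma smooth_inner [simp]: "smooth_fun (\<lambda>x. (x - a) \<bullet> i)"
  by (rule smooth_coinduct[where S="insert (\<lambda>x. (x - a) \<bullet> i) {f. \<exists>c. f = (\<lambda>x. c)}"])
     (auto simp: pd_const pd_inner intro!: derivative_intros)

lemma smooth_inner' [simp]: "smooth_fun (\<lambda>x. x \<bullet> i)"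
  using smooth_inner[of 0 i] by simp

lemma smooth_add:
  assumes "smooth_fun f" "smooth_fun g" shows "smooth_fun (\<lambda>x. f x + g x)"
proof (rule smooth_coinduct[where S="{h. \<exists>f g. smooth_fun f \<and> smooth_fun g \<and> h = (\<lambda>x. f x + g x)}"], goal_cases)
  case 1 then show ?case using assms by blast
next
  case (2 h x)
  then show ?case by (auto intro!: differentiable_add intro: smooth_differentiable)
next
  case (3 h b)
  then obtain f g where fg: "smooth_fun f" "smooth_fun g" "h = (\<lambda>x. f x + g x)" by auto
  have "smooth_fun (pd b f)" "smooth_fun (pd b g)" using fg 3 smooth_pd by auto
  moreover have "pd b h = (\<lambda>x. pd b f x + pd b g x)" unfolding fg(3) by (rule pd_add[OF fg(1,2)])
  ultimately show ?case by blast
qed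

text \<open>The product, chain and quotient rules produce a sum of two functions of the natural
  class, not a member of it. The finite sums of members of \<open>S\<close> do form a class closed
  under \<open>pd\<close>, to which \<open>smooth_coinduct\<close> applies.\<close>

lemma smooth_coinduct_add:
  assumes "f \<in> S"
    and d: "\<And>f x. f \<in> S \<Longrightarrow> f differentiable (at x)"
    and p: "\<And>f b. f \<in> S \<Longrightarrow> b \<in> Basis \<Longrightarrow> \<exists>g\<in>S. \<exists>h\<in>S. pd b f = (\<lambda>x. g x + h x)"
  shows "smooth_fun f"
proof -
  define C where "C = {f. \<exists>n::nat. \<exists>g. (\<forall>k<n. g k \<in> S) \<and> f = (\<lambda>x. \<Sum>k<n. g k x)}"
  have Cadd: "(\<lambda>x. g x + h x) \<in> C" if gh: "g \<in> C" "h \<in> C" for g h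
  proof -
    obtain n s where s: "\<forall>k<n. s k \<in> S" "g = (\<lambda>x. \<Sum>k<n::nat. s k x)"
      using gh(1) unfolding C_def mem_Collect_eq by (elim exE conjE)
    obtain m t where t: "\<forall>k<m. t k \<in> S" "h = (\<lambda>x. \<Sum>k<m::nat. t k x)"
      using gh(2) unfolding C_def mem_Collect_eq by (elim exE conjE)
    define r where "r k = (if k < n then s k else t (k - n))" for k
    have "g x + h x = (\<Sum>k<n+m. r k x)" for x
      unfolding sum_lessThan_add by (simp add: s t r_def)
    moreover have "\<forall>k<n+m. r k \<in> S" using s t by (auto simp: r_def)
    ultimately show ?thesis unfolding C_def by blast
  qed
  have SC: "g \<in> C" if "g \<in> S" for g
    unfolding C_def using that by (auto intro!: exI[of _ "1::nat"] exI[of _ "\<lambda>_. g"])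
  have Cd: "g differentiable (at x)" if "g \<in> C" for g x
    using that d unfolding C_def by (auto intro!: differentiable_sum)
  have "pd b (\<lambda>x. \<Sum>k<n. g k x) \<in> C" if "\<forall>k<n::nat. g k \<in> S" "b \<in> Basis" for b n g
    using that
  proof (induction n)
    case 0
    then show ?case by (auto simp: pd_const C_def intro!: exI[of _ "0::nat"])
  next
    case (Suc n)
    have "pd b (\<lambda>x. (\<Sum>k<n. g k x) + g n x) = (\<lambda>x. pd b (\<lambda>x. \<Sum>k<n. g k x) x + pd b (g n) x)"
      by (rule differentiable_pd_add) (use Suc d in \<open>auto intro!: differentiable_sum\<close>)
    moreover obtain g1 h1 where "g1 \<in> S" "h1 \<in> S" "pd b (g n) = (\<lambda>x. g1 x + h1 x)"
      using p[of "g n" b] Suc by auto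
    ultimately show ?case using Suc Cadd SC by auto
  qed
  then have Cp: "pd b g \<in> C" if "g \<in> C" "b \<in> Basis" for g b
    using that unfolding C_def by blast
  show ?thesis
    by (rule smooth_coinduct[where S=C]) (use SC assms(1) Cd Cp in auto)
qed

lemma smooth_mult:
  assumes "smooth_fun f" "smooth_fun g" shows "smooth_fun (\<lambda>x. f x * g x)"
proof (rule smooth_coinduct_add[where S="{h. \<exists>f g. smooth_fun f \<and> smooth_fun g \<and> h = (\<lambda>x. f x * g x)}"], goal_cases)
  case 1 then show ?case using assms by blast
next
  case (2 h x) then show ?case by (auto intro!: differentiable_mult intro: smooth_differentiable)
next
  case (3 h b)
  then obtain f g where fg: "smooth_fun f" "smooth_fun g" "h = (\<lambda>x. f x * g x)" by auto
  have "smooth_fun (pd b f)" "smooth_fun (pd b g)" using fg 3 smooth_pd by auto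
  then have "(\<lambda>x. pd b f x * g x) \<in> {h. \<exists>f g. smooth_fun f \<and> smooth_fun g \<and> h = (\<lambda>x. f x * g x)}"
    "(\<lambda>x. f x * pd b g x) \<in> {h. \<exists>f g. smooth_fun f \<and> smooth_fun g \<and> h = (\<lambda>x. f x * g x)}"
    using fg by blast+
  then show ?case unfolding fg(3) pd_mult[OF fg(1,2)]
    by (intro bexI[of _ "\<lambda>x. pd b f x * g x"] bexI[of _ "\<lambda>x. f x * pd b g x"] refl)
qed

lemma smooth_cmult: "smooth_fun f \<Longrightarrow> smooth_fun (\<lambda>x. c * f x)"
  by (rule smooth_mult) auto

lemma smooth_minus: "smooth_fun f \<Longrightarrow> smooth_fun (\<lambda>x. - f x)"
  using smooth_cmult[of f "-1"] by simp

lemma smooth_diff: "smooth_fun f \<Longrightarrow> smooth_fun g \<Longrightarrow> smooth_fun (\<lambda>x. f x - g x)"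
  using smooth_add[OF _ smooth_minus, of f g] by simp

lemma smooth_sum: "(\<And>k. k \<in> A \<Longrightarrow> smooth_fun (f k)) \<Longrightarrow> smooth_fun (\<lambda>x. \<Sum>k\<in>A. f k x)"
  by (induction A rule: infinite_finite_induct) (auto intro: smooth_add)

lemma smooth_prod: "(\<And>k. k \<in> A \<Longrightarrow> smooth_fun (f k)) \<Longrightarrow> smooth_fun (\<lambda>x. \<Prod>k\<in>A. f k x)"
  by (induction A rule: infinite_finite_induct) (auto intro: smooth_mult)

lemma pd_cmult: "smooth_fun f \<Longrightarrow> pd b (\<lambda>x. c * f x) = (\<lambda>x. c * pd b f x)"
  by (simp add: pd_mult pd_const)

lemma pd_compose:
  fixes H :: "real \<Rightarrow> real"
  assumes "smooth_fun H" "smooth_fun f"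
  shows "pd b (\<lambda>x. H (f x)) = (\<lambda>x. pd 1 H (f x) * pd b f x)"
proof
  fix x
  have "(f has_derivative frechet_derivative f (at x)) (at x)"
    using assms smooth_differentiable frechet_derivative_works by blast
  moreover have "(H has_derivative (\<lambda>h. h * pd 1 H (f x))) (at (f x))"
    using smooth_has_derivative[OF assms(1)] by simp
  ultimately have "((\<lambda>x. H (f x)) has_derivative (\<lambda>h. frechet_derivative f (at x) h * pd 1 H (f x))) (at x)"
    by (rule has_derivative_compose)
  from has_derivative_pd[OF this]
  show "pd b (\<lambda>x. H (f x)) x = pd 1 H (f x) * pd b f x" by (simp add: pd_def)
qed

lemma differentiable_compose_smooth:
  fixes H :: "real \<Rightarrow> real"
  assumes "smooth_fun H" "smooth_fun f"
  shows "(\<lambda>x. H (f x)) differentiable at x"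
proof -
  have "(H \<circ> f) differentiable at x"
    by (intro differentiable_chain_at smooth_differentiable assms)
  then show ?thesis by (simp add: comp_def)
qed

text \<open>The class consists of the products \<open>H (f x) * g x\<close> with \<open>f\<close>
  fixed: the factor \<open>pd b f\<close> that the chain rule takes out is absorbed by
  \<open>g\<close>.\<close>

lemma smooth_compose:
  fixes H :: "real \<Rightarrow> real"
  assumes H0: "smooth_fun H" and f: "smooth_fun f"
  shows "smooth_fun (\<lambda>x. H (f x))"
proof -
  define S where "S = {h. \<exists>H g. smooth_fun H \<and> smooth_fun g \<and> h = (\<lambda>x. H (f x) * g x)}"
  have S: "(\<lambda>x. H (f x) * g x) \<in> S" if "smooth_fun H" "smooth_fun g" for H g
    unfolding S_def using that by (intro CollectI exI[of _ H] exI[of _ g] conjI refl)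
  show ?thesis
  proof (rule smooth_coinduct_add[where S=S])
    show "(\<lambda>x. H (f x)) \<in> S" using S[OF H0 smooth_const[of 1]] by simp
  next
    fix h x assume "h \<in> S"
    then obtain H g where H: "smooth_fun H" "smooth_fun g" "h = (\<lambda>x. H (f x) * g x)"
      unfolding S_def by auto
    show "h differentiable at x"
      unfolding H(3) by (intro differentiable_mult differentiable_compose_smooth smooth_differentiable H f)
  next
    fix h and b :: 'a assume "h \<in> S" and b: "b \<in> Basis"
    then obtain H g where H: "smooth_fun H" "smooth_fun g" "h = (\<lambda>x. H (f x) * g x)"
      unfolding S_def by auto
    have eq: "pd b h = (\<lambda>x. pd 1 H (f x) * (pd b f x * g x) + H (f x) * pd b g x)"
    proof
      fix x
      have "((\<lambda>x. H (f x)) has_derivative frechet_derivative (\<lambda>x. H (f x)) (at x)) (at x)"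
        "(g has_derivative frechet_derivative g (at x)) (at x)"
        using differentiable_compose_smooth[OF H(1) f] smooth_differentiable[OF H(2)]
        by (simp_all add: frechet_derivative_works)
      from has_derivative_pd[OF has_derivative_mult[OF this], of b]
      have "pd b h x = pd b (\<lambda>x. H (f x)) x * g x + H (f x) * pd b g x" by (simp add: H(3) pd_def)
      then show "pd b h x = pd 1 H (f x) * (pd b f x * g x) + H (f x) * pd b g x"
        by (simp add: pd_compose[OF H(1) f])
    qed
    have "(\<lambda>x. pd 1 H (f x) * (pd b f x * g x)) \<in> S" "(\<lambda>x. H (f x) * pd b g x) \<in> S"
      using H f b by (auto intro!: S smooth_pd smooth_mult)
    then show "\<exists>g\<in>S. \<exists>k\<in>S. pd b h = (\<lambda>x. g x + k x)"
      unfolding eq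
      by (intro bexI[of _ "\<lambda>x. pd 1 H (f x) * (pd b f x * g x)"] bexI[of _ "\<lambda>x. H (f x) * pd b g x"] refl)
  qed
qed

text \<open>Each derivative raises the power of \<open>d\<close> in the denominator, so the class
  contains the quotients by all powers of \<open>d\<close>.\<close>

lemma smooth_divide:
  assumes f: "smooth_fun f" and d: "smooth_fun d" and nz: "\<And>x. d x \<noteq> 0"
  shows "smooth_fun (\<lambda>x. f x / d x)"
proof (rule smooth_coinduct_add[where S="{h. \<exists>n g. smooth_fun g \<and> h = (\<lambda>x. g x / d x ^ n)}"], goal_cases)
  case 1 then show ?case using f by (auto intro!: exI[of _ "1::nat"] exI[of _ f])
next
  case (2 h x)
  then show ?case using nz d by (auto intro!: differentiable_divide differentiable_power intro: smooth_differentiable)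
next
  case (3 h b)
  then obtain n g where g: "smooth_fun g" "h = (\<lambda>x. g x / d x ^ n)" by auto
  have p: "pd b h x = pd b g x / d x ^ n + (- real n * g x * pd b d x) / d x ^ Suc n" for x
  proof -
    obtain G D where G: "(g has_derivative G) (at x)" and D: "(d has_derivative D) (at x)"
      using smooth_differentiable[OF d] smooth_differentiable[OF g(1)] unfolding differentiable_def by blast
    have "((\<lambda>x. d x ^ n) has_derivative (\<lambda>y. of_nat n * D y * d x ^ (n - 1))) (at x)"
      by (rule has_derivative_power[OF D])
    from has_derivative_divide'[OF G this]
    have "(h has_derivative (\<lambda>y. (G y * d x ^ n - g x * (of_nat n * D y * d x ^ (n - 1))) / (d x ^ n * d x ^ n))) (at x)"
      unfolding g using nz by simp
    from has_derivative_pd[OF this, of b]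
    have "pd b h x = (G b * d x ^ n - g x * (of_nat n * D b * d x ^ (n - 1))) / (d x ^ n * d x ^ n)" .
    also have "\<dots> = G b / d x ^ n + (- real n * g x * D b) / d x ^ Suc n"
      using nz[of x] by (cases n) (auto simp: field_simps)
    finally show ?thesis by (simp only: has_derivative_pd[OF G] has_derivative_pd[OF D])
  qed
  define A where "A = (\<lambda>x. pd b g x / d x ^ n)"
  define B where "B = (\<lambda>x. (- real n * g x * pd b d x) / d x ^ Suc n)"
  have "pd b h = (\<lambda>x. A x + B x)" using p by (simp add: A_def B_def fun_eq_iff)
  moreover have "A \<in> {h. \<exists>n g. smooth_fun g \<and> h = (\<lambda>x. g x / d x ^ n)}"
    unfolding A_def using smooth_pd[OF g(1) 3(2)] by blast
  moreover have "smooth_fun (\<lambda>x. - real n * g x * pd b d x)"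
    using g(1) d 3(2) by (intro smooth_mult smooth_pd smooth_const)
  then have "B \<in> {h. \<exists>n g. smooth_fun g \<and> h = (\<lambda>x. g x / d x ^ n)}"
    unfolding B_def by blast
  ultimately show ?case by (intro bexI[of _ A] bexI[of _ B])
qed

section \<open>A smooth step function built from \<open>exp (- 1 / t)\<close>\<close>

definition flat_exp :: "real poly \<Rightarrow> real \<Rightarrow> real" where
  "flat_exp p t = (if t > 0 then poly p (1 / t) * exp (- 1 / t) else 0)"

lemma poly_exp_tendsto_0: "((\<lambda>s::real. poly p s * exp (- s)) \<longlongrightarrow> 0) at_top"
proof (induction p)
  case 0 then show ?case by simp
next
  case (pCons a p)
  have "((\<lambda>s::real. s ^ n / exp s) \<longlongrightarrow> 0) at_top" for n by (rule tendsto_power_div_exp_0)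
  have *: "((\<lambda>s::real. poly q s / exp s) \<longlongrightarrow> 0) at_top" for q :: "real poly"
    unfolding poly_altdef sum_divide_distrib times_divide_eq_right[symmetric]
    by (intro tendsto_null_sum tendsto_mult_right_zero tendsto_power_div_exp_0)
  show ?case using *[of "pCons a p"] by (simp add: exp_minus field_simps)
qed

text \<open>With \<open>s = 1 / t\<close>, the derivative in \<open>t\<close> of
  \<open>p(s) exp(- s)\<close> is \<open>s\<^sup>2 (p(s) - p'(s)) exp(- s)\<close>; the polynomial
  parameter makes the family closed under differentiation. At 0 the left difference quotients
  vanish, and the right ones are a polynomial in \<open>s\<close> times \<open>exp(- s)\<close> with
  \<open>s\<close> tending to infinity.\<close>

lemma flat_exp_has_derivative:
  "(flat_exp p has_real_derivative flat_exp (monom 1 2 * (p - pderiv p)) t) (at t)"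
proof -
  consider "t > 0" | "t < 0" | "t = 0" by linarith
  then show ?thesis
  proof cases
    case 1
    have i: "((\<lambda>t::real. 1 / t) has_real_derivative - (1 / t\<^sup>2)) (at t)"
      using 1 by (auto intro!: derivative_eq_intros simp: power2_eq_square)
    have "((\<lambda>t. exp (- (1 / t))) has_real_derivative exp (- (1 / t)) * (1 / t\<^sup>2)) (at t)"
      using DERIV_fun_exp[OF DERIV_minus[OF i]] by simp
    from DERIV_mult[OF DERIV_chain2[OF poly_DERIV[of p] i] this]
    have "((\<lambda>t. poly p (1 / t) * exp (- (1 / t))) has_real_derivative flat_exp (monom 1 2 * (p - pderiv p)) t) (at t)"
      by (rule DERIV_cong) (use 1 in \<open>simp add: flat_exp_def poly_monom field_simps\<close>)
    moreover have "eventually (\<lambda>s. flat_exp p s = poly p (1 / s) * exp (- (1 / s))) (nhds t)"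
      using eventually_nhds_in_open[of "{0<..}" t] 1 by (auto simp: flat_exp_def elim: eventually_mono)
    ultimately show ?thesis by (subst DERIV_cong_ev[OF refl _ refl])
  next
    case 2
    have "eventually (\<lambda>s. flat_exp p s = 0) (nhds t)"
      using eventually_nhds_in_open[of "{..<0}" t] 2 by (auto simp: flat_exp_def elim: eventually_mono)
    moreover have "((\<lambda>s. 0) has_real_derivative flat_exp (monom 1 2 * (p - pderiv p)) t) (at t)"
      using 2 by (simp add: flat_exp_def)
    ultimately show ?thesis by (subst DERIV_cong_ev[OF refl _ refl])
  next
    case 3
    have r: "((\<lambda>s. flat_exp p s / s) \<longlongrightarrow> 0) (at_right 0)"
    proof -
      have "((\<lambda>s. poly (pCons 0 p) (inverse s) * exp (- inverse s)) \<longlongrightarrow> 0) (at_right (0::real))"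
        by (rule filterlim_compose[OF poly_exp_tendsto_0 filterlim_inverse_at_top_right])
      moreover have "eventually (\<lambda>s. poly (pCons 0 p) (inverse s) * exp (- inverse s) = flat_exp p s / s) (at_right (0::real))"
        unfolding eventually_at_filter
        by (rule always_eventually) (simp add: flat_exp_def field_simps)
      ultimately show ?thesis by (rule Lim_transform_eventually)
    qed
    have l: "((\<lambda>s. flat_exp p s / s) \<longlongrightarrow> 0) (at_left 0)"
    proof (rule Lim_transform_eventually[OF tendsto_const])
      show "eventually (\<lambda>s. 0 = flat_exp p s / s) (at_left (0::real))"
        unfolding eventually_at_filter
        by (rule always_eventually) (simp add: flat_exp_def)
    qed
    have "((\<lambda>s. flat_exp p s / s) \<longlongrightarrow> 0) (at 0)" using l r filterlim_split_at_real by blast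
    then have "(flat_exp p has_real_derivative 0) (at 0)"
      unfolding DERIV_def by (simp add: flat_exp_def[of _ 0])
    then show ?thesis unfolding 3 by (simp add: flat_exp_def[of _ 0])
  qed
qed

lemma has_real_derivative_pd: "(f has_real_derivative d) (at t) \<Longrightarrow> pd 1 f t = d"
  unfolding has_field_derivative_def by (drule has_derivative_pd[where b=1]) simp

lemma smooth_flat_exp: "smooth_fun (flat_exp p)"
proof (rule smooth_coinduct[where S="range flat_exp"], goal_cases)
  case (2 f x) then show ?case using flat_exp_has_derivative real_differentiable_def by blast
next
  case (3 f b)
  then obtain p where "f = flat_exp p" by auto
  then have "pd 1 f = flat_exp (monom 1 2 * (p - pderiv p))"
    using has_real_derivative_pd[OF flat_exp_has_derivative] by auto
  then show ?case using 3 by auto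
qed auto

definition smooth_step :: "real \<Rightarrow> real" where
  "smooth_step t = flat_exp 1 t / (flat_exp 1 t + flat_exp 1 (1 - t))"

lemma flat_exp_1: "flat_exp 1 t \<ge> 0" "t > 0 \<Longrightarrow> flat_exp 1 t > 0" "t \<le> 0 \<Longrightarrow> flat_exp 1 t = 0"
  by (auto simp: flat_exp_def)

lemma smooth_step_denom: "flat_exp 1 t + flat_exp 1 (1 - t) > 0"
  using flat_exp_1[of t] flat_exp_1[of "1 - t"] by (cases "t > 0") (auto intro: add_pos_nonneg add_nonneg_pos)

lemma smooth_step:
  "smooth_fun smooth_step" "0 \<le> smooth_step t" "smooth_step t \<le> 1"
  "t \<le> 0 \<Longrightarrow> smooth_step t = 0" "t \<ge> 1 \<Longrightarrow> smooth_step t = 1"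
proof -
  have "smooth_fun (\<lambda>t::real. 1 - t)" using smooth_diff[OF smooth_const[of 1] smooth_inner'[of "1::real"]] by simp
  then have "smooth_fun (\<lambda>t. flat_exp 1 (1 - t))" by (rule smooth_compose[OF smooth_flat_exp])
  then show "smooth_fun smooth_step" unfolding smooth_step_def[abs_def]
    by (intro smooth_divide smooth_add smooth_flat_exp) (simp_all add: smooth_step_denom less_imp_neq[symmetric])
  show "0 \<le> smooth_step t" "smooth_step t \<le> 1"
    using smooth_step_denom[of t] flat_exp_1(1)[of t] flat_exp_1(1)[of "1-t"]
    by (auto simp: smooth_step_def field_simps)
  show "smooth_step t = 0" if "t \<le> 0" using flat_exp_1(3)[OF that] by (simp add: smooth_step_def)
  show "smooth_step t = 1" if "t \<ge> 1"
    using smooth_step_denom[of t] flat_exp_1(3)[of "1 - t"] that by (simp add: smooth_step_def)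
qed

section \<open>Compactly supported smooth functions\<close>

lemma fsupp_subset: "closed F \<Longrightarrow> (\<And>x. x \<notin> F \<Longrightarrow> f x = 0) \<Longrightarrow> fsupp f \<subseteq> F"
  unfolding fsupp_def by (rule closure_minimal) auto

lemma notin_fsupp: "x \<notin> fsupp f \<Longrightarrow> f x = 0"
  unfolding fsupp_def using closure_subset[of "{x. f x \<noteq> 0}"] by blast

lemma closed_fsupp [simp]: "closed (fsupp f)"
  by (simp add: fsupp_def)

lemma C0infI:
  assumes "smooth_fun f" "compact F" "F \<subseteq> U" "\<And>x. x \<notin> F \<Longrightarrow> f x = 0"
  shows "f \<in> C0inf U"
proof -
  have "fsupp f \<subseteq> F" using assms compact_imp_closed by (intro fsupp_subset) auto
  then have "compact (fsupp f)" using assms(2) closed_fsupp compact_Int_closed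
    by (metis inf.absorb_iff2)
  then show ?thesis using assms \<open>fsupp f \<subseteq> F\<close> by (auto simp: C0inf_def)
qed

lemma C0infD:
  assumes "f \<in> C0inf U"
  shows "smooth_fun f" "compact (fsupp f)" "fsupp f \<subseteq> U" "x \<notin> fsupp f \<Longrightarrow> f x = 0" "x \<notin> U \<Longrightarrow> f x = 0"
  using assms notin_fsupp by (auto simp: C0inf_def)

lemma C0inf_mono: "U \<subseteq> V \<Longrightarrow> f \<in> C0inf U \<Longrightarrow> f \<in> C0inf V"
  by (auto simp: C0inf_def)

lemma C0inf_mult: "f \<in> C0inf U \<Longrightarrow> smooth_fun g \<Longrightarrow> (\<lambda>x. f x * g x) \<in> C0inf U"
  by (rule C0infI[where F="fsupp f"]) (auto simp: C0infD intro!: smooth_mult)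

lemma C0inf_mult': "f \<in> C0inf U \<Longrightarrow> smooth_fun g \<Longrightarrow> (\<lambda>x. g x * f x) \<in> C0inf U"
  by (rule C0infI[where F="fsupp f"]) (auto simp: C0infD intro!: smooth_mult)

lemma C0inf_cmult: "f \<in> C0inf U \<Longrightarrow> (\<lambda>x. c * f x) \<in> C0inf U"
  by (rule C0inf_mult') auto

lemma C0inf_add: "f \<in> C0inf U \<Longrightarrow> g \<in> C0inf U \<Longrightarrow> (\<lambda>x. f x + g x) \<in> C0inf U"
  by (rule C0infI[where F="fsupp f \<union> fsupp g"]) (auto simp: C0infD intro!: smooth_add)

lemma C0inf_diff: "f \<in> C0inf U \<Longrightarrow> g \<in> C0inf U \<Longrightarrow> (\<lambda>x. f x - g x) \<in> C0inf U"
  using C0inf_add[OF _ C0inf_cmult[of g U "-1"], of f] by simp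

lemma C0inf_zero [simp]: "(\<lambda>x. 0) \<in> C0inf U"
  by (rule C0infI[where F="{}"]) auto

lemma C0inf_sum: "(\<And>k. k \<in> A \<Longrightarrow> f k \<in> C0inf U) \<Longrightarrow> (\<lambda>x. \<Sum>k\<in>A. f k x) \<in> C0inf U"
  by (induction A rule: infinite_finite_induct) (auto intro: C0inf_add)

lemma C0inf_pd:
  assumes "f \<in> C0inf U" "b \<in> Basis" shows "pd b f \<in> C0inf U"
proof (rule C0infI[where F="fsupp f"])
  show "smooth_fun (pd b f)" using assms by (auto intro: smooth_pd simp: C0infD)
  fix x assume x: "x \<notin> fsupp f"
  have "(f has_derivative (\<lambda>h. 0)) (at x)"
    by (rule has_derivative_transform_within_open[OF has_derivative_const[of 0] open_Compl[OF closed_fsupp[of f]]])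
      (use x in \<open>auto simp: notin_fsupp\<close>)
  then show "pd b f x = 0" by (rule has_derivative_pd)
qed (use assms in \<open>auto simp: C0infD\<close>)

lemma C0inf_continuous: "f \<in> C0inf U \<Longrightarrow> continuous_on S f"
  using C0infD(1) smooth_continuous by blast

lemma C0inf_measurable [measurable_dest]: "f \<in> C0inf U \<Longrightarrow> f \<in> borel_measurable borel"
  by (rule borel_measurable_continuous_onI[OF C0inf_continuous])

lemma C0inf_bounded:
  assumes "f \<in> C0inf U" shows "\<exists>B>0. \<forall>x. \<bar>f x\<bar> \<le> B"
proof -
  have "compact (f ` fsupp f)"
    using assms by (intro compact_continuous_image C0inf_continuous C0infD(2))
  then obtain B where B: "B > 0" "\<forall>y\<in>f ` fsupp f. \<bar>y\<bar> \<le> B"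
    using bounded_pos compact_imp_bounded by (metis real_norm_def)
  have "\<bar>f x\<bar> \<le> B" for x
    using B notin_fsupp[of x f] by (cases "x \<in> fsupp f") auto
  then show ?thesis using B by blast
qed

lemma smooth_bump:
  fixes a :: "'a::euclidean_space"
  assumes r: "r > 0"
  obtains f where "smooth_fun f" "\<And>x. 0 \<le> f x" "\<And>x. f x \<le> 1" "\<And>x. dist a x \<le> r \<Longrightarrow> f x = 1"
    "\<And>x. dist a x \<ge> 2 * r \<Longrightarrow> f x = 0"
proof
  \<comment> \<open>The squared distance, unlike the distance, is smooth at \<open>a\<close>. The
    normalisation gives \<open>q\<close> the value 1 at distance \<open>r\<close> and 0 at distance
    \<open>2 * r\<close>, the thresholds beyond which \<open>smooth_step\<close> is
    constant.\<close>
  define q where "q x = (4 * r\<^sup>2 - (\<Sum>i\<in>Basis. ((x - a) \<bullet> i) * ((x - a) \<bullet> i))) * (1 / (3 * r\<^sup>2))" for x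
  have q: "q x = (4 * r\<^sup>2 - (dist a x)\<^sup>2) / (3 * r\<^sup>2)" for x
    by (simp add: q_def euclidean_inner[symmetric] dist_norm norm_minus_commute dot_square_norm)
  have "smooth_fun q" unfolding q_def[abs_def]
    by (intro smooth_mult smooth_diff smooth_const smooth_sum smooth_inner)
  then show "smooth_fun (\<lambda>x. smooth_step (q x))" by (rule smooth_compose[OF smooth_step(1)])
  show "smooth_step (q x) = 1" if "dist a x \<le> r" for x
  proof (rule smooth_step(5))
    have "(dist a x)\<^sup>2 \<le> r\<^sup>2" using that by (intro power_mono) auto
    then show "1 \<le> q x" using r by (simp add: q field_simps)
  qed
  show "smooth_step (q x) = 0" if "dist a x \<ge> 2 * r" for x
  proof (rule smooth_step(4))
    have "(2 * r)\<^sup>2 \<le> (dist a x)\<^sup>2" using that r by (intro power_mono) auto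
    then show "q x \<le> 0" using r by (auto simp: q field_simps)
  qed
qed (auto simp: smooth_step)

lemma sum_prod_telescope:
  fixes a :: "nat \<Rightarrow> real"
  shows "(\<Sum>k<n. a k * (\<Prod>j<k. 1 - a j)) = 1 - (\<Prod>j<n. 1 - a j)"
  by (induction n) (auto simp: algebra_simps)

text \<open>Bumps \<open>a k\<close> equal to 1 on small balls become a partition through
  \<open>a k * (\<Prod>j<k. 1 - a j)\<close>, whose sum telescopes to
  \<open>1 - (\<Prod>j<n. 1 - a j)\<close>. Without any division, the sum is at most 1 everywhere,
  and it is 1 on the union of the small balls, where some factor of the product vanishes.\<close>

lemma smooth_partition:
  fixes F :: "'a::euclidean_space set"
  assumes F: "compact F" "F \<subseteq> \<Union>\<O>" and op: "\<And>V. V \<in> \<O> \<Longrightarrow> open V"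
  obtains n :: nat and \<psi> W where "\<And>k. k < n \<Longrightarrow> \<exists>V\<in>\<O>. \<psi> k \<in> C0inf V" "\<And>k x. 0 \<le> \<psi> k x"
    "\<And>x. (\<Sum>k<n. \<psi> k x) \<le> 1" "open W" "F \<subseteq> W" "\<And>x. x \<in> W \<Longrightarrow> (\<Sum>k<n. \<psi> k x) = 1"
proof -
  have "\<exists>r>0. \<exists>V\<in>\<O>. cball x (2 * r) \<subseteq> V" if xF: "x \<in> F" for x
  proof -
    obtain V where V: "V \<in> \<O>" "x \<in> V" using F(2) xF by (meson UnionE subsetD)
    then obtain e where "e > 0" "cball x e \<subseteq> V" using op open_contains_cball by blast
    then show ?thesis using V by (intro exI[of _ "e/2"]) auto
  qed
  then obtain r where r: "\<And>x. x \<in> F \<Longrightarrow> r x > 0" "\<And>x. x \<in> F \<Longrightarrow> \<exists>V\<in>\<O>. cball x (2 * r x) \<subseteq> V"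
    by metis
  have "F \<subseteq> (\<Union>x\<in>F. ball x (r x))" using r by auto
  then obtain C where C: "C \<subseteq> F" "finite C" "F \<subseteq> (\<Union>x\<in>C. ball x (r x))"
    using compactE_image[OF F(1), of F "\<lambda>x. ball x (r x)"] by auto
  obtain n z where z: "C = z ` {i::nat. i < n}"
    using C(2) finite_imp_nat_seg_image_inj_on by metis
  have zF: "z k \<in> F" if "k < n" for k using z C that by auto
  have "\<forall>k. \<exists>f. k < n \<longrightarrow> smooth_fun f \<and> (\<forall>x. 0 \<le> f x) \<and> (\<forall>x. f x \<le> 1) \<and>
      (\<forall>x. dist (z k) x \<le> r (z k) \<longrightarrow> f x = 1) \<and> (\<forall>x. dist (z k) x \<ge> 2 * r (z k) \<longrightarrow> f x = 0)"
  proof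
    fix k
    show "\<exists>f. k < n \<longrightarrow> smooth_fun f \<and> (\<forall>x. 0 \<le> f x) \<and> (\<forall>x. f x \<le> 1) \<and>
      (\<forall>x. dist (z k) x \<le> r (z k) \<longrightarrow> f x = 1) \<and> (\<forall>x. dist (z k) x \<ge> 2 * r (z k) \<longrightarrow> f x = 0)"
    proof (cases "k < n")
      case True
      from smooth_bump[OF r(1)[OF zF[OF True]], of "z k"] show ?thesis by metis
    qed auto
  qed
  then obtain a0 where a0: "\<And>k. k < n \<Longrightarrow> smooth_fun (a0 k) \<and> (\<forall>x. 0 \<le> a0 k x) \<and> (\<forall>x. a0 k x \<le> 1) \<and>
      (\<forall>x. dist (z k) x \<le> r (z k) \<longrightarrow> a0 k x = 1) \<and> (\<forall>x. dist (z k) x \<ge> 2 * r (z k) \<longrightarrow> a0 k x = 0)"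
    by metis
  define a where "a k = (if k < n then a0 k else (\<lambda>x. 0))" for k
  have a: "smooth_fun (a k)" "0 \<le> a k x" "a k x \<le> 1" for k x
    using a0 by (auto simp: a_def)
  define \<psi> where "\<psi> k x = a k x * (\<Prod>j<k. 1 - a j x)" for k x
  show ?thesis
  proof
    fix k assume k: "k < n"
    obtain V where V: "V \<in> \<O>" "cball (z k) (2 * r (z k)) \<subseteq> V" using r zF k by blast
    have "\<psi> k \<in> C0inf V"
    proof (rule C0infI[where F="cball (z k) (2 * r (z k))"])
      show "smooth_fun (\<psi> k)" unfolding \<psi>_def[abs_def]
        by (intro smooth_mult smooth_prod smooth_diff smooth_const a)
      show "\<psi> k x = 0" if "x \<notin> cball (z k) (2 * r (z k))" for x
        using a0[OF k] k that by (auto simp: \<psi>_def a_def)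
    qed (use V in auto)
    then show "\<exists>V\<in>\<O>. \<psi> k \<in> C0inf V" using V by blast
  next
    fix k x show "0 \<le> \<psi> k x" unfolding \<psi>_def using a by (intro mult_nonneg_nonneg prod_nonneg) auto
  next
    fix x
    have "(\<Prod>j<n. 1 - a j x) \<ge> 0" using a by (intro prod_nonneg) auto
    then show "(\<Sum>k<n. \<psi> k x) \<le> 1" unfolding \<psi>_def sum_prod_telescope by simp
  next
    show "open (\<Union>x\<in>C. ball x (r x))" "F \<subseteq> (\<Union>x\<in>C. ball x (r x))" using C by auto
    fix x assume "x \<in> (\<Union>x\<in>C. ball x (r x))"
    then obtain k where "k < n" "dist (z k) x < r (z k)" using z by auto
    then have "(\<Prod>j<n. 1 - a j x) = 0" using a0[of k] by (auto intro!: prod_zero simp: a_def intro!: bexI[of _ k])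
    then show "(\<Sum>k<n. \<psi> k x) = 1" unfolding \<psi>_def sum_prod_telescope by simp
  qed
qed

lemma smooth_cutoff:
  fixes F :: "'a::euclidean_space set"
  assumes "compact F" "F \<subseteq> V" "open V"
  obtains \<eta> W where "\<eta> \<in> C0inf V" "\<And>x. 0 \<le> \<eta> x" "\<And>x. \<eta> x \<le> 1" "open W" "F \<subseteq> W" "\<And>x. x \<in> W \<Longrightarrow> \<eta> x = 1"
proof -
  obtain n \<psi> W where "\<And>k. k < n \<Longrightarrow> \<exists>V\<in>{V}. \<psi> k \<in> C0inf V" "\<And>k x. 0 \<le> \<psi> k x"
    "\<And>x. (\<Sum>k<n::nat. \<psi> k x) \<le> 1" "open W" "F \<subseteq> W" "\<And>x. x \<in> W \<Longrightarrow> (\<Sum>k<n. \<psi> k x) = 1"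
    using smooth_partition[OF assms(1), of "{V}"] assms by auto
  then show ?thesis by (intro that[of "\<lambda>x. \<Sum>k<n. \<psi> k x" W] C0inf_sum sum_nonneg) auto
qed

section \<open>Taylor estimates uniform in both points\<close>

lemma smooth_line_derivative:
  assumes "smooth_fun u"
  shows "((\<lambda>t. u (y + t *\<^sub>R h)) has_real_derivative (\<Sum>i\<in>Basis. (h \<bullet> i) * pd i u (y + t *\<^sub>R h))) (at t)"
proof -
  have "((\<lambda>t. y + t *\<^sub>R h) has_derivative (\<lambda>s. s *\<^sub>R h)) (at t)"
    by (auto intro!: derivative_eq_intros)
  from has_derivative_compose[OF this smooth_has_derivative[OF assms]]
  show ?thesis unfolding has_field_derivative_def
    by (rule has_derivative_eq_rhs) (simp add: fun_eq_iff sum_distrib_left mult_ac)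
qed

lemma smooth_lipschitz:
  assumes s: "smooth_fun u" and B: "\<And>i x. i \<in> Basis \<Longrightarrow> \<bar>pd i u x\<bar> \<le> B i"
  shows "\<bar>u x - u y\<bar> \<le> (\<Sum>i\<in>Basis. B i) * dist x y"
proof -
  let ?h = "x - y"
  obtain t :: real where "u (y + 1 *\<^sub>R ?h) - u (y + 0 *\<^sub>R ?h) = (1 - 0) * (\<Sum>i\<in>Basis. (?h \<bullet> i) * pd i u (y + t *\<^sub>R ?h))"
    using MVT2[of 0 1 "\<lambda>t. u (y + t *\<^sub>R ?h)", OF _ smooth_line_derivative[OF s]] by auto
  then have "\<bar>u x - u y\<bar> = \<bar>\<Sum>i\<in>Basis. (?h \<bullet> i) * pd i u (y + t *\<^sub>R ?h)\<bar>" by simp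
  also have "\<dots> \<le> (\<Sum>i\<in>Basis. dist x y * B i)"
    using B Basis_le_norm[of _ ?h]
    by (intro order_trans[OF sum_abs] sum_mono) (auto simp: abs_mult dist_norm intro!: mult_mono)
  finally show ?thesis by (simp add: sum_distrib_right mult.commute)
qed

lemma C0inf_lipschitz:
  assumes "u \<in> C0inf U"
  shows "\<exists>C\<ge>0. \<forall>x y. \<bar>u x - u y\<bar> \<le> C * dist x y"
proof -
  have "\<forall>i\<in>Basis. \<exists>B>0. \<forall>x. \<bar>pd i u x\<bar> \<le> B" using C0inf_bounded C0inf_pd assms by blast
  then obtain B where B: "\<And>i x. i \<in> Basis \<Longrightarrow> \<bar>pd i u x\<bar> \<le> B i" "\<And>i. i \<in> Basis \<Longrightarrow> B i > 0" by metis
  have "\<bar>u x - u y\<bar> \<le> (\<Sum>i\<in>Basis. B i) * dist x y" for x y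
    by (rule smooth_lipschitz[OF C0infD(1)[OF assms] B(1)])
  moreover have "(\<Sum>i\<in>Basis. B i) \<ge> 0" using B by (intro sum_nonneg) (auto intro: less_imp_le)
  ultimately show ?thesis by blast
qed

lemma C0inf_taylor1:
  assumes "u \<in> C0inf U"
  shows "\<exists>C\<ge>0. \<forall>x y. \<bar>u x - u y - (\<Sum>i\<in>Basis. ((x - y) \<bullet> i) * pd i u y)\<bar> \<le> C * (dist x y)\<^sup>2"
proof -
  have s: "smooth_fun u" using assms by (rule C0infD)
  have "\<forall>i\<in>Basis. \<exists>B\<ge>0. \<forall>x y. \<bar>pd i u x - pd i u y\<bar> \<le> B * dist x y"
    using C0inf_lipschitz C0inf_pd assms by blast
  then obtain B where B: "\<And>i x y. i \<in> Basis \<Longrightarrow> \<bar>pd i u x - pd i u y\<bar> \<le> B i * dist x y"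
    "\<And>i. i \<in> Basis \<Longrightarrow> B i \<ge> 0" by metis
  have "\<bar>u x - u y - (\<Sum>i\<in>Basis. ((x - y) \<bullet> i) * pd i u y)\<bar> \<le> (\<Sum>i\<in>Basis. B i) * (dist x y)\<^sup>2" for x y
  proof -
    let ?h = "x - y"
    obtain t :: real where t: "0 < t" "t < 1"
      "u (y + 1 *\<^sub>R ?h) - u (y + 0 *\<^sub>R ?h) = (1 - 0) * (\<Sum>i\<in>Basis. (?h \<bullet> i) * pd i u (y + t *\<^sub>R ?h))"
      using MVT2[of 0 1 "\<lambda>t. u (y + t *\<^sub>R ?h)", OF _ smooth_line_derivative[OF s]] by auto
    have "\<bar>pd i u (y + t *\<^sub>R ?h) - pd i u y\<bar> \<le> B i * dist x y" if "i \<in> Basis" for i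
    proof -
      have "dist (y + t *\<^sub>R ?h) y \<le> dist x y" using t by (simp add: dist_norm mult_left_le_one_le)
      then show ?thesis using B(1)[OF that, of "y + t *\<^sub>R ?h" y] B(2)[OF that]
        by (meson mult_left_mono order_trans)
    qed
    then have 1: "(\<Sum>i\<in>Basis. \<bar>(?h \<bullet> i) * (pd i u (y + t *\<^sub>R ?h) - pd i u y)\<bar>) \<le> (\<Sum>i\<in>Basis. dist x y * (B i * dist x y))"
      using Basis_le_norm[of _ ?h]
      by (intro sum_mono) (auto simp: abs_mult dist_norm intro!: mult_mono)
    have 2: "u x - u y - (\<Sum>i\<in>Basis. (?h \<bullet> i) * pd i u y)
        = (\<Sum>i\<in>Basis. (?h \<bullet> i) * (pd i u (y + t *\<^sub>R ?h) - pd i u y))"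
      using t by (simp add: right_diff_distrib sum_subtractf)
    have 3: "(\<Sum>i\<in>Basis. dist x y * (B i * dist x y)) = (\<Sum>i\<in>Basis. B i) * (dist x y)\<^sup>2"
      by (simp add: sum_distrib_right power2_eq_square mult_ac)
    show ?thesis unfolding 2 by (rule order_trans[OF sum_abs 1[unfolded 3]])
  qed
  moreover have "(\<Sum>i\<in>Basis. B i) \<ge> 0" using B by (intro sum_nonneg) auto
  ultimately show ?thesis by blast
qed

text \<open>Maclaurin's formula on the segment from \<open>y\<close> to \<open>x\<close> leaves the
  second derivatives at an intermediate point. They are Lipschitz, so moving them to
  \<open>y\<close> costs one more factor \<open>dist x y\<close>. The cubic bound is what makes the
  remainder invisible to the local functional \<open>B\<close> (see
  \<open>B_third_order\<close>).\<close>

lemma C0inf_taylor2: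
  assumes "u \<in> C0inf U"
  shows "\<exists>C\<ge>0. \<forall>x y. \<bar>u x - u y - (\<Sum>i\<in>Basis. ((x - y) \<bullet> i) * pd i u y)
    - 1/2 * (\<Sum>i\<in>Basis. \<Sum>j\<in>Basis. ((x - y) \<bullet> i) * ((x - y) \<bullet> j) * pd j (pd i u) y)\<bar> \<le> C * (dist x y) ^ 3"
proof -
  have s: "smooth_fun u" using assms by (rule C0infD)
  have "\<forall>i\<in>Basis. \<forall>j\<in>Basis. \<exists>B\<ge>0. \<forall>x y. \<bar>pd j (pd i u) x - pd j (pd i u) y\<bar> \<le> B * dist x y"
    using C0inf_lipschitz C0inf_pd assms by blast
  then obtain B where B: "\<And>i j x y. i \<in> Basis \<Longrightarrow> j \<in> Basis \<Longrightarrow> \<bar>pd j (pd i u) x - pd j (pd i u) y\<bar> \<le> B i j * dist x y"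
    "\<And>i j. i \<in> Basis \<Longrightarrow> j \<in> Basis \<Longrightarrow> B i j \<ge> 0" by metis
  have "\<bar>u x - u y - (\<Sum>i\<in>Basis. ((x - y) \<bullet> i) * pd i u y)
    - 1/2 * (\<Sum>i\<in>Basis. \<Sum>j\<in>Basis. ((x - y) \<bullet> i) * ((x - y) \<bullet> j) * pd j (pd i u) y)\<bar>
     \<le> (1/2 * (\<Sum>i\<in>Basis. \<Sum>j\<in>Basis. B i j)) * (dist x y) ^ 3" for x y
  proof -
    let ?h = "x - y"
    define D where "D m t = (if m = 0 then u (y + t *\<^sub>R ?h)
      else if m = 1 then (\<Sum>i\<in>Basis. (?h \<bullet> i) * pd i u (y + t *\<^sub>R ?h))
      else (\<Sum>i\<in>Basis. \<Sum>j\<in>Basis. (?h \<bullet> i) * (?h \<bullet> j) * pd j (pd i u) (y + t *\<^sub>R ?h)))" for m :: nat and t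
    have D: "(D m has_real_derivative D (Suc m) t) (at t)" if "m < 2" for m t
    proof (cases "m = 0")
      case True then show ?thesis using smooth_line_derivative[OF s] by (simp add: D_def[abs_def])
    next
      case False
      then have m: "m = 1" using that by auto
      have "((\<lambda>t. \<Sum>i\<in>Basis. (?h \<bullet> i) * pd i u (y + t *\<^sub>R ?h)) has_real_derivative
        (\<Sum>i\<in>Basis. (?h \<bullet> i) * (\<Sum>j\<in>Basis. (?h \<bullet> j) * pd j (pd i u) (y + t *\<^sub>R ?h)))) (at t)"
        by (intro DERIV_sum DERIV_cmult smooth_line_derivative smooth_pd s)
      then show ?thesis by (simp add: m D_def[abs_def] sum_distrib_left mult.assoc)
    qed
    obtain t :: real where t: "0 < t" "t < 1" "D 0 1 = (\<Sum>m<2. D m 0 / fact m * 1 ^ m) + D 2 t / fact 2 * 1 ^ 2"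
      using Maclaurin[of 1 2 D "D 0"] D by auto
    have "(\<Sum>m<2. D m 0 / fact m * 1 ^ m) = D 0 0 + D 1 0" by (simp add: numeral_2_eq_2)
    then have "u x - u y - (\<Sum>i\<in>Basis. (?h \<bullet> i) * pd i u y) = 1/2 * D 2 t"
      using t(3) by (simp add: D_def)
    then have eq: "u x - u y - (\<Sum>i\<in>Basis. ((x - y) \<bullet> i) * pd i u y)
      - 1/2 * (\<Sum>i\<in>Basis. \<Sum>j\<in>Basis. ((x - y) \<bullet> i) * ((x - y) \<bullet> j) * pd j (pd i u) y)
      = 1/2 * (\<Sum>i\<in>Basis. \<Sum>j\<in>Basis. (?h \<bullet> i) * (?h \<bullet> j) * (pd j (pd i u) (y + t *\<^sub>R ?h) - pd j (pd i u) y))"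
      by (simp add: D_def right_diff_distrib sum_subtractf)
    have "\<bar>(?h \<bullet> i) * (?h \<bullet> j) * (pd j (pd i u) (y + t *\<^sub>R ?h) - pd j (pd i u) y)\<bar> \<le> dist x y * dist x y * (B i j * dist x y)"
      if "i \<in> Basis" "j \<in> Basis" for i j
    proof -
      have "dist (y + t *\<^sub>R ?h) y \<le> dist x y" using t by (simp add: dist_norm mult_left_le_one_le)
      then have "\<bar>pd j (pd i u) (y + t *\<^sub>R ?h) - pd j (pd i u) y\<bar> \<le> B i j * dist x y"
        using B(1)[OF that, of "y + t *\<^sub>R ?h" y] B(2)[OF that] by (meson mult_left_mono order_trans)
      then show ?thesis unfolding abs_mult using that Basis_le_norm[of _ ?h]
        by (intro mult_mono) (auto simp: dist_norm)
    qed
    then have "(\<Sum>i\<in>Basis. \<Sum>j\<in>Basis. \<bar>(?h \<bullet> i) * (?h \<bullet> j) * (pd j (pd i u) (y + t *\<^sub>R ?h) - pd j (pd i u) y)\<bar>)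
        \<le> (\<Sum>i\<in>Basis. \<Sum>j\<in>Basis. dist x y * dist x y * (B i j * dist x y))"
      by (intro sum_mono)
    also have "\<dots> = (\<Sum>i\<in>Basis. \<Sum>j\<in>Basis. B i j) * (dist x y) ^ 3"
      by (simp add: sum_distrib_left sum_distrib_right power3_eq_cube mult_ac)
    finally have "\<bar>\<Sum>i\<in>Basis. \<Sum>j\<in>Basis. (?h \<bullet> i) * (?h \<bullet> j) * (pd j (pd i u) (y + t *\<^sub>R ?h) - pd j (pd i u) y)\<bar>
        \<le> (\<Sum>i\<in>Basis. \<Sum>j\<in>Basis. B i j) * (dist x y) ^ 3"
      by (rule order_trans[rotated]) (rule order_trans[OF sum_abs sum_mono[OF sum_abs]])
    then show ?thesis unfolding eq by (simp add: abs_mult)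
  qed
  moreover have "1/2 * (\<Sum>i\<in>Basis. \<Sum>j\<in>Basis. B i j) \<ge> 0" using B by (auto intro!: sum_nonneg)
  ultimately show ?thesis by blast
qed

section \<open>Stability of smooth convergence\<close>

lemma pderivs_add:
  "smooth_fun f \<Longrightarrow> smooth_fun g \<Longrightarrow> set bs \<subseteq> Basis \<Longrightarrow>
    pderivs bs (\<lambda>x. f x + g x) = (\<lambda>x. pderivs bs f x + pderivs bs g x)"
  by (induction bs) (auto simp: pd_add smooth_pderivs)

lemma smooth_conv_pd:
  assumes "smooth_conv fs f" "b \<in> Basis"
  shows "smooth_conv (\<lambda>n. pd b (fs n)) (pd b f)"
  unfolding smooth_conv_def
proof (intro allI impI)
  fix bs assume "set bs \<subseteq> (Basis :: 'a set)"
  then have "set (bs @ [b]) \<subseteq> Basis" using assms(2) by simp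
  then have "uniform_limit UNIV (\<lambda>n. pderivs (bs @ [b]) (fs n)) (pderivs (bs @ [b]) f) sequentially"
    using assms(1) unfolding smooth_conv_def by blast
  then show "uniform_limit UNIV (\<lambda>n. pderivs bs (pd b (fs n))) (pderivs bs (pd b f)) sequentially"
    by (simp add: pderivs_append)
qed

lemma smooth_conv_uniform: "smooth_conv fs f \<Longrightarrow> uniform_limit UNIV fs f sequentially"
  unfolding smooth_conv_def by (drule spec[of _ "[]"]) simp

text \<open>The last direction of the list is differentiated first. Peeling it off from the right
  lets the product rule act on \<open>g\<close> and \<open>fs\<close> before the remaining
  derivatives, and the induction hypothesis is applied to the pairs \<open>(pd b g, fs)\<close> and
  \<open>(g, pd b (fs n))\<close>; hence \<open>rev_induct\<close> with all functions
  generalised.\<close>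

lemma smooth_conv_mult:
  assumes "g \<in> C0inf U" "\<And>n. smooth_fun (fs n)" "smooth_fun f" "smooth_conv fs f"
  shows "smooth_conv (\<lambda>n x. g x * fs n x) (\<lambda>x. g x * f x)"
proof -
  have "uniform_limit UNIV (\<lambda>n. pderivs bs (\<lambda>x. g x * fs n x)) (pderivs bs (\<lambda>x. g x * f x)) sequentially"
    if "set bs \<subseteq> Basis" for bs
    using that assms
  proof (induction bs arbitrary: g fs f rule: rev_induct)
    case Nil
    obtain B where B: "B > 0" "\<And>x. \<bar>g x\<bar> \<le> B" using C0inf_bounded[OF Nil(2)] by blast
    show ?case unfolding pderivs.simps
    proof (rule uniform_limitI)
      fix e :: real assume "e > 0"
      then have "\<forall>\<^sub>F n in sequentially. \<forall>x\<in>UNIV. dist (fs n x) (f x) < e / B"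
        using smooth_conv_uniform[OF Nil(5)] B(1) by (auto simp: uniform_limit_iff)
      then show "\<forall>\<^sub>F n in sequentially. \<forall>x\<in>UNIV. dist (g x * fs n x) (g x * f x) < e"
      proof (rule eventually_mono, intro ballI)
        fix n x assume "\<forall>x\<in>UNIV. dist (fs n x) (f x) < e / B"
        then have d: "dist (fs n x) (f x) < e / B" by simp
        have "dist (g x * fs n x) (g x * f x) = \<bar>g x\<bar> * dist (fs n x) (f x)"
          by (simp add: dist_real_def abs_mult[symmetric] right_diff_distrib)
        also have "\<dots> \<le> B * dist (fs n x) (f x)" using B(2) by (intro mult_right_mono) auto
        also have "\<dots> < e" using d B(1) by (simp add: field_simps)
        finally show "dist (g x * fs n x) (g x * f x) < e" .
      qed
    qed
  next
    case (snoc b bs)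
    have b: "b \<in> Basis" and bs: "set bs \<subseteq> Basis" using snoc(2) by auto
    have g: "smooth_fun g" using snoc(3) by (rule C0infD)
    have eq: "pderivs (bs @ [b]) (\<lambda>x. g x * h x)
        = (\<lambda>x. pderivs bs (\<lambda>x. pd b g x * h x) x + pderivs bs (\<lambda>x. g x * pd b h x) x)"
      if "smooth_fun h" for h
      using that g b bs by (simp add: pderivs_append pd_mult pderivs_add smooth_mult smooth_pd)
    have "uniform_limit UNIV (\<lambda>n. pderivs bs (\<lambda>x. pd b g x * fs n x)) (pderivs bs (\<lambda>x. pd b g x * f x)) sequentially"
      by (rule snoc(1)[OF bs C0inf_pd[OF snoc(3) b] snoc(4,5,6)])
    moreover have "uniform_limit UNIV (\<lambda>n. pderivs bs (\<lambda>x. g x * pd b (fs n) x)) (pderivs bs (\<lambda>x. g x * pd b f x)) sequentially"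
      by (rule snoc(1)[OF bs snoc(3) smooth_pd[OF snoc(4) b] smooth_pd[OF snoc(5) b] smooth_conv_pd[OF snoc(6) b]])
    ultimately show ?case unfolding eq[OF snoc(4)] eq[OF snoc(5)] by (rule uniform_limit_add)
  qed
  then show ?thesis unfolding smooth_conv_def by blast
qed

section \<open>Radon measures tested on smooth functions\<close>

lemma radon_integrable:
  assumes r: "radon_on U M" and f: "f \<in> C0inf U"
  shows "integrable M f"
proof -
  have sM: "sets M = sets borel" using r by (simp add: radon_on_def)
  obtain B where B: "\<And>x. \<bar>f x\<bar> \<le> B" using C0inf_bounded[OF f] by blast
  have "emeasure M (fsupp f) < \<infinity>" using r C0infD(2,3)[OF f] by (auto simp: radon_on_def)
  then have "integrable M (\<lambda>x. B * indicator (fsupp f) x)"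
    by (intro integrable_mult_right integrable_real_indicator) (auto simp: sM)
  then show "integrable M f"
  proof (rule Bochner_Integration.integrable_bound)
    show "f \<in> borel_measurable M" using C0inf_measurable[OF f] by (simp add: measurable_cong_sets[OF sM refl])
    have "norm (f x) \<le> norm (B * indicator (fsupp f) x)" for x
      using B[of x] notin_fsupp[of x f] by (cases "x \<in> fsupp f") auto
    then show "AE x in M. norm (f x) \<le> norm (B * indicator (fsupp f) x)" by simp
  qed
qed

lemma radon_integral_le:
  assumes r: "radon_on U M" and f: "f \<in> C0inf U" and F: "compact F" "F \<subseteq> U" "fsupp f \<subseteq> F" and e: "\<And>x. \<bar>f x\<bar> \<le> e"
  shows "\<bar>integral\<^sup>L M f\<bar> \<le> e * measure M F"
proof -
  have sM: "sets M = sets borel" using r by (simp add: radon_on_def)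
  have sp: "space M = UNIV" using sets_eq_imp_space_eq[OF sM] by simp
  have fin: "emeasure M F < \<infinity>" using r F by (auto simp: radon_on_def)
  have Fm: "F \<in> sets M" using F(1) by (simp add: sM borel_compact)
  have "\<bar>integral\<^sup>L M f\<bar> \<le> (\<integral>x. \<bar>f x\<bar> \<partial>M)" by (rule integral_abs_bound)
  also have "\<dots> \<le> (\<integral>x. e * indicator F x \<partial>M)"
  proof (rule integral_mono)
    show "integrable M (\<lambda>x. \<bar>f x\<bar>)" using radon_integrable[OF r f] by simp
    show "integrable M (\<lambda>x. e * indicator F x :: real)"
      using fin Fm by (intro integrable_mult_right integrable_real_indicator) auto
    fix x show "\<bar>f x\<bar> \<le> e * indicator F x"
      using e[of x] notin_fsupp[of x f] F(3) by (cases "x \<in> F") auto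
  qed
  also have "\<dots> = e * measure M F" using Fm sp by simp
  finally show ?thesis .
qed

text \<open>The approximating functions do not depend on the measure, so that identities between
  several Radon measures on test functions pass to compact sets.\<close>

lemma radon_compact_approx:
  fixes F U :: "'a::euclidean_space set"
  assumes F: "compact F" "F \<subseteq> U" and U: "open U"
  obtains f :: "nat \<Rightarrow> 'a \<Rightarrow> real" where "\<And>n. f n \<in> C0inf U" "\<And>n x. 0 \<le> f n x"
    "\<And>M. radon_on U M \<Longrightarrow> (\<lambda>n. integral\<^sup>L M (f n)) \<longlonglongrightarrow> measure M F"
proof -
  obtain \<eta> W where \<eta>: "\<eta> \<in> C0inf U" "\<And>x. 0 \<le> \<eta> x" "\<And>x. \<eta> x \<le> 1" "open W" "F \<subseteq> W" "\<And>x. x \<in> W \<Longrightarrow> \<eta> x = 1"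
    using smooth_cutoff[of F U] F U by metis
  \<comment> \<open>The neighbourhoods shrink to \<open>F\<close> inside \<open>W\<close>, where
    \<eta> is 1. All \<open>f n\<close> therefore lie below \<eta>, which serves as integrable
    majorant for every Radon measure.\<close>
  define V where "V n = (\<Union>x\<in>F. ball x (1 / real (Suc n))) \<inter> (W \<inter> U)" for n
  have "\<forall>n. \<exists>f. f \<in> C0inf (V n) \<and> (\<forall>x. 0 \<le> f x) \<and> (\<forall>x. f x \<le> 1) \<and> (\<forall>x\<in>F. f x = 1)"
  proof
    fix n
    have "open (V n)" "F \<subseteq> V n" using \<eta>(4,5) U F unfolding V_def by (auto intro!: open_Int)
    then obtain g X where "g \<in> C0inf (V n)" "\<And>x. 0 \<le> g x" "\<And>x. g x \<le> 1" "open X" "F \<subseteq> X" "\<And>x. x \<in> X \<Longrightarrow> g x = 1"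
      using smooth_cutoff[of F "V n"] F(1) by metis
    then show "\<exists>f. f \<in> C0inf (V n) \<and> (\<forall>x. 0 \<le> f x) \<and> (\<forall>x. f x \<le> 1) \<and> (\<forall>x\<in>F. f x = 1)"
      by (intro exI[of _ g]) auto
  qed
  then obtain f where "\<forall>n. f n \<in> C0inf (V n) \<and> (\<forall>x. 0 \<le> f n x) \<and> (\<forall>x. f n x \<le> 1) \<and> (\<forall>x\<in>F. f n x = 1)"
    by (rule choice[THEN exE])
  then have f: "f n \<in> C0inf (V n)" "0 \<le> f n x" "f n x \<le> 1" "x \<in> F \<Longrightarrow> f n x = 1" for n x by simp_all
  have VU: "V n \<subseteq> U" "V n \<subseteq> W" for n by (auto simp: V_def)
  have fU: "f n \<in> C0inf U" for n using C0inf_mono[OF VU(1) f(1)] .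
  have lim: "(\<lambda>n. integral\<^sup>L M (f n)) \<longlonglongrightarrow> measure M F" if r: "radon_on U M" for M
  proof -
    have sM: "sets M = sets borel" using r by (simp add: radon_on_def)
    have sp: "space M = UNIV" using sets_eq_imp_space_eq[OF sM] by simp
    have Fm: "F \<in> sets M" using F(1) by (simp add: sM borel_compact)
    have "(\<lambda>n. integral\<^sup>L M (f n)) \<longlonglongrightarrow> (\<integral>x. indicator F x \<partial>M)"
    proof (rule integral_dominated_convergence[where w=\<eta>])
      show "indicat_real F \<in> borel_measurable M" using Fm by simp
      show "f n \<in> borel_measurable M" for n using radon_integrable[OF r fU] by simp
      show "integrable M \<eta>" by (rule radon_integrable[OF r \<eta>(1)])
      show "AE x in M. norm (f n x) \<le> \<eta> x" for n
      proof (rule AE_I2)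
        fix x show "norm (f n x) \<le> \<eta> x"
        proof (cases "x \<in> W")
          case True then show ?thesis using f(2,3)[of n x] \<eta>(6)[of x] by simp
        next
          case False
          then have "f n x = 0" using C0infD(5)[OF f(1)] VU(2) by blast
          then show ?thesis using \<eta>(2) by simp
        qed
      qed
      show "AE x in M. (\<lambda>n. f n x) \<longlonglongrightarrow> indicator F x"
      proof (rule AE_I2)
        fix x show "(\<lambda>n. f n x) \<longlonglongrightarrow> indicator F x"
        proof (cases "x \<in> F")
          case True then show ?thesis using f(4) by simp
        next
          case False
          obtain d where d: "d > 0" "\<And>y. y \<in> F \<Longrightarrow> d \<le> dist x y"
            using separate_point_closed[OF compact_imp_closed[OF F(1)] False] by blast
          obtain n0 where n0: "inverse (real (Suc n0)) < d" using reals_Archimedean[OF d(1)] by blast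
          have "(\<lambda>n. f n x) \<longlonglongrightarrow> 0"
          proof (rule tendsto_eventually, rule eventually_sequentiallyI[of n0])
            fix n assume "n0 \<le> n"
            then have "1 / real (Suc n) \<le> inverse (real (Suc n0))" by (simp add: inverse_eq_divide frac_le)
            then have "1 / real (Suc n) < d" using n0 by simp
            then have "x \<notin> V n" using d(2) by (force simp: V_def dist_commute)
            then show "f n x = 0" using C0infD(5)[OF f(1)] by blast
          qed
          then show ?thesis using False by simp
        qed
      qed
    qed
    then show ?thesis using Fm sp by simp
  qed
  show ?thesis by (rule that[of f]) (use fU f(2) lim in auto)
qed

section \<open>Positive functionals on smooth functions are Radon measures\<close>

text \<open>A smooth staircase: the steps with \<open>k + 1 \<le> t\<close> are complete, those with
  \<open>k \<ge> t\<close> have not begun, and at most one is in progress. It plays the role of the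
  layer-cake formula for \<open>f\<close>, with slices that are themselves test functions.\<close>

lemma smooth_step_sum:
  assumes "0 \<le> t" "t \<le> real N"
  shows "\<bar>t - (\<Sum>k<N. smooth_step (t - real k))\<bar> \<le> 1"
  using assms
proof (induction N)
  case (Suc N)
  show ?case
  proof (cases "t \<le> real N")
    case True
    then show ?thesis using Suc smooth_step(4)[of "t - real N"] by simp
  next
    case False
    have "(\<Sum>k<N. smooth_step (t - real k)) = (\<Sum>k<N. 1)"
      using False by (intro sum.cong refl smooth_step(5)) auto
    then show ?thesis using False Suc(3) smooth_step(2,3)[of "t - real N"] by (simp add: abs_le_iff)
  qed
qed simp

locale positive_functional =
  fixes U :: "'a::euclidean_space set" and L :: "('a \<Rightarrow> real) \<Rightarrow> real"
  assumes open_U: "open U"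
    and add: "f \<in> C0inf U \<Longrightarrow> g \<in> C0inf U \<Longrightarrow> L (\<lambda>x. f x + g x) = L f + L g"
    and cmult: "f \<in> C0inf U \<Longrightarrow> L (\<lambda>x. c * f x) = c * L f"
    and nonneg: "f \<in> C0inf U \<Longrightarrow> (\<And>x. 0 \<le> f x) \<Longrightarrow> 0 \<le> L f"
begin

lemma mono: "f \<in> C0inf U \<Longrightarrow> g \<in> C0inf U \<Longrightarrow> (\<And>x. f x \<le> g x) \<Longrightarrow> L f \<le> L g"
  using nonneg[of "\<lambda>x. g x + (-1) * f x"] add[of g "\<lambda>x. (-1) * f x"] cmult[of f "-1"]
    C0inf_add[of g U "\<lambda>x. (-1) * f x"] C0inf_cmult[of f U "-1"] by simp

lemma zero: "L (\<lambda>x. 0) = 0"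
  using cmult[of "\<lambda>x. 0" 0] by simp

lemma sum: "(\<And>k. k \<in> A \<Longrightarrow> f k \<in> C0inf U) \<Longrightarrow> L (\<lambda>x. \<Sum>k\<in>A. f k x) = (\<Sum>k\<in>A. L (f k))"
  by (induction A rule: infinite_finite_induct) (auto simp: zero add C0inf_sum)

definition tests :: "'a set \<Rightarrow> ('a \<Rightarrow> real) set" where
  "tests V = {f \<in> C0inf (V \<inter> U). \<forall>x. 0 \<le> f x \<and> f x \<le> 1}"

definition lam :: "'a set \<Rightarrow> ennreal" where
  "lam V = (SUP f\<in>tests V. ennreal (L f))"

text \<open>Only \<open>A \<inter> U\<close> has to be covered. The outer measure thus lives on the
  whole type and does not charge the complement of \<open>U\<close>, which is the encoding used by
  \<open>radon_on\<close>.\<close>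

definition mu :: "'a set \<Rightarrow> ennreal" where
  "mu A = (INF V\<in>{V. open V \<and> A \<inter> U \<subseteq> V}. lam V)"

lemma testsD:
  assumes "f \<in> tests V"
  shows "f \<in> C0inf U" "f \<in> C0inf V" "0 \<le> f x" "f x \<le> 1"
  using assms C0inf_mono[of "V \<inter> U" U f] C0inf_mono[of "V \<inter> U" V f] by (auto simp: tests_def)

lemma zero_tests: "(\<lambda>x. 0) \<in> tests V"
  by (simp add: tests_def)

lemma tests_mono: "V \<inter> U \<subseteq> W \<Longrightarrow> tests V \<subseteq> tests W"
  using C0inf_mono[of "V \<inter> U" "W \<inter> U"] by (auto simp: tests_def)

lemma lam_mono: "V \<inter> U \<subseteq> W \<Longrightarrow> lam V \<le> lam W"
  unfolding lam_def by (rule SUP_subset_mono[OF tests_mono]) auto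

lemma lam_upper: "f \<in> tests V \<Longrightarrow> ennreal (L f) \<le> lam V"
  unfolding lam_def by (rule SUP_upper)

lemma lam_le: "(\<And>f. f \<in> tests V \<Longrightarrow> ennreal (L f) \<le> c) \<Longrightarrow> lam V \<le> c"
  unfolding lam_def by (rule SUP_least)

lemma lam_empty: "lam {} = 0"
proof -
  have "ennreal (L f) \<le> 0" if "f \<in> tests {}" for f
  proof -
    have "f = (\<lambda>x. 0)" using that by (auto simp: tests_def dest: C0infD(5))
    then show ?thesis by (simp add: zero)
  qed
  then have "lam {} \<le> 0" by (rule lam_le)
  then show ?thesis by simp
qed

lemma mu_lower: "open V \<Longrightarrow> A \<inter> U \<subseteq> V \<Longrightarrow> mu A \<le> lam V"
  unfolding mu_def by (rule INF_lower) auto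

lemma le_mu: "(\<And>V. open V \<Longrightarrow> A \<inter> U \<subseteq> V \<Longrightarrow> c \<le> lam V) \<Longrightarrow> c \<le> mu A"
  unfolding mu_def by (rule INF_greatest) auto

lemma mu_open: "open V \<Longrightarrow> mu V = lam V"
  by (intro antisym mu_lower le_mu lam_mono) auto

lemma mu_mono: "A \<inter> U \<subseteq> B \<Longrightarrow> mu A \<le> mu B"
  by (intro le_mu mu_lower) auto

text \<open>A partition of unity on the compact support of \<open>f\<close>, subordinate to the sets
  \<open>V i\<close>, splits \<open>f\<close> into finitely many pieces. Several pieces may lie in
  the same \<open>V j\<close>; they are added up to one \<open>g j\<close>, which is still at most 1
  and hence a test function for \<open>V j\<close>.\<close>

lemma lam_subadditive:
  assumes op: "\<And>i::nat. open (V i)"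
  shows "lam (\<Union>i. V i) \<le> (\<Sum>i. lam (V i))"
proof (rule lam_le)
  fix f assume f: "f \<in> tests (\<Union>i. V i)"
  have fU: "f \<in> C0inf ((\<Union>i. V i) \<inter> U)" using f by (simp add: tests_def)
  obtain n \<psi> W where \<psi>: "\<And>k. k < n \<Longrightarrow> \<exists>Q\<in>range (\<lambda>i. V i \<inter> U). \<psi> k \<in> C0inf Q" "\<And>k x. 0 \<le> \<psi> k x"
    "\<And>x. (\<Sum>k<n::nat. \<psi> k x) \<le> 1" "open W" "fsupp f \<subseteq> W" "\<And>x. x \<in> W \<Longrightarrow> (\<Sum>k<n. \<psi> k x) = 1"
    by (rule smooth_partition[of "fsupp f" "range (\<lambda>i. V i \<inter> U)"])
      (use C0infD(2,3)[OF fU] op open_U in auto)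
  have "\<exists>i. \<psi> k \<in> C0inf (V i \<inter> U)" if "k < n" for k using \<psi>(1)[OF that] by auto
  then obtain i where i: "\<And>k. k < n \<Longrightarrow> \<psi> k \<in> C0inf (V (i k) \<inter> U)" by metis
  define g where "g j x = (\<Sum>k\<in>{k\<in>{..<n}. i k = j}. f x * \<psi> k x)" for j x
  have fpsi: "(\<lambda>x. f x * \<psi> k x) \<in> C0inf (V (i k) \<inter> U)" if "k < n" for k
    using C0inf_mult'[OF i[OF that] C0infD(1)[OF fU]] .
  have fpsiU: "(\<lambda>x. f x * \<psi> k x) \<in> C0inf U" if "k < n" for k
    using C0inf_mono[OF _ fpsi[OF that]] by blast
  have g: "g j \<in> tests (V j)" for j
    unfolding tests_def
  proof (intro CollectI conjI allI)
    show "g j \<in> C0inf (V j \<inter> U)" unfolding g_def[abs_def]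
      by (rule C0inf_sum) (use fpsi in auto)
    fix x
    show "0 \<le> g j x" unfolding g_def by (intro sum_nonneg mult_nonneg_nonneg) (use testsD[OF f] \<psi>(2) in auto)
    have "g j x \<le> (\<Sum>k<n. f x * \<psi> k x)" unfolding g_def
      by (intro sum_mono2 mult_nonneg_nonneg) (use testsD[OF f] \<psi>(2) in auto)
    also have "\<dots> \<le> (\<Sum>k<n. 1 * \<psi> k x)"
      by (intro sum_mono mult_right_mono) (use testsD[OF f] \<psi>(2) in auto)
    finally show "g j x \<le> 1" using \<psi>(3)[of x] by simp
  qed
  have "f = (\<lambda>x. \<Sum>k<n. f x * \<psi> k x)"
  proof
    fix x show "f x = (\<Sum>k<n. f x * \<psi> k x)"
      using \<psi>(5,6) notin_fsupp[of x f] by (cases "x \<in> fsupp f") (auto simp: sum_distrib_left[symmetric])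
  qed
  then have "L f = (\<Sum>k<n. L (\<lambda>x. f x * \<psi> k x))" using sum[of "{..<n}" "\<lambda>k x. f x * \<psi> k x"] fpsiU by simp
  also have "\<dots> = (\<Sum>j\<in>i ` {..<n}. \<Sum>k\<in>{k\<in>{..<n}. i k = j}. L (\<lambda>x. f x * \<psi> k x))"
    by (rule sum.image_gen) auto
  also have "\<dots> = (\<Sum>j\<in>i ` {..<n}. L (g j))"
    unfolding g_def[abs_def] by (intro sum.cong refl sum[symmetric]) (use fpsiU in auto)
  finally have "ennreal (L f) = (\<Sum>j\<in>i ` {..<n}. ennreal (L (g j)))"
    using nonneg testsD[OF g] by (simp add: sum_ennreal)
  also have "\<dots> \<le> (\<Sum>j\<in>i ` {..<n}. lam (V j))" by (intro sum_mono lam_upper g)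
  also have "\<dots> \<le> (\<Sum>j. lam (V j))" by (rule sum_le_suminf) auto
  finally show "ennreal (L f) \<le> (\<Sum>j. lam (V j))" .
qed

lemma mu_subadditive: "mu (\<Union>i. A i) \<le> (\<Sum>i::nat. mu (A i))"
proof (rule ennreal_le_epsilon)
  fix e :: real assume fin: "(\<Sum>i. mu (A i)) < top" and e: "0 < e"
  have "\<exists>V. open V \<and> A i \<inter> U \<subseteq> V \<and> lam V < mu (A i) + ennreal (e * (1/2) ^ Suc i)" for i
  proof -
    have "mu (A i) < top" using fin ennreal_suminf_lessD by blast
    then have "mu (A i) < mu (A i) + ennreal (e * (1/2) ^ Suc i)"
      using e by (cases "mu (A i)") (auto simp: ennreal_plus[symmetric] ennreal_less_iff simp del: ennreal_plus)
    then show ?thesis unfolding mu_def by (auto simp: INF_less_iff)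
  qed
  then obtain V where V: "\<And>i. open (V i)" "\<And>i. A i \<inter> U \<subseteq> V i" "\<And>i. lam (V i) < mu (A i) + ennreal (e * (1/2) ^ Suc i)"
    by metis
  have "mu (\<Union>i. A i) \<le> lam (\<Union>i. V i)" using V by (intro mu_lower) auto
  also have "\<dots> \<le> (\<Sum>i. lam (V i))" by (rule lam_subadditive) (rule V)
  also have "\<dots> \<le> (\<Sum>i. mu (A i) + ennreal (e * (1/2) ^ Suc i))"
    using V(3) by (intro suminf_le) (auto intro: less_imp_le)
  also have "\<dots> = (\<Sum>i. mu (A i)) + (\<Sum>i. ennreal (e * (1/2) ^ Suc i))"
    by (rule suminf_add[symmetric]) auto
  also have "(\<Sum>i. ennreal (e * (1/2) ^ Suc i)) = ennreal e"
    using sums_mult[OF power_half_series, of e] e by (intro suminf_ennreal_eq) auto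
  finally show "mu (\<Union>i. A i) \<le> (\<Sum>i. mu (A i)) + ennreal e" .
qed

lemma mu_outer: "outer_measure_space (Pow UNIV) mu"
  unfolding outer_measure_space_def
proof (intro conjI)
  have "mu {} \<le> lam {}" by (rule mu_lower) auto
  then show "positive (Pow UNIV) mu" unfolding positive_def by (simp add: lam_empty)
  show "increasing (Pow UNIV) mu" unfolding increasing_def by (auto intro: mu_mono)
  show "countably_subadditive (Pow UNIV) mu" unfolding countably_subadditive_def using mu_subadditive by auto
qed

lemma mu_empty: "mu {} = 0"
  using mu_outer by (simp add: outer_measure_space_def positive_def)

text \<open>This is the superadditive half of Caratheodory's criterion, for open \<open>Q\<close>.
  If \<open>f\<close> is a test function for \<open>Q \<inter> V\<close> and \<open>g\<close> one
  for \<open>Q\<close> minus the support of \<open>f\<close>, then \<open>f + g\<close> is at most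
  1, so it is a test function for \<open>Q\<close>. Take the supremum over \<open>g\<close> first,
  then over \<open>f\<close>.\<close>

lemma lam_split:
  assumes V: "open V" and Q: "open Q"
  shows "lam (Q \<inter> V) + mu (Q - V) \<le> lam Q"
proof -
  have "ennreal (L f) + mu (Q - V) \<le> lam Q" if f: "f \<in> tests (Q \<inter> V)" for f
  proof -
    have fs: "fsupp f \<subseteq> Q \<inter> V" using C0infD(3) testsD(2)[OF f] by blast
    have "mu (Q - V) \<le> lam (Q - fsupp f)" using fs by (intro mu_lower open_Diff Q) auto
    moreover have "ennreal (L f) + ennreal (L g) \<le> lam Q" if g: "g \<in> tests (Q - fsupp f)" for g
    proof -
      have gs: "fsupp g \<subseteq> Q - fsupp f" using C0infD(3) testsD(2)[OF g] by blast
      have "(\<lambda>x. f x + g x) \<in> tests Q"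
        unfolding tests_def
      proof (intro CollectI conjI allI)
        show "(\<lambda>x. f x + g x) \<in> C0inf (Q \<inter> U)"
        proof (rule C0inf_add)
          show "f \<in> C0inf (Q \<inter> U)" by (rule C0inf_mono[of "(Q \<inter> V) \<inter> U"]) (use f in \<open>auto simp: tests_def\<close>)
          show "g \<in> C0inf (Q \<inter> U)" by (rule C0inf_mono[of "(Q - fsupp f) \<inter> U"]) (use g in \<open>auto simp: tests_def\<close>)
        qed
        fix x
        show "0 \<le> f x + g x" using testsD(3)[OF f] testsD(3)[OF g] by simp
        have "x \<in> fsupp f \<Longrightarrow> g x = 0" using gs notin_fsupp[of x g] by blast
        then show "f x + g x \<le> 1"
          using testsD(4)[OF f, of x] testsD(4)[OF g, of x] notin_fsupp[of x f] by (cases "x \<in> fsupp f") auto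
      qed
      from lam_upper[OF this] show ?thesis
        using add[OF testsD(1)[OF f] testsD(1)[OF g]] nonneg testsD[OF f] testsD[OF g] by simp
    qed
    then have "ennreal (L f) + lam (Q - fsupp f) \<le> lam Q"
      unfolding lam_def[of "Q - fsupp f"]
      by (subst ennreal_SUP_add_right) (use zero_tests in \<open>auto intro!: SUP_least\<close>)
    ultimately show ?thesis by (meson add_left_mono order_trans)
  qed
  then show ?thesis unfolding lam_def[of "Q \<inter> V"]
    by (subst ennreal_SUP_add_left[symmetric]) (use zero_tests in \<open>auto intro!: SUP_least\<close>)
qed

lemma open_lambda_system: "open V \<Longrightarrow> V \<in> lambda_system UNIV (Pow UNIV) mu"
proof -
  assume V: "open V"
  interpret sigma_algebra UNIV "Pow (UNIV::'a set)" by (rule sigma_algebra_Pow)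
  have "mu (A \<inter> V) + mu (A - V) = mu A" for A
  proof (rule antisym)
    show "mu (A \<inter> V) + mu (A - V) \<le> mu A"
    proof (rule le_mu)
      fix Q assume Q: "open Q" "A \<inter> U \<subseteq> Q"
      have "mu (A \<inter> V) \<le> lam (Q \<inter> V)" using Q V by (intro mu_lower) auto
      moreover have "mu (A - V) \<le> mu (Q - V)" using Q by (intro mu_mono) auto
      ultimately show "mu (A \<inter> V) + mu (A - V) \<le> lam Q"
        using lam_split[OF V Q(1)] by (meson add_mono order_trans)
    qed
    have "mu A = mu (\<Union>i::nat. if i = 0 then A \<inter> V else if i = 1 then A - V else {})"
      by (rule arg_cong[where f=mu]) (auto split: if_splits)
    also have "\<dots> \<le> (\<Sum>i::nat. mu (if i = 0 then A \<inter> V else if i = 1 then A - V else {}))"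
      by (rule mu_subadditive)
    also have "\<dots> = (\<Sum>i\<in>{0,1::nat}. mu (if i = 0 then A \<inter> V else if i = 1 then A - V else {}))"
      by (rule suminf_finite) (auto simp: mu_empty)
    finally show "mu A \<le> mu (A \<inter> V) + mu (A - V)" by simp
  qed
  then show ?thesis unfolding lambda_system_eq by simp
qed

definition M :: "'a measure" where
  "M = measure_of UNIV (sets borel) mu"

lemma sets_M [simp, measurable_cong]: "sets M = sets borel"
  by (simp add: M_def sigma_algebra.sets_measure_of_eq[OF sets.sigma_algebra_axioms[of borel, simplified]])

lemma space_M [simp]: "space M = UNIV"
  by (simp add: M_def space_measure_of_conv)

lemma emeasure_M: "A \<in> sets borel \<Longrightarrow> emeasure M A = mu A"
proof -
  assume A: "A \<in> sets borel"
  interpret sigma_algebra UNIV "Pow (UNIV::'a set)" by (rule sigma_algebra_Pow)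
  have ms: "measure_space UNIV (lambda_system UNIV (Pow UNIV) mu) mu"
    by (rule caratheodory_lemma[OF mu_outer])
  have "sigma_sets UNIV {S::'a set. open S} \<subseteq> lambda_system UNIV (Pow UNIV) mu"
    by (rule sigma_algebra.sigma_sets_subset)
      (use ms open_lambda_system in \<open>auto simp: measure_space_def\<close>)
  then have sub: "sets borel \<subseteq> lambda_system UNIV (Pow UNIV) mu" by (simp add: borel_def)
  show "emeasure M A = mu A" unfolding M_def
  proof (rule emeasure_measure_of_sigma[OF _ _ _ A])
    show "sigma_algebra UNIV (sets (borel::'a measure))" using sets.sigma_algebra_axioms[of "borel::'a measure"] by simp
    show "positive (sets borel) mu" by (simp add: positive_def mu_empty)
    show "countably_additive (sets borel) mu"
      using ms sub unfolding measure_space_def countably_additive_def by (meson order_trans subsetD)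
  qed
qed

lemma emeasure_open: "open V \<Longrightarrow> emeasure M V = lam V"
  by (simp add: emeasure_M mu_open)

lemma lam_le_L: "f \<in> C0inf U \<Longrightarrow> (\<And>x. 0 \<le> f x) \<Longrightarrow> (\<And>x. x \<in> V \<Longrightarrow> 1 \<le> f x) \<Longrightarrow> lam V \<le> ennreal (L f)"
proof (rule lam_le)
  fix g assume f: "f \<in> C0inf U" "\<And>x. 0 \<le> f x" "\<And>x. x \<in> V \<Longrightarrow> 1 \<le> f x" and g: "g \<in> tests V"
  have "g x \<le> f x" for x
    using testsD(4)[OF g, of x] f(2,3)[of x] C0infD(5)[OF testsD(2)[OF g], of x] by (cases "x \<in> V") auto
  then have "L g \<le> L f" by (intro mono testsD(1)[OF g] f)
  then show "ennreal (L g) \<le> ennreal (L f)" by (rule ennreal_leI)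
qed

lemma radon_M: "radon_on U M"
  unfolding radon_on_def
proof (intro conjI allI impI)
  have "mu (- U) \<le> lam {}" by (rule mu_lower) auto
  then show "emeasure M (- U) = 0" using open_U by (subst emeasure_M) (auto simp: lam_empty)
  fix C :: "'a set" assume C: "compact C \<and> C \<subseteq> U"
  obtain \<eta> W where \<eta>: "\<eta> \<in> C0inf U" "\<And>x. 0 \<le> \<eta> x" "\<And>x. \<eta> x \<le> 1" "open W" "C \<subseteq> W" "\<And>x. x \<in> W \<Longrightarrow> \<eta> x = 1"
    using smooth_cutoff[of C U] C open_U by auto
  have "emeasure M C \<le> lam W" using C \<eta> by (subst emeasure_M) (auto intro!: borel_compact mu_lower)
  also have "\<dots> \<le> ennreal (L \<eta>)" using \<eta> by (intro lam_le_L) auto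
  finally show "emeasure M C < \<infinity>" by (simp add: le_less_trans)
qed simp

lemma integrable_C0inf: "f \<in> C0inf U \<Longrightarrow> integrable M f"
  by (rule radon_integrable[OF radon_M])

text \<open>Slice \<open>f\<close> at height \<open>e\<close> into \<open>g k\<close>, so that
  \<open>f\<close> differs from \<open>e * (\<Sum>k<N. g k)\<close> by at most
  \<open>e * \<eta>\<close>. For the superlevel sets, \<open>lam\<close> is squeezed between values
  of \<open>L\<close> and of the integral on neighbouring slices. Both sums then agree up to a few
  end terms that are bounded independently of \<open>N\<close>, and the factor \<open>e\<close>
  makes the total error small.\<close>

lemma integral_nonneg_C0inf:
  assumes f: "f \<in> C0inf U" and f0: "\<And>x. 0 \<le> f x"
  shows "integral\<^sup>L M f = L f"
proof -
  obtain \<eta> W where \<eta>: "\<eta> \<in> C0inf U" "\<And>x. 0 \<le> \<eta> x" "\<And>x. \<eta> x \<le> 1" "open W" "fsupp f \<subseteq> W" "\<And>x. x \<in> W \<Longrightarrow> \<eta> x = 1"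
    using smooth_cutoff[of "fsupp f" U] C0infD[OF f] open_U by metis
  obtain B where B: "\<And>x. \<bar>f x\<bar> \<le> B" using C0inf_bounded[OF f] by blast
  have I\<eta>: "0 \<le> integral\<^sup>L M \<eta>" by (rule integral_nonneg_AE) (simp add: \<eta>)
  \<comment> \<open>The error budget per unit of \<open>e\<close>: replacing \<open>f\<close> by the
    slices costs \<open>L \<eta>\<close> on one side and the integral of \<eta> on the other; the
    index shifts in the comparison of the two sums cost at most \<open>2 * L \<eta>\<close> plus the
    integral of \<eta>.\<close>
  define C where "C = 3 * L \<eta> + 2 * integral\<^sup>L M \<eta>"
  have main: "\<bar>L f - integral\<^sup>L M f\<bar> \<le> e * C" if e: "e > 0" for e
  proof -
    obtain N where N: "B / e \<le> real N" using real_arch_simple by blast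
    define g where "g k x = smooth_step (f x * (1 / e) - real k)" for k :: nat and x
    have sm: "smooth_fun (g k)" for k unfolding g_def[abs_def]
      by (rule smooth_compose[OF smooth_step(1)]) (intro smooth_diff smooth_mult smooth_const C0infD(1)[OF f])
    have g: "g k \<in> C0inf U" for k
      by (rule C0infI[where F="fsupp f"]) (use sm C0infD[OF f] in \<open>auto simp: g_def smooth_step\<close>)
    have g01: "0 \<le> g k x" "g k x \<le> 1" for k x by (auto simp: g_def smooth_step)
    have g\<eta>: "g k x \<le> \<eta> x" for k x
      using \<eta>(2)[of x] \<eta>(5,6) g01[of k x] notin_fsupp[of x f]
      by (cases "x \<in> fsupp f") (auto simp: g_def smooth_step)
    define S where "S x = (\<Sum>k<N. g k x)" for x
    have S: "S \<in> C0inf U" unfolding S_def[abs_def] by (intro C0inf_sum g)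
    have fS: "\<bar>f x - e * S x\<bar> \<le> e * \<eta> x" for x
    proof (cases "x \<in> fsupp f")
      case True
      have "f x / e \<le> B / e" using B[of x] e by (intro divide_right_mono) auto
      then have "\<bar>f x / e - (\<Sum>k<N. smooth_step (f x / e - real k))\<bar> \<le> 1"
        using e f0[of x] N by (intro smooth_step_sum) auto
      then have "\<bar>e * (f x / e - S x)\<bar> \<le> e * 1" unfolding abs_mult using e
        by (simp add: S_def g_def)
      then show ?thesis using True \<eta>(5,6) e by (auto simp: right_diff_distrib)
    next
      case False
      then show ?thesis using notin_fsupp[of x f] \<eta>(2)[of x] e by (simp add: S_def g_def smooth_step)
    qed
    have op: "open {x. f x > c}" for c
      using open_Collect_less[OF continuous_on_const C0inf_continuous[OF f]] .
    have ei: "ennreal (integral\<^sup>L M (g k)) = (\<integral>\<^sup>+x. ennreal (g k x) \<partial>M)" for k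
      by (rule nn_integral_eq_integral[symmetric]) (use integrable_C0inf[OF g] g01 in auto)
    have I0: "0 \<le> integral\<^sup>L M (g k)" for k by (rule integral_nonneg_AE) (simp add: g01)
    have up: "L (g (k + 2)) \<le> integral\<^sup>L M (g k)" for k
    proof -
      let ?V = "{x. f x > (real k + 1) * e}"
      have "g (k + 2) \<in> tests ?V" unfolding tests_def
      proof (intro CollectI conjI allI g01)
        show "g (k + 2) \<in> C0inf (?V \<inter> U)"
        proof (rule C0infI[OF sm, where F="fsupp f \<inter> {x. f x \<ge> (real k + 2) * e}"])
          show "compact (fsupp f \<inter> {x. f x \<ge> (real k + 2) * e})"
            by (intro compact_Int_closed C0infD(2)[OF f] closed_Collect_le continuous_on_const C0inf_continuous[OF f])
          show "fsupp f \<inter> {x. (real k + 2) * e \<le> f x} \<subseteq> ?V \<inter> U"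
            using C0infD(3)[OF f] e by (auto simp: algebra_simps)
          fix x assume "x \<notin> fsupp f \<inter> {x. (real k + 2) * e \<le> f x}"
          then have "f x < (real k + 2) * e" using notin_fsupp[of x f] e by (cases "x \<in> fsupp f") auto
          then show "g (k + 2) x = 0" using e by (auto simp: g_def field_simps intro!: smooth_step)
        qed
      qed
      then have "ennreal (L (g (k+2))) \<le> emeasure M ?V" using lam_upper emeasure_open[OF op] by simp
      also have "\<dots> = (\<integral>\<^sup>+x. indicator ?V x \<partial>M)" using op by simp
      also have "\<dots> \<le> (\<integral>\<^sup>+x. ennreal (g k x) \<partial>M)"
      proof (rule nn_integral_mono)
        fix x
        have "g k x = 1" if "f x > (real k + 1) * e" unfolding g_def
          by (rule smooth_step(5)) (use that e in \<open>auto simp: field_simps\<close>)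
        then show "indicator ?V x \<le> ennreal (g k x)" by (auto simp: indicator_def)
      qed
      finally show ?thesis using ei I0 by (metis ennreal_le_iff)
    qed
    have lo: "integral\<^sup>L M (g (k + 1)) \<le> L (g k)" for k
    proof -
      let ?V = "{x. f x > (real k + 1) * e}"
      have "(\<integral>\<^sup>+x. ennreal (g (k + 1) x) \<partial>M) \<le> (\<integral>\<^sup>+x. indicator ?V x \<partial>M)"
      proof (rule nn_integral_mono)
        fix x
        have "g (k + 1) x = 0" if "f x \<le> (real k + 1) * e" unfolding g_def
          by (rule smooth_step(4)) (use that e in \<open>auto simp: field_simps\<close>)
        then show "ennreal (g (k + 1) x) \<le> indicator ?V x" using g01 by (auto simp: indicator_def)
      qed
      also have "\<dots> = lam ?V" using op emeasure_open[OF op] by simp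
      also have "\<dots> \<le> ennreal (L (g k))"
      proof (rule lam_le_L[OF g g01(1)])
        fix x assume "x \<in> ?V"
        then have "g k x = 1" unfolding g_def
          by (intro smooth_step(5)) (use e in \<open>auto simp: field_simps\<close>)
        then show "1 \<le> g k x" by simp
      qed
      finally show ?thesis using ei nonneg[OF g g01(1)] by (metis ennreal_le_iff)
    qed
    have Lg: "0 \<le> L (g k)" "L (g k) \<le> L \<eta>" for k using nonneg[OF g g01(1)] mono[OF g \<eta>(1) g\<eta>] by auto
    have Ig: "0 \<le> integral\<^sup>L M (g k)" "integral\<^sup>L M (g k) \<le> integral\<^sup>L M \<eta>" for k
      using g01 g\<eta> by (auto intro!: integral_nonneg_AE integral_mono integrable_C0inf g \<eta>)
    have 1: "(\<Sum>k<n. L (g k)) \<le> 2 * L \<eta> + (\<Sum>k<n. integral\<^sup>L M (g k))" for n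
    proof -
      have "(\<Sum>k<n + 2. L (g k)) = L (g 0) + L (g 1) + (\<Sum>k<n. L (g (k + 2)))"
        by (induction n) (auto simp: numeral_2_eq_2)
      also have "\<dots> \<le> L \<eta> + L \<eta> + (\<Sum>k<n. integral\<^sup>L M (g k))" by (intro add_mono Lg sum_mono up)
      moreover have "(\<Sum>k<n. L (g k)) \<le> (\<Sum>k<n + 2. L (g k))" using Lg by (intro sum_mono2) auto
      ultimately show ?thesis by linarith
    qed
    have 2: "(\<Sum>k<n. integral\<^sup>L M (g k)) \<le> integral\<^sup>L M \<eta> + (\<Sum>k<n. L (g k))" for n
    proof -
      have "(\<Sum>k<n + 1. integral\<^sup>L M (g k)) = integral\<^sup>L M (g 0) + (\<Sum>k<n. integral\<^sup>L M (g (k + 1)))"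
        by (induction n) auto
      also have "\<dots> \<le> integral\<^sup>L M \<eta> + (\<Sum>k<n. L (g k))" by (intro add_mono Ig sum_mono lo)
      moreover have "(\<Sum>k<n. integral\<^sup>L M (g k)) \<le> (\<Sum>k<n + 1. integral\<^sup>L M (g k))" using Ig by (intro sum_mono2) auto
      ultimately show ?thesis by linarith
    qed
    have LS: "L S = (\<Sum>k<N. L (g k))" unfolding S_def[abs_def] by (rule sum) (rule g)
    have IS: "integral\<^sup>L M S = (\<Sum>k<N. integral\<^sup>L M (g k))" unfolding S_def[abs_def]
      by (rule Bochner_Integration.integral_sum) (rule integrable_C0inf[OF g])
    have "\<bar>L S - integral\<^sup>L M S\<bar> \<le> 2 * L \<eta> + integral\<^sup>L M \<eta>"
      using 1[of N] 2[of N] nonneg[OF \<eta>(1,2)] I\<eta> unfolding LS IS by auto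
    then have "e * (L S - integral\<^sup>L M S) \<le> e * (2 * L \<eta> + integral\<^sup>L M \<eta>)"
      "e * (integral\<^sup>L M S - L S) \<le> e * (2 * L \<eta> + integral\<^sup>L M \<eta>)"
      using e by (auto simp: abs_le_iff)
    then have a: "e * L S \<le> e * integral\<^sup>L M S + (2 * (e * L \<eta>) + e * integral\<^sup>L M \<eta>)"
      "e * integral\<^sup>L M S \<le> e * L S + (2 * (e * L \<eta>) + e * integral\<^sup>L M \<eta>)"
      by (simp_all add: algebra_simps)
    have fS': "f x \<le> e * S x + e * \<eta> x" "e * S x \<le> f x + e * \<eta> x" for x using fS[of x] by (auto simp: abs_le_iff)
    have b: "L f \<le> e * L S + e * L \<eta>" "e * L S \<le> L f + e * L \<eta>"
      using mono[of f "\<lambda>x. e * S x + e * \<eta> x"] mono[of "\<lambda>x. e * S x" "\<lambda>x. f x + e * \<eta> x"] fS' f S \<eta>(1)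
      by (auto simp: add cmult C0inf_add C0inf_cmult)
    have c: "integral\<^sup>L M f \<le> e * integral\<^sup>L M S + e * integral\<^sup>L M \<eta>"
      "e * integral\<^sup>L M S \<le> integral\<^sup>L M f + e * integral\<^sup>L M \<eta>"
      using integral_mono[of M f "\<lambda>x. e * S x + e * \<eta> x"] integral_mono[of M "\<lambda>x. e * S x" "\<lambda>x. f x + e * \<eta> x"]
        fS' integrable_C0inf[OF f] integrable_C0inf[OF S] integrable_C0inf[OF \<eta>(1)] by auto
    have "e * C = 3 * (e * L \<eta>) + 2 * (e * integral\<^sup>L M \<eta>)" by (simp add: C_def algebra_simps)
    then show ?thesis using a b c by (simp add: abs_le_iff)
  qed
  have "\<bar>L f - integral\<^sup>L M f\<bar> \<le> 0 + d" if "d > 0" for d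
  proof -
    have "C \<ge> 0" using nonneg[OF \<eta>(1,2)] I\<eta> by (auto simp: C_def)
    then have "d / (C + 1) * C \<le> d" using that by (simp add: field_simps)
    then show ?thesis using main[of "d / (C + 1)"] that \<open>C \<ge> 0\<close> by auto
  qed
  then have "\<bar>L f - integral\<^sup>L M f\<bar> \<le> 0" by (rule field_le_epsilon)
  then show ?thesis by simp
qed

lemma integral_C0inf: "f \<in> C0inf U \<Longrightarrow> integral\<^sup>L M f = L f"
proof -
  assume f: "f \<in> C0inf U"
  obtain \<eta> W where \<eta>: "\<eta> \<in> C0inf U" "\<And>x. 0 \<le> \<eta> x" "\<And>x. \<eta> x \<le> 1" "open W" "fsupp f \<subseteq> W" "\<And>x. x \<in> W \<Longrightarrow> \<eta> x = 1"
    using smooth_cutoff[of "fsupp f" U] C0infD[OF f] open_U by metis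
  obtain B where B: "B > 0" "\<And>x. \<bar>f x\<bar> \<le> B" using C0inf_bounded[OF f] by blast
  \<comment> \<open>Adding a multiple of a cut-off writes \<open>f\<close> as a difference of two
    nonnegative test functions; positive and negative parts would not be smooth.\<close>
  have "0 \<le> f x + B * \<eta> x" for x
    using B(2)[of x] B(1) \<eta>(2)[of x] \<eta>(5,6) notin_fsupp[of x f] by (cases "x \<in> fsupp f") auto
  then have "integral\<^sup>L M (\<lambda>x. f x + B * \<eta> x) = L (\<lambda>x. f x + B * \<eta> x)"
    by (intro integral_nonneg_C0inf C0inf_add C0inf_cmult f \<eta>)
  moreover have "integral\<^sup>L M \<eta> = L \<eta>" by (intro integral_nonneg_C0inf \<eta>)
  ultimately show "integral\<^sup>L M f = L f"
    using f \<eta>(1) integrable_C0inf[OF f] integrable_C0inf[OF \<eta>(1)] by (simp add: add cmult C0inf_cmult)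
qed

end

section \<open>The Lax--Milgram theorem on a space of functions\<close>

text \<open>Functions are not identified almost everywhere, so \<open>s u u = 0\<close> does not
  force \<open>u = 0\<close> and \<open>s\<close> is only semidefinite. The locale is used twice:
  for the \<open>L\<^sup>2\<close> product and for the symmetrised energy.\<close>

locale semi_inner =
  fixes D :: "('a \<Rightarrow> real) set" and s :: "('a \<Rightarrow> real) \<Rightarrow> ('a \<Rightarrow> real) \<Rightarrow> real"
  assumes D_zero: "(\<lambda>_. 0) \<in> D"
    and D_add: "u \<in> D \<Longrightarrow> v \<in> D \<Longrightarrow> (\<lambda>x. u x + v x) \<in> D"
    and D_cmult: "u \<in> D \<Longrightarrow> (\<lambda>x. c * u x) \<in> D"
    and s_add: "u \<in> D \<Longrightarrow> v \<in> D \<Longrightarrow> w \<in> D \<Longrightarrow> s (\<lambda>x. u x + v x) w = s u w + s v w"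
    and s_cmult: "u \<in> D \<Longrightarrow> w \<in> D \<Longrightarrow> s (\<lambda>x. c * u x) w = c * s u w"
    and s_sym: "u \<in> D \<Longrightarrow> w \<in> D \<Longrightarrow> s u w = s w u"
    and s_nonneg: "u \<in> D \<Longrightarrow> 0 \<le> s u u"
begin

lemma D_diff: "u \<in> D \<Longrightarrow> v \<in> D \<Longrightarrow> (\<lambda>x. u x - v x) \<in> D"
  using D_add[of u "\<lambda>x. (-1) * v x"] D_cmult[of v "-1"] by simp

lemma s_diff: "u \<in> D \<Longrightarrow> v \<in> D \<Longrightarrow> w \<in> D \<Longrightarrow> s (\<lambda>x. u x - v x) w = s u w - s v w"
  using s_add[of u "\<lambda>x. (-1) * v x" w] D_cmult[of v "-1"] s_cmult[of v w "-1"] by simp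

lemma s_add_right: "u \<in> D \<Longrightarrow> v \<in> D \<Longrightarrow> w \<in> D \<Longrightarrow> s w (\<lambda>x. u x + v x) = s w u + s w v"
  by (simp add: s_sym[of w] D_add s_add)

lemma s_diff_right: "u \<in> D \<Longrightarrow> v \<in> D \<Longrightarrow> w \<in> D \<Longrightarrow> s w (\<lambda>x. u x - v x) = s w u - s w v"
  by (simp add: s_sym[of w] D_diff s_diff)

lemma s_cmult_right: "u \<in> D \<Longrightarrow> w \<in> D \<Longrightarrow> s w (\<lambda>x. c * u x) = c * s w u"
  by (simp add: s_sym[of w] D_cmult s_cmult)

lemmas s_simps = D_add D_diff D_cmult s_add s_diff s_cmult s_add_right s_diff_right s_cmult_right

lemma cauchy_schwarz2: "u \<in> D \<Longrightarrow> v \<in> D \<Longrightarrow> (s u v)\<^sup>2 \<le> s u u * s v v"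
proof -
  assume u: "u \<in> D" and v: "v \<in> D"
  have q: "0 \<le> s u u + 2 * t * s u v + t\<^sup>2 * s v v" for t
  proof -
    have "0 \<le> s (\<lambda>x. u x + t * v x) (\<lambda>x. u x + t * v x)" using u v by (intro s_nonneg D_add D_cmult)
    also have "\<dots> = s u u + 2 * t * s u v + t\<^sup>2 * s v v"
      using u v s_sym[OF v u] by (simp add: s_simps algebra_simps power2_eq_square)
    finally show ?thesis .
  qed
  show ?thesis
  proof (cases "s v v = 0")
    case True
    \<comment> \<open>For \<open>s v v = 0\<close> the quadratic in \<open>t\<close> is affine; a
      nonzero slope would make it negative at the chosen \<open>t\<close>.\<close>
    have "s u v = 0"
    proof (rule ccontr)
      assume n: "s u v \<noteq> 0"
      have "2 * (- (s u u + 1) / (2 * s u v)) * s u v = - (s u u + 1)" using n by (simp add: field_simps)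
      then show False using q[of "- (s u u + 1) / (2 * s u v)"] True by simp
    qed
    then show ?thesis using True by simp
  next
    case False
    then have p: "s v v > 0" using s_nonneg[OF v] by simp
    have "s u u + 2 * (- s u v / s v v) * s u v + (- s u v / s v v)\<^sup>2 * s v v = s u u - (s u v)\<^sup>2 / s v v"
      using p by (simp add: power2_eq_square field_simps)
    then have "(s u v)\<^sup>2 / s v v \<le> s u u" using q[of "- s u v / s v v"] by linarith
    then show ?thesis using p by (simp add: pos_divide_le_eq)
  qed
qed

lemma cauchy_schwarz: "u \<in> D \<Longrightarrow> v \<in> D \<Longrightarrow> \<bar>s u v\<bar> \<le> sqrt (s u u) * sqrt (s v v)"
  using cauchy_schwarz2[of u v] real_sqrt_le_mono[of "(s u v)\<^sup>2" "s u u * s v v"]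
  by (simp add: real_sqrt_mult)

lemma diff_norm2_le: "u \<in> D \<Longrightarrow> v \<in> D \<Longrightarrow> s (\<lambda>x. u x - v x) (\<lambda>x. u x - v x) \<le> 2 * s u u + 2 * s v v"
proof -
  assume u: "u \<in> D" and v: "v \<in> D"
  have "0 \<le> s (\<lambda>x. u x + v x) (\<lambda>x. u x + v x)" using u v by (intro s_nonneg D_add)
  then show ?thesis using u v s_sym[OF v u] by (simp add: s_simps)
qed

lemma add_norm2_le: "u \<in> D \<Longrightarrow> v \<in> D \<Longrightarrow> s u u \<le> 2 * s (\<lambda>x. u x - v x) (\<lambda>x. u x - v x) + 2 * s v v"
proof -
  assume u: "u \<in> D" and v: "v \<in> D"
  have "0 \<le> s (\<lambda>x. (u x - v x) - v x) (\<lambda>x. (u x - v x) - v x)" using u v by (intro s_nonneg D_diff)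
  then show ?thesis using u v s_sym[OF v u] by (simp add: s_simps)
qed

end

locale semi_hilbert = semi_inner +
  assumes complete: "(\<And>k::nat. f k \<in> D) \<Longrightarrow>
      (\<And>e. e > 0 \<Longrightarrow> \<exists>N. \<forall>p\<ge>N. \<forall>q\<ge>N. s (\<lambda>x. f p x - f q x) (\<lambda>x. f p x - f q x) < e) \<Longrightarrow>
      \<exists>g\<in>D. (\<lambda>k. s (\<lambda>x. f k x - g x) (\<lambda>x. f k x - g x)) \<longlonglongrightarrow> 0"
begin

lemma tendsto_of_norm:
  assumes "\<And>k. f k \<in> D" "g \<in> D" "(\<lambda>k. s (\<lambda>x. f k x - g x) (\<lambda>x. f k x - g x)) \<longlonglongrightarrow> 0"
    and b: "\<And>u. u \<in> D \<Longrightarrow> \<bar>\<phi> u\<bar> \<le> M * sqrt (s u u)"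
    and l: "\<And>k. \<phi> (\<lambda>x. f k x - g x) = \<phi> (f k) - \<phi> g"
  shows "(\<lambda>k. \<phi> (f k)) \<longlonglongrightarrow> \<phi> g"
proof -
  have "(\<lambda>k. M * sqrt (s (\<lambda>x. f k x - g x) (\<lambda>x. f k x - g x))) \<longlonglongrightarrow> M * sqrt 0"
    by (intro tendsto_intros assms)
  then have 1: "(\<lambda>k. M * sqrt (s (\<lambda>x. f k x - g x) (\<lambda>x. f k x - g x))) \<longlonglongrightarrow> 0" by simp
  have "(\<lambda>k. \<phi> (f k) - \<phi> g) \<longlonglongrightarrow> 0"
    by (rule Lim_null_comparison[OF always_eventually 1])
       (use b[OF D_diff[OF assms(1,2)]] l in auto)
  then show ?thesis by (simp only: LIM_zero_iff)
qed

text \<open>Minimise \<open>F v = s v v - 2 * \<phi> v\<close>, which is bounded below by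
  \<open>- B\<^sup>2\<close>. A minimising sequence is Cauchy by the parallelogram identity, and the
  vanishing first variation at the limit is the representation.\<close>

lemma riesz:
  assumes l_add: "\<And>u v. u \<in> D \<Longrightarrow> v \<in> D \<Longrightarrow> \<phi> (\<lambda>x. u x + v x) = \<phi> u + \<phi> v"
    and l_cmult: "\<And>u c. u \<in> D \<Longrightarrow> \<phi> (\<lambda>x. c * u x) = c * \<phi> u"
    and bd: "\<And>u. u \<in> D \<Longrightarrow> \<bar>\<phi> u\<bar> \<le> B * sqrt (s u u)"
  shows "\<exists>h\<in>D. \<forall>v\<in>D. s h v = \<phi> v"
proof -
  define F where "F v = s v v - 2 * \<phi> v" for v
  have low: "- B\<^sup>2 \<le> F v" if "v \<in> D" for v
  proof -
    have "0 \<le> (sqrt (s v v) - B)\<^sup>2" by simp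
    also have "\<dots> = s v v - 2 * (B * sqrt (s v v)) + B\<^sup>2"
      using s_nonneg[OF that] by (simp add: power2_diff algebra_simps)
    finally show ?thesis using bd[OF that] unfolding F_def by linarith
  qed
  define I where "I = Inf (F ` D)"
  have bb: "bdd_below (F ` D)" using low by (intro bdd_belowI[of _ "- B\<^sup>2"]) auto
  have I_le: "I \<le> F v" if "v \<in> D" for v unfolding I_def using that bb by (intro cInf_lower) auto
  have "\<exists>v\<in>D. F v < I + 1 / real (Suc n)" for n
  proof -
    have "Inf (F ` D) < I + 1 / real (Suc n)" unfolding I_def by simp
    then show ?thesis using cInf_lessD[of "F ` D"] D_zero by blast
  qed
  then obtain f where f: "\<And>n. f n \<in> D" "\<And>n. F (f n) < I + 1 / real (Suc n)" by metis
  \<comment> \<open>In \<open>2 * F (f p) + 2 * F (f q) - 4 * F ?m\<close> the linear terms cancel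
    at the midpoint \<open>?m\<close>, and the parallelogram identity leaves the norm of the
    difference. The values of \<open>F\<close> exceed \<open>I\<close> by at most
    \<open>1 / Suc p\<close> and \<open>1 / Suc q\<close>.\<close>
  have par: "s (\<lambda>x. f p x - f q x) (\<lambda>x. f p x - f q x) \<le> 2 / real (Suc p) + 2 / real (Suc q)" for p q
  proof -
    let ?m = "\<lambda>x. 1/2 * (f p x + f q x)"
    have m: "?m \<in> D" using f by (intro D_cmult D_add)
    have "s ?m ?m = 1/4 * (s (f p) (f p) + 2 * s (f p) (f q) + s (f q) (f q))"
      by (subst s_cmult s_cmult_right, (intro D_cmult D_add f)+)+
         (simp add: s_simps f s_sym[OF f(1)[of q] f(1)[of p]])
    moreover have "\<phi> ?m = 1/2 * (\<phi> (f p) + \<phi> (f q))"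
      by (subst l_cmult) (auto intro!: D_add f simp: l_add f)
    ultimately have "s (\<lambda>x. f p x - f q x) (\<lambda>x. f p x - f q x) = 2 * F (f p) + 2 * F (f q) - 4 * F ?m"
      by (simp add: F_def s_simps f s_sym[OF f(1)[of q] f(1)[of p]])
    then show ?thesis using f(2)[of p] f(2)[of q] I_le[OF m] by simp
  qed
  have "\<exists>h\<in>D. (\<lambda>k. s (\<lambda>x. f k x - h x) (\<lambda>x. f k x - h x)) \<longlonglongrightarrow> 0"
  proof (rule complete[OF f(1)])
    fix e :: real assume "e > 0"
    obtain N where N: "4 / e < real N" using reals_Archimedean2 by blast
    have "s (\<lambda>x. f p x - f q x) (\<lambda>x. f p x - f q x) < e" if "p \<ge> N" "q \<ge> N" for p q
    proof -
      have Np: "real N > 0" using N \<open>e > 0\<close> by (smt (verit) divide_pos_pos)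
      have "2 / real (Suc p) \<le> 2 / real N" "2 / real (Suc q) \<le> 2 / real N"
        using that Np by (auto intro!: divide_left_mono)
      moreover have "4 / real N < e" using N Np \<open>e > 0\<close> by (simp add: field_simps)
      ultimately show ?thesis using par[of p q] by linarith
    qed
    then show "\<exists>N. \<forall>p\<ge>N. \<forall>q\<ge>N. s (\<lambda>x. f p x - f q x) (\<lambda>x. f p x - f q x) < e" by blast
  qed
  then obtain h where h: "h \<in> D" "(\<lambda>k. s (\<lambda>x. f k x - h x) (\<lambda>x. f k x - h x)) \<longlonglongrightarrow> 0" by blast
  have "s h v = \<phi> v" if v: "v \<in> D" for v
  proof -
    have conv: "(\<lambda>n. s (f n) v) \<longlonglongrightarrow> s h v"
      by (rule tendsto_of_norm[OF f(1) h, where \<phi>="\<lambda>u. s u v" and M="sqrt (s v v)"])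
         (use cauchy_schwarz[OF _ v] s_diff[OF f(1) h(1) v] in \<open>auto simp: mult.commute\<close>)
    have q: "0 \<le> t\<^sup>2 * s v v + 2 * t * (s h v - \<phi> v)" for t
    proof -
      have A: "- (1 / real (Suc n)) \<le> t\<^sup>2 * s v v + 2 * t * (s (f n) v - \<phi> v)" for n
      proof -
        have "I \<le> F (\<lambda>x. f n x + t * v x)" using f v by (intro I_le D_add D_cmult)
        also have "\<dots> = F (f n) + t\<^sup>2 * s v v + 2 * t * (s (f n) v - \<phi> v)"
          using f v s_sym[OF v f(1)[of n]]
          by (simp add: F_def s_simps l_add l_cmult algebra_simps power2_eq_square)
        finally show ?thesis using f(2)[of n] by linarith
      qed
      have B: "(\<lambda>n. - (1 / real (Suc n))) \<longlonglongrightarrow> - 0"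
        using LIMSEQ_inverse_real_of_nat by (intro tendsto_minus) (simp add: inverse_eq_divide)
      have C: "(\<lambda>n. t\<^sup>2 * s v v + 2 * t * (s (f n) v - \<phi> v)) \<longlonglongrightarrow> t\<^sup>2 * s v v + 2 * t * (s h v - \<phi> v)"
        by (intro tendsto_intros conv)
      have "- 0 \<le> t\<^sup>2 * s v v + 2 * t * (s h v - \<phi> v)" by (rule LIMSEQ_le[OF B C]) (use A in blast)
      then show ?thesis by simp
    qed
    \<comment> \<open>Evaluate the nonnegative quadratic \<open>q\<close> at
      \<open>t = - d / r\<close>. The choice \<open>r = s v v + 1\<close> keeps the denominator
      positive even if \<open>v\<close> has norm zero, and the value is negative unless
      \<open>d = 0\<close>.\<close>
    define d where "d = s h v - \<phi> v"
    define r where "r = s v v + 1"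
    have r: "r > 0" "s v v = r - 1" using s_nonneg[OF v] by (auto simp: r_def)
    have "0 \<le> (- d / r)\<^sup>2 * (r - 1) + 2 * (- d / r) * d" using q[of "- d / r"] r(2) by (simp add: d_def)
    also have "\<dots> = - (d\<^sup>2 * (r + 1) / r\<^sup>2)" using r(1) by (simp add: power2_eq_square field_simps)
    finally have "d\<^sup>2 * (r + 1) / r\<^sup>2 \<le> 0" by simp
    then have "d = 0" using r(1) by (smt (verit) divide_pos_pos mult_pos_pos zero_less_power2)
    then show ?thesis by (simp add: d_def)
  qed
  then show ?thesis using h(1) by blast
qed

text \<open>If \<open>z\<close> represents the residual \<open>b(g, \<cdot>) - \<phi>\<close>, the step \<open>g \<mapsto> g - t z\<close> contracts the
  residual; coercivity turns convergence of the residuals into convergence of the iterates.\<close>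

lemma lax_milgram:
  assumes b_add: "\<And>u v w. u \<in> D \<Longrightarrow> v \<in> D \<Longrightarrow> w \<in> D \<Longrightarrow> b (\<lambda>x. u x + v x) w = b u w + b v w"
    and b_cmult: "\<And>u w c. u \<in> D \<Longrightarrow> w \<in> D \<Longrightarrow> b (\<lambda>x. c * u x) w = c * b u w"
    and b_add_right: "\<And>u v w. u \<in> D \<Longrightarrow> v \<in> D \<Longrightarrow> w \<in> D \<Longrightarrow> b w (\<lambda>x. u x + v x) = b w u + b w v"
    and b_cmult_right: "\<And>u w c. u \<in> D \<Longrightarrow> w \<in> D \<Longrightarrow> b w (\<lambda>x. c * u x) = c * b w u"
    and b_bd: "\<And>u v. u \<in> D \<Longrightarrow> v \<in> D \<Longrightarrow> \<bar>b u v\<bar> \<le> M * sqrt (s u u) * sqrt (s v v)"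
    and coer: "\<And>u. u \<in> D \<Longrightarrow> s u u \<le> b u u"
    and l_add: "\<And>u v. u \<in> D \<Longrightarrow> v \<in> D \<Longrightarrow> \<phi> (\<lambda>x. u x + v x) = \<phi> u + \<phi> v"
    and l_cmult: "\<And>u c. u \<in> D \<Longrightarrow> \<phi> (\<lambda>x. c * u x) = c * \<phi> u"
    and l_bd: "\<And>u. u \<in> D \<Longrightarrow> \<bar>\<phi> u\<bar> \<le> B * sqrt (s u u)"
  shows "\<exists>w\<in>D. \<forall>v\<in>D. b w v = \<phi> v"
proof -
  define K where "K = max M 1"
  have K: "K \<ge> 1" "\<And>u v. u \<in> D \<Longrightarrow> v \<in> D \<Longrightarrow> \<bar>b u v\<bar> \<le> K * sqrt (s u u) * sqrt (s v v)"
  proof -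
    fix u v assume uv: "u \<in> D" "v \<in> D"
    have "M * (sqrt (s u u) * sqrt (s v v)) \<le> K * (sqrt (s u u) * sqrt (s v v))"
      unfolding K_def using s_nonneg uv by (intro mult_right_mono) auto
    then show "\<bar>b u v\<bar> \<le> K * sqrt (s u u) * sqrt (s v v)" using b_bd[OF uv] by (simp add: mult.assoc)
  qed (simp add: K_def)
  have b_diff: "b (\<lambda>x. u x - v x) w = b u w - b v w" if "u \<in> D" "v \<in> D" "w \<in> D" for u v w
    using b_add[of u "\<lambda>x. (-1) * v x" w] D_cmult[of v "-1"] b_cmult[of v w "-1"] that by simp
  have "\<exists>z\<in>D. \<forall>v\<in>D. s z v = b g v - \<phi> v" if g: "g \<in> D" for g
  proof (rule riesz[where B="K * sqrt (s g g) + B"])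
    fix u assume u: "u \<in> D"
    show "\<bar>b g u - \<phi> u\<bar> \<le> (K * sqrt (s g g) + B) * sqrt (s u u)"
      using K(2)[OF g u] l_bd[OF u] by (simp add: algebra_simps)
  qed (auto simp: b_add_right b_cmult_right l_add l_cmult g algebra_simps)
  then obtain Z where Z: "\<And>g. g \<in> D \<Longrightarrow> Z g \<in> D" "\<And>g v. g \<in> D \<Longrightarrow> v \<in> D \<Longrightarrow> s (Z g) v = b g v - \<phi> v"
    by metis
  \<comment> \<open>The difference \<open>r\<close> of consecutive residuals satisfies
    \<open>s r v = t * b (z n) v\<close>. Hence
    \<open>s r r \<le> t\<^sup>2 K\<^sup>2 s (z n) (z n)\<close>, while coercivity gives
    \<open>s r (z n) \<ge> t * s (z n) (z n)\<close>. With \<open>t = 1 / K\<^sup>2\<close> the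
    first bound equals \<open>t * s (z n) (z n)\<close>, so squared residuals contract by
    \<open>1 - t\<close>.\<close>
  define t where "t = 1 / K\<^sup>2"
  define f where "f n = ((\<lambda>g x. g x - t * Z g x) ^^ n) (\<lambda>_. 0)" for n
  have f: "f n \<in> D" for n
    by (induction n) (auto simp: f_def D_zero intro!: D_diff D_cmult Z)
  have fS: "f (Suc n) = (\<lambda>x. f n x - t * Z (f n) x)" for n by (simp add: f_def)
  define z where "z n = Z (f n)" for n
  have z: "z n \<in> D" for n unfolding z_def by (rule Z(1)[OF f])
  have sz: "s (z n) v = b (f n) v - \<phi> v" if "v \<in> D" for n v unfolding z_def by (rule Z(2)[OF f that])
  define q where "q = 1 - 1 / K\<^sup>2"
  have q: "0 \<le> q" "q < 1" using K(1) by (auto simp: q_def field_simps)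
  have contr: "s (z (Suc n)) (z (Suc n)) \<le> q * s (z n) (z n)" for n
  proof -
    let ?d = "z n" and ?d' = "z (Suc n)"
    define r where "r x = ?d x - ?d' x" for x
    have r: "r \<in> D" unfolding r_def[abs_def] by (intro D_diff z)
    have sr: "s r v = t * b ?d v" if v: "v \<in> D" for v
    proof -
      have "b (f (Suc n)) v = b (f n) v - t * b ?d v"
        unfolding fS z_def[symmetric] using b_diff[OF f D_cmult[OF z] v] b_cmult[OF z v] by simp
      then show ?thesis unfolding r_def[abs_def] using sz[OF v] v z by (simp add: s_diff)
    qed
    have t0: "t > 0" using K(1) by (simp add: t_def)
    have "s r r \<le> t\<^sup>2 * K\<^sup>2 * s ?d ?d"
    proof (cases "s r r = 0")
      case True then show ?thesis using s_nonneg[OF z] by simp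
    next
      case False
      then have p: "sqrt (s r r) > 0" using s_nonneg[OF r] by simp
      have "s r r = t * b ?d r" by (rule sr[OF r])
      also have "\<dots> \<le> t * (K * sqrt (s ?d ?d) * sqrt (s r r))"
        using K(2)[OF z r, of n] t0 by (intro mult_left_mono) auto
      finally have "s r r \<le> t * (K * sqrt (s ?d ?d) * sqrt (s r r))" .
      then have "sqrt (s r r) * sqrt (s r r) \<le> (t * K * sqrt (s ?d ?d)) * sqrt (s r r)"
        using s_nonneg[OF r] by (simp add: mult_ac)
      then have "sqrt (s r r) \<le> t * K * sqrt (s ?d ?d)" using p by (rule mult_right_le_imp_le)
      then have "(sqrt (s r r))\<^sup>2 \<le> (t * K * sqrt (s ?d ?d))\<^sup>2" using p by (intro power_mono) auto
      then show ?thesis using s_nonneg[OF r] s_nonneg[OF z] by (simp add: power_mult_distrib)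
    qed
    moreover have "t\<^sup>2 * K\<^sup>2 = t" using K(1) by (simp add: t_def power2_eq_square)
    ultimately have "s r r \<le> t * s ?d ?d" by simp
    moreover have "s ?d' ?d' = s ?d ?d - 2 * s r ?d + s r r"
      unfolding r_def[abs_def] using s_sym[OF z z, of n "Suc n"] by (simp add: s_simps z)
    moreover have "t * s ?d ?d \<le> s r ?d" unfolding sr[OF z] using t0 coer[OF z] by (intro mult_left_mono) auto
    ultimately have "s ?d' ?d' \<le> s ?d ?d - t * s ?d ?d" by linarith
    then show ?thesis by (simp add: q_def t_def algebra_simps)
  qed
  have geo: "s (z n) (z n) \<le> q ^ n * s (z 0) (z 0)" for n
  proof (induction n)
    case (Suc n)
    have "s (z (Suc n)) (z (Suc n)) \<le> q * (q ^ n * s (z 0) (z 0))"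
      using contr[of n] Suc mult_left_mono[OF Suc q(1)] by linarith
    then show ?case by (simp add: mult_ac)
  qed simp
  have "(\<lambda>n. q ^ n * s (z 0) (z 0)) \<longlonglongrightarrow> 0 * s (z 0) (z 0)"
    using q by (intro tendsto_mult LIMSEQ_realpow_zero tendsto_const) auto
  then have q0: "(\<lambda>n. q ^ n * s (z 0) (z 0)) \<longlonglongrightarrow> 0" by simp
  have z0: "(\<lambda>n. s (z n) (z n)) \<longlonglongrightarrow> 0"
    by (rule Lim_null_comparison[OF always_eventually q0]) (use geo s_nonneg[OF z] in simp)
  have cauchy: "s (\<lambda>x. f p x - f k x) (\<lambda>x. f p x - f k x) \<le> 2 * s (z p) (z p) + 2 * s (z k) (z k)" for p k
  proof -
    define d where "d x = f p x - f k x" for x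
    have d: "d \<in> D" unfolding d_def[abs_def] by (intro D_diff f)
    have "s d d \<le> b d d" by (rule coer[OF d])
    also have "\<dots> = b (f p) d - b (f k) d" using b_diff[OF f f d, of p k] by (simp add: d_def[abs_def])
    also have "\<dots> = s (\<lambda>x. z p x - z k x) d" using sz[OF d] d by (simp add: s_diff z)
    also have "\<dots> \<le> sqrt (s (\<lambda>x. z p x - z k x) (\<lambda>x. z p x - z k x)) * sqrt (s d d)"
      using cauchy_schwarz[OF D_diff[OF z z] d, of p k] by simp
    finally have *: "sqrt (s d d) * sqrt (s d d) \<le> sqrt (s (\<lambda>x. z p x - z k x) (\<lambda>x. z p x - z k x)) * sqrt (s d d)"
      using s_nonneg[OF d] by simp
    have "s d d \<le> s (\<lambda>x. z p x - z k x) (\<lambda>x. z p x - z k x)"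
    proof (cases "s d d = 0")
      case True then show ?thesis using s_nonneg[OF D_diff[OF z z]] by simp
    next
      case False
      then have "sqrt (s d d) > 0" using s_nonneg[OF d] by simp
      from mult_right_le_imp_le[OF * this] show ?thesis by simp
    qed
    then show ?thesis using diff_norm2_le[OF z z, of p k] by (simp add: d_def[abs_def])
  qed
  have "\<exists>g\<in>D. (\<lambda>k. s (\<lambda>x. f k x - g x) (\<lambda>x. f k x - g x)) \<longlonglongrightarrow> 0"
  proof (rule complete[OF f])
    fix e :: real assume "e > 0"
    then obtain N where N: "\<And>n. n \<ge> N \<Longrightarrow> \<bar>s (z n) (z n)\<bar> < e / 4"
      using LIMSEQ_D[OF z0, of "e/4"] by auto
    show "\<exists>N. \<forall>p\<ge>N. \<forall>q\<ge>N. s (\<lambda>x. f p x - f q x) (\<lambda>x. f p x - f q x) < e"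
    proof (intro exI allI impI)
      fix p k assume "N \<le> p" "N \<le> k"
      then show "s (\<lambda>x. f p x - f k x) (\<lambda>x. f p x - f k x) < e"
        using cauchy[of p k] N[of p] N[of k] by linarith
    qed
  qed
  then obtain g where g: "g \<in> D" "(\<lambda>k. s (\<lambda>x. f k x - g x) (\<lambda>x. f k x - g x)) \<longlonglongrightarrow> 0" by blast
  have "b g v = \<phi> v" if v: "v \<in> D" for v
  proof -
    have "(\<lambda>n. b (f n) v) \<longlonglongrightarrow> b g v"
      by (rule tendsto_of_norm[OF f g, where \<phi>="\<lambda>u. b u v" and M="K * sqrt (s v v)"])
         (use K(2)[OF _ v] b_diff[OF f g(1) v] in \<open>auto simp: mult_ac\<close>)
    then have 1: "(\<lambda>n. s (z n) v) \<longlonglongrightarrow> b g v - \<phi> v"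
      unfolding sz[OF v] by (intro tendsto_intros)
    have "(\<lambda>n. sqrt (s (z n) (z n)) * sqrt (s v v)) \<longlonglongrightarrow> sqrt 0 * sqrt (s v v)"
      by (intro tendsto_intros z0)
    then have 2: "(\<lambda>n. sqrt (s (z n) (z n)) * sqrt (s v v)) \<longlonglongrightarrow> 0" by simp
    have "(\<lambda>n. s (z n) v) \<longlonglongrightarrow> 0"
      by (rule Lim_null_comparison[OF always_eventually 2]) (use cauchy_schwarz[OF z v] in simp)
    from LIMSEQ_unique[OF 1 this] show ?thesis by simp
  qed
  then show ?thesis using g(1) by blast
qed

end

section \<open>Semi-Dirichlet forms are nonpositive on kernels vanishing on the diagonal\<close>

locale sdform =
  fixes m :: "'a::euclidean_space measure" and D :: "('a \<Rightarrow> real) set"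
    and E :: "('a \<Rightarrow> real) \<Rightarrow> ('a \<Rightarrow> real) \<Rightarrow> real" and \<alpha> C :: real
  assumes D_L2: "u \<in> D \<Longrightarrow> u \<in> borel_measurable m" "u \<in> D \<Longrightarrow> integrable m (\<lambda>x. (u x)\<^sup>2)"
    and E_ae: "u \<in> D \<Longrightarrow> u' \<in> D \<Longrightarrow> v \<in> D \<Longrightarrow> AE x in m. u x = u' x \<Longrightarrow> E u v = E u' v"
    and D_zero: "(\<lambda>_. 0) \<in> D"
    and D_add: "u \<in> D \<Longrightarrow> v \<in> D \<Longrightarrow> (\<lambda>x. u x + v x) \<in> D"
    and D_cmult: "u \<in> D \<Longrightarrow> (\<lambda>x. c * u x) \<in> D"
    and E_lin: "u \<in> D \<Longrightarrow> u' \<in> D \<Longrightarrow> v \<in> D \<Longrightarrow> E (\<lambda>x. a * u x + b * u' x) v = a * E u v + b * E u' v"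
      "u \<in> D \<Longrightarrow> u' \<in> D \<Longrightarrow> v \<in> D \<Longrightarrow> E v (\<lambda>x. a * u x + b * u' x) = a * E v u + b * E v u'"
    and alpha: "0 \<le> \<alpha>"
    and E_nonneg: "u \<in> D \<Longrightarrow> 0 \<le> Ealpha m E \<alpha> u u"
    and sector: "u \<in> D \<Longrightarrow> v \<in> D \<Longrightarrow> \<bar>Ealpha m E (\<alpha> + 1) u v\<bar>
        \<le> C * sqrt (Ealpha m E (\<alpha> + 1) u u) * sqrt (Ealpha m E (\<alpha> + 1) v v)"
    and E_complete: "(\<And>k::nat. f k \<in> D) \<Longrightarrow>
       (\<And>e. e > 0 \<Longrightarrow> \<exists>N. \<forall>p\<ge>N. \<forall>q\<ge>N. Ealpha m E (\<alpha> + 1) (\<lambda>x. f p x - f q x) (\<lambda>x. f p x - f q x) < e) \<Longrightarrow>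
       \<exists>g\<in>D. (\<lambda>k. Ealpha m E (\<alpha> + 1) (\<lambda>x. f k x - g x) (\<lambda>x. f k x - g x)) \<longlonglongrightarrow> 0"
    and truncate: "u \<in> D \<Longrightarrow> (\<lambda>x. min (max (u x) 0) 1) \<in> D"
    and markov: "u \<in> D \<Longrightarrow> 0 \<le> E (\<lambda>x. min (max (u x) 0) 1) (\<lambda>x. u x - min (max (u x) 0) 1)"

lemma semi_dirichlet_formE:
  assumes "semi_dirichlet_form m D E"
  obtains \<alpha> C where "sdform m D E \<alpha> C"
proof -
  note a = assms[unfolded semi_dirichlet_form_def]
  from a obtain \<alpha> C where al: "\<alpha> \<ge> 0" "\<forall>u\<in>D. Ealpha m E \<alpha> u u \<ge> 0"
    "\<forall>u\<in>D. \<forall>v\<in>D. \<bar>Ealpha m E (\<alpha> + 1) u v\<bar>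
              \<le> C * sqrt (Ealpha m E (\<alpha> + 1) u u) * sqrt (Ealpha m E (\<alpha> + 1) v v)"
    "\<forall>f. (\<forall>k. f k \<in> D) \<longrightarrow>
           (\<forall>e>0. \<exists>N. \<forall>p\<ge>N. \<forall>q\<ge>N.
              Ealpha m E (\<alpha> + 1) (\<lambda>x. f p x - f q x) (\<lambda>x. f p x - f q x) < e) \<longrightarrow>
           (\<exists>g\<in>D. (\<lambda>k. Ealpha m E (\<alpha> + 1) (\<lambda>x. f k x - g x) (\<lambda>x. f k x - g x))
                     \<longlonglongrightarrow> 0)" by (elim conjE exE) (rule that; assumption)
  have L2: "u \<in> borel_measurable m" "integrable m (\<lambda>x. (u x)\<^sup>2)" if "u \<in> D" for u
    using a that by (auto simp: L2_def)
  have lin: "\<forall>u\<in>D. \<forall>u'\<in>D. \<forall>v\<in>D. \<forall>a b.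
        E (\<lambda>x. a * u x + b * u' x) v = a * E u v + b * E u' v \<and>
        E v (\<lambda>x. a * u x + b * u' x) = a * E v u + b * E v u'"
    using a by (elim conjE)
  have tr: "\<forall>u\<in>D. (\<lambda>x. min (max (u x) 0) 1) \<in> D \<and>
        E (\<lambda>x. min (max (u x) 0) 1) (\<lambda>x. u x - min (max (u x) 0) 1) \<ge> 0"
    using a by (elim conjE)
  have "sdform m D E \<alpha> C"
  proof (unfold_locales, goal_cases)
    case 1 then show ?case using L2 by blast
  next
    case 2 then show ?case using L2 by blast
  next
    case 3 then show ?case using a by blast
  next
    case 4 then show ?case using a by blast
  next
    case (5 u v)
    have "\<forall>u\<in>D. \<forall>v\<in>D. (\<lambda>x. u x + v x) \<in> D" using a by (elim conjE)
    then show ?case using 5 by blast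
  next
    case (6 u c)
    have "\<forall>u\<in>D. \<forall>c. (\<lambda>x. c * u x) \<in> D" using a by (elim conjE)
    then show ?case using 6 by blast
  next
    case (7 u u' v a b)
    then show ?case using lin by blast
  next
    case (8 u u' v a b)
    then show ?case using lin by blast
  next
    case 9 show ?case by (rule al(1))
  next
    case 10 then show ?case using al(2) by blast
  next
    case 11 then show ?case using al(3) by blast
  next
    case (12 f) then show ?case using al(4) by blast
  next
    case 13 then show ?case using tr by blast
  next
    case 14 then show ?case using tr by blast
  qed
  then show ?thesis by (rule that)
qed

context sdform
begin

definition ip :: "('a \<Rightarrow> real) \<Rightarrow> ('a \<Rightarrow> real) \<Rightarrow> real" where
  "ip u v = (\<integral>x. u x * v x \<partial>m)"

lemma ip_integrable: "u \<in> D \<Longrightarrow> v \<in> D \<Longrightarrow> integrable m (\<lambda>x. u x * v x)"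
proof -
  assume u: "u \<in> D" and v: "v \<in> D"
  have "integrable m (\<lambda>x. (u x)\<^sup>2 + (v x)\<^sup>2)" using D_L2(2)[OF u] D_L2(2)[OF v] by simp
  then show ?thesis
  proof (rule Bochner_Integration.integrable_bound)
    show "(\<lambda>x. u x * v x) \<in> borel_measurable m" using D_L2(1)[OF u] D_L2(1)[OF v] by simp
    have "\<bar>a * b\<bar> \<le> a\<^sup>2 + b\<^sup>2" for a b :: real
    proof -
      have "2 * (\<bar>a\<bar> * \<bar>b\<bar>) \<le> a\<^sup>2 + b\<^sup>2"
        using sum_squares_bound[of "\<bar>a\<bar>" "\<bar>b\<bar>"] by (simp add: mult.assoc)
      moreover have "0 \<le> \<bar>a\<bar> * \<bar>b\<bar>" by simp
      ultimately show ?thesis unfolding abs_mult by linarith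
    qed
    then show "AE x in m. norm (u x * v x) \<le> norm ((u x)\<^sup>2 + (v x)\<^sup>2)" by simp
  qed
qed

sublocale ip: semi_inner D ip
proof (unfold_locales, goal_cases)
  case (4 u v w)
  then show ?case using ip_integrable[of u w] ip_integrable[of v w] by (simp add: ip_def distrib_right)
next
  case (5 u w c)
  then show ?case using ip_integrable[of u w] by (simp add: ip_def mult.assoc)
next
  case (6 u w) then show ?case by (simp add: ip_def mult.commute)
next
  case (7 u) then show ?case by (auto simp: ip_def intro!: integral_nonneg_AE)
qed (auto intro: D_zero D_add D_cmult)

lemma E_add: "u \<in> D \<Longrightarrow> v \<in> D \<Longrightarrow> w \<in> D \<Longrightarrow> E (\<lambda>x. u x + v x) w = E u w + E v w"
  using E_lin(1)[of u v w 1 1] by simp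

lemma E_add_right: "u \<in> D \<Longrightarrow> v \<in> D \<Longrightarrow> w \<in> D \<Longrightarrow> E w (\<lambda>x. u x + v x) = E w u + E w v"
  using E_lin(2)[of u v w 1 1] by simp

lemma E_cmult: "u \<in> D \<Longrightarrow> w \<in> D \<Longrightarrow> E (\<lambda>x. c * u x) w = c * E u w"
  using E_lin(1)[of u u w c 0] by simp

lemma E_cmult_right: "u \<in> D \<Longrightarrow> w \<in> D \<Longrightarrow> E w (\<lambda>x. c * u x) = c * E w u"
  using E_lin(2)[of u u w c 0] by simp

lemma E_diff: "u \<in> D \<Longrightarrow> v \<in> D \<Longrightarrow> w \<in> D \<Longrightarrow> E (\<lambda>x. u x - v x) w = E u w - E v w"
  using E_lin(1)[of u v w 1 "-1"] by simp

lemmas E_simps = E_add E_add_right E_cmult E_cmult_right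

definition e :: "('a \<Rightarrow> real) \<Rightarrow> ('a \<Rightarrow> real) \<Rightarrow> real" where
  "e u v = Ealpha m E (\<alpha> + 1) u v"

lemma e_eq: "e u v = E u v + (\<alpha> + 1) * ip u v"
  by (simp add: e_def Ealpha_def ip_def)

text \<open>The symmetric part of the shifted form. It has the same diagonal as \<open>e\<close>, so
  the closedness of the form is completeness of \<open>s\<close>; the asymmetry of \<open>E\<close>
  is left to Lax-Milgram, with the sector condition as continuity.\<close>

definition s :: "('a \<Rightarrow> real) \<Rightarrow> ('a \<Rightarrow> real) \<Rightarrow> real" where
  "s u v = (e u v + e v u) / 2"

lemma s_diag: "s u u = e u u"
  by (simp add: s_def)

lemma ip_le_e: "u \<in> D \<Longrightarrow> ip u u \<le> e u u"
  using E_nonneg[of u] unfolding e_eq Ealpha_def ip_def by (simp add: algebra_simps)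

sublocale s: semi_hilbert D s
proof (unfold_locales, goal_cases)
  case (4 u v w)
  then show ?case by (simp add: s_def e_eq E_simps ip.s_simps field_simps)
next
  case (5 u w c)
  then show ?case by (simp add: s_def e_eq E_simps ip.s_simps field_simps)
next
  case (6 u w) then show ?case by (simp add: s_def)
next
  case (7 u) then show ?case using ip_le_e[of u] ip.s_nonneg[of u] by (simp add: s_diag)
next
  case (8 f) then show ?case using E_complete[of f] by (simp add: s_diag e_def)
qed (auto intro: D_zero D_add D_cmult)

lemma ip_le_s: "u \<in> D \<Longrightarrow> ip u u \<le> s u u"
  using ip_le_e by (simp add: s_diag)

lemma ip_bd: "u \<in> D \<Longrightarrow> v \<in> D \<Longrightarrow> \<bar>ip u v\<bar> \<le> sqrt (s u u) * sqrt (s v v)"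
  by (rule order_trans[OF ip.cauchy_schwarz])
    (auto intro!: mult_mono ip_le_s simp: ip.s_nonneg s.s_nonneg)

lemma E_bd: "u \<in> D \<Longrightarrow> v \<in> D \<Longrightarrow> \<bar>E u v\<bar> \<le> (C + (\<alpha> + 1)) * sqrt (s u u) * sqrt (s v v)"
proof -
  assume u: "u \<in> D" and v: "v \<in> D"
  have "\<bar>(\<alpha> + 1) * ip u v\<bar> \<le> (\<alpha> + 1) * (sqrt (s u u) * sqrt (s v v))"
    unfolding abs_mult using ip_bd[OF u v] alpha by (intro mult_mono) auto
  moreover have "\<bar>E u v + (\<alpha> + 1) * ip u v\<bar> \<le> C * (sqrt (s u u) * sqrt (s v v))"
    using sector[OF u v] by (simp add: e_eq[symmetric] s_diag e_def mult.assoc)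
  ultimately have "\<bar>E u v\<bar> \<le> C * (sqrt (s u u) * sqrt (s v v)) + (\<alpha> + 1) * (sqrt (s u u) * sqrt (s v v))"
    by linarith
  then show ?thesis by (simp add: algebra_simps)
qed

text \<open>The solution is the defect \<open>w = u - \<beta> G\<^sub>\<beta> u\<close> of the
  resolvent: \<open>u - w\<close> solves the resolvent equation with right-hand side
  \<open>\<beta> (u, v)\<close>. The functional \<open>E u\<close> on the right has a bound
  independent of \<beta>, which is what the asymptotics in \<beta> exploit.\<close>

lemma solve:
  assumes u: "u \<in> D" and l: "\<alpha> + 1 \<le> \<beta>"
  shows "\<exists>w\<in>D. \<forall>v\<in>D. E w v + \<beta> * ip w v = E u v"
proof (rule s.lax_milgram[where M="C + (\<alpha> + 1) + \<beta>" and B="(C + (\<alpha> + 1)) * sqrt (s u u)"], goal_cases)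
  case (5 w v)
  have "\<bar>\<beta> * ip w v\<bar> \<le> \<beta> * (sqrt (s w w) * sqrt (s v v))"
    unfolding abs_mult using ip_bd[OF 5] alpha l by (intro mult_mono) auto
  then show ?case using E_bd[OF 5] by (simp add: algebra_simps)
next
  case (6 w)
  have "(\<alpha> + 1) * ip w w \<le> \<beta> * ip w w" using l ip.s_nonneg[OF 6] by (intro mult_right_mono)
  then show ?case by (simp add: s_diag e_eq)
next
  case (9 w)
  then show ?case using E_bd[OF u 9] by simp
qed (use u in \<open>auto simp: E_simps ip.s_simps algebra_simps\<close>)

text \<open>The solutions \<open>h\<^sub>n\<close> of \<open>s(h\<^sub>n, v) + n (h\<^sub>n, v) = E(v, b)\<close> form a Cauchy sequence because
  \<open>E(h\<^sub>n, b)\<close> decreases; their \<open>L\<^sup>2\<close>-norms tend to zero, hence so do their energies.\<close>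

lemma weak_bound:
  assumes b: "b \<in> D" and \<eta>: "\<eta> > 0"
  shows "\<exists>K\<ge>0. \<forall>w\<in>D. \<bar>E w b\<bar> \<le> \<eta> * sqrt (s w w) + K * sqrt (ip w w)"
proof -
  have "\<exists>h\<in>D. \<forall>v\<in>D. s h v + real n * ip h v = E v b" for n
  proof (rule s.lax_milgram[where M="1 + real n" and B="(C + (\<alpha> + 1)) * sqrt (s b b)"], goal_cases)
    case (5 w v)
    have "\<bar>real n * ip w v\<bar> \<le> real n * (sqrt (s w w) * sqrt (s v v))"
      unfolding abs_mult using ip_bd[OF 5] by (intro mult_mono) auto
    then show ?case using s.cauchy_schwarz[OF 5] by (simp add: algebra_simps)
  next
    case (9 w)
    then show ?case using E_bd[OF 9 b] by (simp add: mult_ac)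
  qed (use b ip.s_nonneg in \<open>auto simp: E_simps ip.s_simps s.s_simps algebra_simps\<close>)
  then obtain h where h: "\<And>n. h n \<in> D" "\<And>n v. v \<in> D \<Longrightarrow> s (h n) v + real n * ip (h n) v = E v b"
    by metis
  define c where "c n = E (h n) b" for n
  have c: "c n = s (h n) (h n) + real n * ip (h n) (h n)" for n by (simp add: c_def h)
  have c0: "0 \<le> c n" for n unfolding c using s.s_nonneg[OF h(1)] ip.s_nonneg[OF h(1)] by simp
  have diff: "s (\<lambda>x. h n x - h k x) (\<lambda>x. h n x - h k x) \<le> c n - c k" if nk: "n \<le> k" for n k
  proof -
    let ?d = "\<lambda>x. h n x - h k x"
    have d: "?d \<in> D" by (intro s.D_diff h)
    \<comment> \<open>The equation for \<open>h n\<close>, tested with \<open>h k\<close>, turns the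
      mixed term into \<open>c k\<close>; since \<open>n \<le> k\<close>, the last term is at most
      \<open>c k\<close> as well.\<close>
    have "s ?d ?d + real n * ip ?d ?d = (s (h n) (h n) + real n * ip (h n) (h n))
        - 2 * (s (h n) (h k) + real n * ip (h n) (h k)) + (s (h k) (h k) + real n * ip (h k) (h k))"
      using s.s_sym[OF h(1) h(1), of n k] ip.s_sym[OF h(1) h(1), of n k]
      by (simp add: s.s_simps ip.s_simps h(1) algebra_simps)
    also have "\<dots> = c n - 2 * c k + (s (h k) (h k) + real n * ip (h k) (h k))"
      by (simp add: h c_def)
    also have "\<dots> \<le> c n - 2 * c k + c k"
      unfolding c[of k] using nk ip.s_nonneg[OF h(1)[of k]] by (intro add_left_mono mult_right_mono) auto
    finally have "s ?d ?d + real n * ip ?d ?d \<le> c n - c k" by simp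
    moreover have "0 \<le> real n * ip ?d ?d" using ip.s_nonneg[OF d] by simp
    ultimately show ?thesis by linarith
  qed
  have dec: "decseq c"
  proof (rule decseq_SucI)
    fix n show "c (Suc n) \<le> c n"
      using diff[of n "Suc n"] s.s_nonneg[OF s.D_diff[OF h(1) h(1)], of n "Suc n"] by simp
  qed
  then obtain c' where "c \<longlonglongrightarrow> c'"
    using decseq_convergent[of c 0] c0 by metis
  then have "Cauchy c" by (rule LIMSEQ_imp_Cauchy)
  have "\<exists>g\<in>D. (\<lambda>k. s (\<lambda>x. h k x - g x) (\<lambda>x. h k x - g x)) \<longlonglongrightarrow> 0"
  proof (rule s.complete[OF h(1)])
    fix r :: real assume "r > 0"
    then obtain N where N': "\<forall>p\<ge>N. \<forall>q\<ge>N. \<bar>c p - c q\<bar> < r"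
      using CauchyD[OF \<open>Cauchy c\<close>, of r] by (auto simp: real_norm_def)
    then have N: "\<bar>c p - c q\<bar> < r" if "p \<ge> N" "q \<ge> N" for p q using that by blast
    have "s (\<lambda>x. h p x - h q x) (\<lambda>x. h p x - h q x) < r" if pq: "p \<ge> N" "q \<ge> N" for p q
    proof (cases "p \<le> q")
      case True then show ?thesis using diff[OF True] N[OF pq] by linarith
    next
      case False
      then have "q \<le> p" by simp
      have "s (\<lambda>x. h p x - h q x) (\<lambda>x. h p x - h q x) = s (\<lambda>x. h q x - h p x) (\<lambda>x. h q x - h p x)"
        by (simp add: s.s_simps h(1))
      then show ?thesis using diff[OF \<open>q \<le> p\<close>] N[OF pq] by linarith
    qed
    then show "\<exists>N. \<forall>p\<ge>N. \<forall>q\<ge>N. s (\<lambda>x. h p x - h q x) (\<lambda>x. h p x - h q x) < r" by blast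
  qed
  then obtain g where g: "g \<in> D" "(\<lambda>k. s (\<lambda>x. h k x - g x) (\<lambda>x. h k x - g x)) \<longlonglongrightarrow> 0" by blast
  have ipb: "ip g g \<le> 2 * s (\<lambda>x. h n x - g x) (\<lambda>x. h n x - g x) + 2 * c 0 * (1 / real n)" if "n > 0" for n
  proof -
    have "real n * ip (h n) (h n) \<le> c n" unfolding c using s.s_nonneg[OF h(1)] by simp
    also have "\<dots> \<le> c 0" using dec by (simp add: decseq_def)
    finally have "ip (h n) (h n) \<le> c 0 * (1 / real n)" using that by (simp add: field_simps)
    moreover have "ip g g \<le> 2 * ip (\<lambda>x. g x - h n x) (\<lambda>x. g x - h n x) + 2 * ip (h n) (h n)"
      by (rule ip.add_norm2_le[OF g(1) h(1)])
    moreover have "ip (\<lambda>x. g x - h n x) (\<lambda>x. g x - h n x) \<le> s (\<lambda>x. g x - h n x) (\<lambda>x. g x - h n x)"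
      by (intro ip_le_s s.D_diff g h)
    moreover have "s (\<lambda>x. g x - h n x) (\<lambda>x. g x - h n x) = s (\<lambda>x. h n x - g x) (\<lambda>x. h n x - g x)"
      by (simp add: s.s_simps h(1) g(1))
    ultimately show ?thesis by linarith
  qed
  have lim: "(\<lambda>n. 2 * s (\<lambda>x. h n x - g x) (\<lambda>x. h n x - g x) + 2 * c 0 * (1 / real n)) \<longlonglongrightarrow> 2 * 0 + 2 * c 0 * 0"
    by (intro tendsto_intros g lim_1_over_n)
  have "ip g g \<le> 2 * 0 + 2 * c 0 * 0"
    by (rule LIMSEQ_le_const[OF lim]) (use ipb in \<open>auto intro!: exI[of _ 1]\<close>)
  then have "ip g g = 0" using ip.s_nonneg[OF g(1)] by simp
  \<comment> \<open>Completeness only provides a limit in energy. That the limit has zero energy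
    follows from its vanishing in \<open>L\<^sup>2\<close> together with the invariance of
    \<open>E\<close> under changes on null sets.\<close>
  then have "AE x in m. g x = 0"
    using integral_nonneg_eq_0_iff_AE[OF ip_integrable[OF g(1) g(1)]] by (auto simp: ip_def)
  then have "E g g = E (\<lambda>_. 0) g" by (intro E_ae g D_zero)
  also have "\<dots> = 0" using E_cmult[OF D_zero g(1), of 0] by simp
  finally have sg: "s g g = 0" using \<open>ip g g = 0\<close> by (simp add: s_diag e_eq)
  have "\<exists>n. s (\<lambda>x. h n x - g x) (\<lambda>x. h n x - g x) < \<eta>\<^sup>2 / 2"
  proof -
    obtain N where N: "\<forall>n\<ge>N. norm (s (\<lambda>x. h n x - g x) (\<lambda>x. h n x - g x) - 0) < \<eta>\<^sup>2 / 2"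
      using LIMSEQ_D[OF g(2), of "\<eta>\<^sup>2 / 2"] \<eta> by auto
    then have "norm (s (\<lambda>x. h N x - g x) (\<lambda>x. h N x - g x) - 0) < \<eta>\<^sup>2 / 2" by blast
    then have "s (\<lambda>x. h N x - g x) (\<lambda>x. h N x - g x) < \<eta>\<^sup>2 / 2" by simp
    then show ?thesis by blast
  qed
  then obtain n where n: "s (\<lambda>x. h n x - g x) (\<lambda>x. h n x - g x) < \<eta>\<^sup>2 / 2" by blast
  have "s (h n) (h n) \<le> \<eta>\<^sup>2" using s.add_norm2_le[OF h(1)[of n] g(1)] n sg by simp
  then have hn: "sqrt (s (h n) (h n)) \<le> \<eta>" using \<eta> by (simp add: real_le_lsqrt)
  \<comment> \<open>By its equation, \<open>h n\<close> represents \<open>E w b\<close> as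
    \<open>s (h n) w + n * ip (h n) w\<close>. Cauchy-Schwarz in each product gives the two terms,
    the first with the small factor \<eta>, the second with
    \<open>K = n * sqrt (ip (h n) (h n))\<close>.\<close>
  show ?thesis
  proof (intro exI[of _ "real n * sqrt (ip (h n) (h n))"] conjI ballI)
    show "0 \<le> real n * sqrt (ip (h n) (h n))" using ip.s_nonneg[OF h(1)] by simp
    fix w assume w: "w \<in> D"
    have "\<bar>E w b\<bar> = \<bar>s (h n) w + real n * ip (h n) w\<bar>" by (simp add: h w)
    also have "\<dots> \<le> \<bar>s (h n) w\<bar> + real n * \<bar>ip (h n) w\<bar>"
      using abs_triangle_ineq[of "s (h n) w" "real n * ip (h n) w"] by (simp add: abs_mult)
    also have "\<dots> \<le> \<eta> * sqrt (s w w) + real n * (sqrt (ip (h n) (h n)) * sqrt (ip w w))"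
    proof (intro add_mono mult_left_mono ip.cauchy_schwarz h w)
      show "\<bar>s (h n) w\<bar> \<le> \<eta> * sqrt (s w w)"
        using s.cauchy_schwarz[OF h(1)[of n] w] mult_right_mono[OF hn, of "sqrt (s w w)"] s.s_nonneg[OF w]
        by simp
    qed simp
    finally show "\<bar>E w b\<bar> \<le> \<eta> * sqrt (s w w) + real n * sqrt (ip (h n) (h n)) * sqrt (ip w w)"
      by (simp add: mult.assoc)
  qed
qed

text \<open>Testing the equation with \<open>w\<close> itself gives
  \<open>s w w + (\<beta> - \<alpha> - 1) * ip w w = E u w\<close>. So the energy of
  \<open>w\<close> stays bounded while its \<open>L\<^sup>2\<close> norm decays like the inverse
  root of \<beta>. By \<open>weak_bound\<close> this suffices: a small multiple of the energy norm
  plus a fixed multiple of the \<open>L\<^sup>2\<close> norm.\<close>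

lemma resolvent_defect_vanishes:
  assumes u: "u \<in> D" and b: "b \<in> D" and \<epsilon>: "\<epsilon> > 0"
  shows "\<exists>\<Lambda>. \<forall>\<beta>\<ge>\<Lambda>. \<forall>w\<in>D. (\<forall>v\<in>D. E w v + \<beta> * ip w v = E u v) \<longrightarrow> \<bar>E w b\<bar> \<le> \<epsilon>"
proof -
  define C' where "C' = \<bar>(C + (\<alpha> + 1)) * sqrt (s u u)\<bar> + 1"
  have C': "C' > 0" by (simp add: C'_def)
  have Eu: "\<bar>E u w\<bar> \<le> C' * sqrt (s w w)" if "w \<in> D" for w
  proof -
    have "((C + (\<alpha> + 1)) * sqrt (s u u)) * sqrt (s w w) \<le> C' * sqrt (s w w)"
      unfolding C'_def using s.s_nonneg[OF that] by (intro mult_right_mono) auto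
    then show ?thesis using E_bd[OF u that] by linarith
  qed
  obtain K where K: "K \<ge> 0" "\<And>w. w \<in> D \<Longrightarrow> \<bar>E w b\<bar> \<le> (\<epsilon> / (2 * C')) * sqrt (s w w) + K * sqrt (ip w w)"
    using weak_bound[OF b, of "\<epsilon> / (2 * C')"] C' \<epsilon> by auto
  \<comment> \<open>Chosen so that \<open>(K + 1) * sqrt (ip w w) \<le> \<epsilon> / 2\<close>, half
    of the permitted error; \<open>K + 1\<close> replaces \<open>K\<close> to have a positive
    constant.\<close>
  define \<Lambda> where "\<Lambda> = \<alpha> + 1 + (2 * (K + 1) * C' / \<epsilon>)\<^sup>2"
  have "\<bar>E w b\<bar> \<le> \<epsilon>" if l: "\<beta> \<ge> \<Lambda>" and w: "w \<in> D" and eq: "\<forall>v\<in>D. E w v + \<beta> * ip w v = E u v" for \<beta> w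
  proof -
    define r where "r = \<beta> - (\<alpha> + 1)"
    have r: "(2 * (K + 1) * C' / \<epsilon>)\<^sup>2 \<le> r" using l by (simp add: r_def \<Lambda>_def)
    have rp: "0 < 2 * (K + 1) * C' / \<epsilon>" using K(1) C' \<epsilon> by (intro divide_pos_pos mult_pos_pos) auto
    then have r0: "0 < r" using r by (smt (verit) zero_less_power)
    have *: "s w w + r * ip w w = E u w" using eq w by (simp add: s_diag e_eq r_def algebra_simps)
    have ip0: "0 \<le> r * ip w w" using r0 ip.s_nonneg[OF w] by simp
    have "s w w \<le> C' * sqrt (s w w)" using * ip0 Eu[OF w] by linarith
    then have sw: "sqrt (s w w) \<le> C'"
    proof (cases "s w w = 0")
      case False
      then have p: "sqrt (s w w) > 0" using s.s_nonneg[OF w] by simp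
      have "sqrt (s w w) * sqrt (s w w) \<le> C' * sqrt (s w w)"
        using \<open>s w w \<le> C' * sqrt (s w w)\<close> s.s_nonneg[OF w] by simp
      then show ?thesis using p by (rule mult_right_le_imp_le)
    qed (use C' in simp)
    have "r * ip w w \<le> C' * C'"
      using * s.s_nonneg[OF w] Eu[OF w] mult_left_mono[OF sw, of C'] C' by linarith
    then have "sqrt (r * ip w w) \<le> sqrt (C' * C')" by (rule real_sqrt_le_mono)
    then have "sqrt r * sqrt (ip w w) \<le> C'" using C' by (simp add: real_sqrt_mult)
    moreover have "2 * (K + 1) * C' / \<epsilon> \<le> sqrt r" using r rp by (intro real_le_rsqrt)
    ultimately have "(2 * (K + 1) * C' / \<epsilon>) * sqrt (ip w w) \<le> C'"
      using ip.s_nonneg[OF w] by (meson mult_right_mono order_trans real_sqrt_ge_zero)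
    then have "C' * (2 * (K + 1) * sqrt (ip w w)) \<le> C' * \<epsilon>" using \<epsilon> by (simp add: field_simps)
    then have "2 * (K + 1) * sqrt (ip w w) \<le> \<epsilon>" using C' by simp
    moreover have "K * sqrt (ip w w) \<le> (K + 1) * sqrt (ip w w)"
      using ip.s_nonneg[OF w] by (intro mult_right_mono) auto
    moreover have "(\<epsilon> / (2 * C')) * sqrt (s w w) \<le> (\<epsilon> / (2 * C')) * C'"
      using sw \<epsilon> C' by (intro mult_left_mono) auto
    moreover have "(\<epsilon> / (2 * C')) * C' = \<epsilon> / 2" using C' by simp
    ultimately show ?thesis using K(2)[OF w] by linarith
  qed
  then show ?thesis by blast
qed

text \<open>Test the equation with the difference of \<open>g\<close> and its truncation to \<open>[0, c]\<close>.\<close>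

lemma resolvent_positive:
  assumes u: "u \<in> D" and u0: "\<And>x. 0 \<le> u x" and uc: "\<And>x. u x \<le> c" and c: "c > 0" and l: "\<alpha> + 1 \<le> \<beta>"
    and g: "g \<in> D" and eq: "\<And>v. v \<in> D \<Longrightarrow> E g v + \<beta> * ip g v = \<beta> * ip u v"
  shows "AE x in m. 0 \<le> g x"
proof -
  define t where "t x = min (max ((1/c) * g x) 0) 1" for x
  have g': "(\<lambda>x. (1/c) * g x) \<in> D" by (intro D_cmult g)
  have t: "t \<in> D" unfolding t_def[abs_def] by (rule truncate[OF g'])
  define p where "p x = c * t x" for x
  have p: "p \<in> D" unfolding p_def[abs_def] by (intro D_cmult t)
  have mk: "0 \<le> E t (\<lambda>x. (1/c) * g x - t x)" unfolding t_def[abs_def] by (rule markov[OF g'])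
  define d where "d x = g x - p x" for x
  have d: "d \<in> D" unfolding d_def[abs_def] by (intro s.D_diff g p)
  have "E p d = c\<^sup>2 * E t (\<lambda>x. (1/c) * g x - t x)"
  proof -
    have "d = (\<lambda>x. c * ((1/c) * g x - t x))" using c by (auto simp: d_def p_def fun_eq_iff field_simps)
    then show ?thesis unfolding p_def[abs_def]
      using E_cmult[OF t d, of c] E_cmult_right[OF s.D_diff[OF g' t] t, of c] by (simp add: power2_eq_square)
  qed
  then have Epd: "0 \<le> E p d" using mk by simp
  have "s d d \<le> E d d + \<beta> * ip d d" using l ip.s_nonneg[OF d] by (simp add: s_diag e_eq mult_right_mono)
  also have "\<dots> = (E g d + \<beta> * ip g d) - E p d - \<beta> * ip p d"
  proof -
    have 1: "E d d = E g d - E p d" "ip d d = ip g d - ip p d"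
      using E_diff[OF g p d] ip.s_diff[OF g p d] by (simp_all add: d_def[abs_def])
    show ?thesis unfolding 1 by (simp add: algebra_simps)
  qed
  also have "\<dots> \<le> \<beta> * (ip u d - ip p d)" using eq[OF d] Epd by (simp add: algebra_simps)
  also have "\<dots> \<le> 0"
  proof -
    have "ip u d - ip p d = (\<integral>x. (u x - p x) * d x \<partial>m)"
      using ip_integrable[OF u d] ip_integrable[OF p d] by (simp add: ip_def left_diff_distrib)
    also have "\<dots> \<le> (\<integral>x. 0 \<partial>m)"
    proof (rule integral_mono)
      show "integrable m (\<lambda>x. (u x - p x) * d x)"
        using ip_integrable[OF u d] ip_integrable[OF p d] by (simp add: left_diff_distrib)
      fix x
      \<comment> \<open>The value \<open>p x\<close> is the projection of \<open>g x\<close> to the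
        interval from 0 to \<open>c\<close>, and \<open>u x\<close> lies in that interval: the
        obtuse angle property in dimension one.\<close>
      show "(u x - p x) * d x \<le> 0"
      proof -
        consider "g x < 0" | "0 \<le> g x" "g x \<le> c" | "c < g x" by linarith
        then show ?thesis
        proof cases
          case 1
          then have "p x = 0" using c by (simp add: p_def t_def divide_neg_pos)
          then show ?thesis using 1 u0[of x] by (simp add: d_def mult_nonneg_nonpos)
        next
          case 2
          then have "p x = g x" using c by (simp add: p_def t_def field_simps min_def max_def)
          then show ?thesis by (simp add: d_def)
        next
          case 3
          then have "p x = c" using c by (simp add: p_def t_def field_simps min_def max_def)
          then show ?thesis using 3 uc[of x] by (simp add: d_def mult_nonpos_nonneg)
        qed
      qed
    qed simp
    finally show ?thesis using l alpha by (simp add: mult_nonneg_nonpos)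
  qed
  finally have "ip d d = 0" using ip_le_s[OF d] ip.s_nonneg[OF d] by linarith
  then have "AE x in m. d x = 0"
    using integral_nonneg_eq_0_iff_AE[OF ip_integrable[OF d d]] by (auto simp: ip_def)
  moreover have "0 \<le> p x" for x using c by (simp add: p_def t_def)
  ultimately show ?thesis by (auto simp: d_def elim: eventually_mono)
qed

text \<open>Put \<open>g k = \<beta> G\<^sub>\<beta> (a k)\<close>. For fixed \<open>y\<close>,
  positivity of the resolvent applied to the kernel as a function of \<open>x\<close> gives
  \<open>(\<Sum>k<n. b k y * g k x) \<ge> 0\<close> for almost every \<open>x\<close>. Setting
  \<open>y = x\<close> needs one null set for all \<open>y\<close>; then
  \<open>(\<Sum>k<n. ip (g k) (b k)) \<ge> 0\<close>, while the corresponding sum for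
  \<open>a k\<close> vanishes by the diagonal condition.\<close>

theorem kernel_nonpos:
  fixes a b :: "nat \<Rightarrow> 'a \<Rightarrow> real"
  assumes a: "\<And>k. a k \<in> D" and b: "\<And>k. b k \<in> D"
    and bd: "\<And>k. \<exists>B. \<forall>x. \<bar>a k x\<bar> \<le> B" and cont: "\<And>k. continuous_on UNIV (b k)"
    and nonneg: "\<And>x y. 0 \<le> (\<Sum>k<n. a k x * b k y)"
    and diag: "\<And>y. (\<Sum>k<n. a k y * b k y) = 0"
  shows "(\<Sum>k<n. E (a k) (b k)) \<le> 0"
proof -
  have "(\<Sum>k<n. E (a k) (b k)) \<le> 0 + \<epsilon>" if \<epsilon>: "\<epsilon> > 0" for \<epsilon>
  proof -
    have "\<exists>\<Lambda>. \<forall>\<beta>\<ge>\<Lambda>. \<forall>w\<in>D. (\<forall>v\<in>D. E w v + \<beta> * ip w v = E (a k) v) \<longrightarrow> \<bar>E w (b k)\<bar> \<le> \<epsilon> / real (n + 1)" for k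
      by (rule resolvent_defect_vanishes[OF a b]) (use \<epsilon> in auto)
    then obtain \<Lambda> where \<Lambda>: "\<And>k \<beta> w. \<beta> \<ge> \<Lambda> k \<Longrightarrow> w \<in> D \<Longrightarrow> (\<And>v. v \<in> D \<Longrightarrow> E w v + \<beta> * ip w v = E (a k) v)
        \<Longrightarrow> \<bar>E w (b k)\<bar> \<le> \<epsilon> / real (n + 1)"
      by metis
    define \<beta> where "\<beta> = Max (insert (\<alpha> + 1) (\<Lambda> ` {..<n}))"
    have l: "\<alpha> + 1 \<le> \<beta>" "\<And>k. k < n \<Longrightarrow> \<Lambda> k \<le> \<beta>" unfolding \<beta>_def by (auto intro!: Max_ge)
    have "\<exists>w\<in>D. \<forall>v\<in>D. E w v + \<beta> * ip w v = E (a k) v" for k by (rule solve[OF a l(1)])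
    then obtain w where w: "\<And>k. w k \<in> D" "\<And>k v. v \<in> D \<Longrightarrow> E (w k) v + \<beta> * ip (w k) v = E (a k) v" by metis
    define g where "g k x = a k x - w k x" for k x
    have g: "g k \<in> D" for k unfolding g_def[abs_def] by (intro s.D_diff a w)
    have geq: "E (g k) v + \<beta> * ip (g k) v = \<beta> * ip (a k) v" if v: "v \<in> D" for k v
    proof -
      have 1: "E (g k) v = E (a k) v - E (w k) v" "ip (g k) v = ip (a k) v - ip (w k) v"
        using E_diff[OF a[of k] w(1)[of k] v] ip.s_diff[OF a[of k] w(1)[of k] v] by (simp_all add: g_def[abs_def])
      show ?thesis unfolding 1 using w(2)[OF v, of k] by (simp add: algebra_simps)
    qed
    have sumD: "(\<lambda>x. \<Sum>k<j. c k * f k x) \<in> D" if "\<And>k. f k \<in> D" for c f and j :: nat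
      by (induction j) (auto intro!: D_zero D_add D_cmult that)
    have sumE: "E (\<lambda>x. \<Sum>k<j. c k * f k x) v = (\<Sum>k<j. c k * E (f k) v)"
      and sumip: "ip (\<lambda>x. \<Sum>k<j. c k * f k x) v = (\<Sum>k<j. c k * ip (f k) v)"
      if f: "\<And>k. f k \<in> D" and v: "v \<in> D" for c f v and j :: nat
    proof (induction j)
      case 0
      { case 1 show ?case using E_cmult[OF D_zero v, of 0] by simp }
      { case 2 show ?case using ip.s_cmult[OF D_zero v, of 0] by simp }
    next
      case (Suc j)
      { case 1 show ?case using Suc(1) by (simp add: E_add[OF sumD[where f=f and c=c and j=j, OF f] D_cmult[OF f] v] E_cmult[OF f v]) }
      { case 2 show ?case using Suc(2) by (simp add: ip.s_add[OF sumD[where f=f and c=c and j=j, OF f] D_cmult[OF f] v] ip.s_cmult[OF f v]) }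
    qed
    have ae: "AE x in m. 0 \<le> (\<Sum>k<n. b k y * g k x)" for y
    proof -
      obtain B where B: "\<And>k x. \<bar>a k x\<bar> \<le> B k" using bd by metis
      define c where "c = (\<Sum>k<n. \<bar>b k y\<bar> * B k) + 1"
      have "0 \<le> B k" for k using B[of k undefined] by linarith
      then have c: "c > 0" unfolding c_def by (intro add_nonneg_pos sum_nonneg mult_nonneg_nonneg) auto
      have le: "(\<Sum>k<n. b k y * a k x) \<le> c" for x
      proof -
        have "(\<Sum>k<n. b k y * a k x) \<le> (\<Sum>k<n. \<bar>b k y\<bar> * B k)"
        proof (rule sum_mono)
          fix k
          have "b k y * a k x \<le> \<bar>b k y\<bar> * \<bar>a k x\<bar>" by (metis abs_ge_self abs_mult)
          also have "\<dots> \<le> \<bar>b k y\<bar> * B k" using B[of k x] by (intro mult_left_mono) auto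
          finally show "b k y * a k x \<le> \<bar>b k y\<bar> * B k" .
        qed
        then show ?thesis by (simp add: c_def)
      qed
      show ?thesis
      proof (rule resolvent_positive[where u="\<lambda>x. \<Sum>k<n. b k y * a k x", OF sumD[OF a] _ le c l(1) sumD[OF g]])
        show "0 \<le> (\<Sum>k<n. b k y * a k x)" for x using nonneg[of x y] by (simp add: mult.commute)
        fix v assume v: "v \<in> D"
        have "E (\<lambda>x. \<Sum>k<n. b k y * g k x) v + \<beta> * ip (\<lambda>x. \<Sum>k<n. b k y * g k x) v
          = (\<Sum>k<n. b k y * (E (g k) v + \<beta> * ip (g k) v))"
          by (simp add: sumE[OF g v] sumip[OF g v] sum_distrib_left sum.distrib algebra_simps)
        also have "\<dots> = \<beta> * ip (\<lambda>x. \<Sum>k<n. b k y * a k x) v"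
          unfolding geq[OF v] sumip[OF a v] sum_distrib_left by (simp only: mult_ac)
        finally show "E (\<lambda>x. \<Sum>k<n. b k y * g k x) v + \<beta> * ip (\<lambda>x. \<Sum>k<n. b k y * g k x) v
          = \<beta> * ip (\<lambda>x. \<Sum>k<n. b k y * a k x) v" .
      qed
    qed
    \<comment> \<open>The null sets are controlled along a countable dense set of \<open>y\<close>, which suffices by continuity of the \<open>b k\<close>.\<close>
    obtain Y :: "'a set" where Y: "countable Y" "\<And>X. open X \<Longrightarrow> X \<noteq> {} \<Longrightarrow> \<exists>d\<in>Y. d \<in> X"
      using countable_dense_setE by metis
    have "AE x in m. \<forall>y\<in>Y. 0 \<le> (\<Sum>k<n. b k y * g k x)"
      using ae Y(1) by (intro AE_ball_countable[THEN iffD2]) auto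
    then have ae2: "AE x in m. 0 \<le> (\<Sum>k<n. g k x * b k x)"
    proof (rule eventually_mono)
      fix x assume x: "\<forall>y\<in>Y. 0 \<le> (\<Sum>k<n. b k y * g k x)"
      show "0 \<le> (\<Sum>k<n. g k x * b k x)"
      proof (rule ccontr)
        assume "\<not> 0 \<le> (\<Sum>k<n. g k x * b k x)"
        then have "x \<in> {y. (\<Sum>k<n. b k y * g k x) < 0}" by (simp add: mult.commute)
        moreover have "open {y. (\<Sum>k<n. b k y * g k x) < 0}"
          by (intro open_Collect_less continuous_intros cont)
        ultimately obtain y where "y \<in> Y" "(\<Sum>k<n. b k y * g k x) < 0" using Y(2) by blast
        then show False using x by force
      qed
    qed
    have int: "0 \<le> (\<Sum>k<n. ip (g k) (b k))"
    proof -
      have "(\<Sum>k<n. ip (g k) (b k)) = (\<integral>x. (\<Sum>k<n. g k x * b k x) \<partial>m)"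
        unfolding ip_def by (rule Bochner_Integration.integral_sum[symmetric]) (rule ip_integrable[OF g b])
      also have "\<dots> \<ge> 0" using ae2 by (rule integral_nonneg_AE)
      finally show ?thesis .
    qed
    have int0: "(\<Sum>k<n. ip (a k) (b k)) = 0"
    proof -
      have "(\<Sum>k<n. ip (a k) (b k)) = (\<integral>x. (\<Sum>k<n. a k x * b k x) \<partial>m)"
        unfolding ip_def by (rule Bochner_Integration.integral_sum[symmetric]) (rule ip_integrable[OF a b])
      then show ?thesis by (simp add: diag)
    qed
    \<comment> \<open>The resolvent equation tested with \<open>b k\<close> gives
      \<open>E (g k) (b k) = \<beta> * ip (a k - g k) (b k)\<close>, the approximating form; the
      rest is the defect \<open>w k\<close>, whose contribution was made at most
      \<open>\<epsilon> / (n + 1)\<close>.\<close>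
    have "E (a k) (b k) = \<beta> * ip (a k) (b k) - \<beta> * ip (g k) (b k) + E (w k) (b k)" for k
      using geq[OF b[of k], of k] E_diff[OF a[of k] w(1)[of k] b[of k]] by (simp add: g_def[abs_def])
    then have "(\<Sum>k<n. E (a k) (b k))
      = \<beta> * (\<Sum>k<n. ip (a k) (b k)) - \<beta> * (\<Sum>k<n. ip (g k) (b k)) + (\<Sum>k<n. E (w k) (b k))"
      by (simp add: sum.distrib sum_subtractf sum_distrib_left)
    also have "\<dots> \<le> (\<Sum>k<n. E (w k) (b k))" using int int0 l(1) alpha by simp
    also have "\<dots> \<le> (\<Sum>k<n. \<epsilon> / real (n + 1))"
    proof (rule sum_mono)
      fix k assume "k \<in> {..<n}"
      then show "E (w k) (b k) \<le> \<epsilon> / real (n + 1)" using \<Lambda>[of k \<beta> "w k", OF l(2) w(1) w(2)] by auto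
    qed
    also have "\<dots> \<le> \<epsilon>" using \<epsilon> by (simp add: field_simps)
    finally show ?thesis by simp
  qed
  then show ?thesis by (rule field_le_epsilon)
qed

end

section \<open>Kernels and the jumping measure\<close>

text \<open>All that is retained of the semi-Dirichlet form: bilinearity on test functions, the
  positivity principle, and the defining property of \<open>J\<close> and \<open>K\<close>. The
  space \<open>L\<^sup>2\<close> and the domain of the form disappear from the argument.\<close>

locale jump_form =
  fixes U :: "'a::euclidean_space set" and E :: "('a \<Rightarrow> real) \<Rightarrow> ('a \<Rightarrow> real) \<Rightarrow> real"
    and J :: "('a \<times> 'a) measure" and K :: "'a measure"
  assumes open_U: "open U"
    and E_add: "u \<in> C0inf U \<Longrightarrow> v \<in> C0inf U \<Longrightarrow> w \<in> C0inf U \<Longrightarrow> E (\<lambda>x. u x + v x) w = E u w + E v w"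
    and E_add_right: "u \<in> C0inf U \<Longrightarrow> v \<in> C0inf U \<Longrightarrow> w \<in> C0inf U \<Longrightarrow> E w (\<lambda>x. u x + v x) = E w u + E w v"
    and E_cmult: "u \<in> C0inf U \<Longrightarrow> w \<in> C0inf U \<Longrightarrow> E (\<lambda>x. c * u x) w = c * E u w"
    and E_cmult_right: "u \<in> C0inf U \<Longrightarrow> w \<in> C0inf U \<Longrightarrow> E w (\<lambda>x. c * u x) = c * E w u"
    and E_kernel_nonpos: "(\<And>k. a k \<in> C0inf U) \<Longrightarrow> (\<And>k. b k \<in> C0inf U) \<Longrightarrow>
      (\<And>x y. 0 \<le> (\<Sum>k<n::nat. a k x * b k y)) \<Longrightarrow> (\<And>y. (\<Sum>k<n. a k y * b k y) = 0) \<Longrightarrow>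
      (\<Sum>k<n. E (a k) (b k)) \<le> 0"
    and jump_kill: "jump_kill U E J K"
begin

lemma sets_J [measurable_cong]: "sets J = sets borel"
  using jump_kill by (auto simp: jump_kill_def radon_on_def)

lemma AE_offdiag: "AE p in J. fst p \<noteq> snd p"
proof -
  have "closed {p::'a \<times> 'a. fst p = snd p}"
    by (intro closed_Collect_eq continuous_intros)
  then have "open (offdiag U)" unfolding offdiag_def by (intro open_Diff open_Times open_U)
  then have "- offdiag U \<in> sets J" unfolding sets_J by auto
  moreover have "emeasure J (- offdiag U) = 0" using jump_kill by (auto simp: jump_kill_def radon_on_def)
  ultimately have "- offdiag U \<in> null_sets J" by auto
  from AE_not_in[OF this] show ?thesis by (rule eventually_mono) (auto simp: offdiag_def)
qed

section \<open>Finite sums of tensors and the extension of \<open>E\<close> to them\<close>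

definition rep :: "nat \<Rightarrow> (nat \<Rightarrow> 'a \<Rightarrow> real) \<Rightarrow> (nat \<Rightarrow> 'a \<Rightarrow> real) \<Rightarrow> ('a \<Rightarrow> 'a \<Rightarrow> real) \<Rightarrow> bool" where
  "rep n a b \<Phi> \<longleftrightarrow> (\<forall>k. a k \<in> C0inf U \<and> b k \<in> C0inf U) \<and> \<Phi> = (\<lambda>x y. \<Sum>k<n. a k x * b k y)"

definition T :: "('a \<Rightarrow> 'a \<Rightarrow> real) set" where
  "T = {\<Phi>. \<exists>n a b. rep n a b \<Phi>}"

text \<open>The choice is immaterial: two representations of a kernel differ by one of the zero kernel,
  to which the positivity principle applies with both signs.\<close>

definition EE :: "('a \<Rightarrow> 'a \<Rightarrow> real) \<Rightarrow> real" where
  "EE \<Phi> = (SOME c. \<exists>n a b. rep n a b \<Phi> \<and> c = (\<Sum>k<n. E (a k) (b k)))"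

lemma rep_add:
  assumes "rep n a b \<Phi>" "rep m c d \<Psi>"
  shows "\<exists>f g. rep (n + m) f g (\<lambda>x y. \<Phi> x y + \<Psi> x y) \<and>
    (\<Sum>k<n+m. E (f k) (g k)) = (\<Sum>k<n. E (a k) (b k)) + (\<Sum>k<m. E (c k) (d k))"
proof -
  define f where "f k = (if k < n then a k else c (k - n))" for k
  define g where "g k = (if k < n then b k else d (k - n))" for k
  have "rep (n + m) f g (\<lambda>x y. \<Phi> x y + \<Psi> x y)"
    using assms by (auto simp: rep_def f_def g_def sum_lessThan_add)
  moreover have "(\<Sum>k<n+m. E (f k) (g k)) = (\<Sum>k<n. E (a k) (b k)) + (\<Sum>k<m. E (c k) (d k))"
    by (simp add: sum_lessThan_add f_def g_def)
  ultimately show ?thesis by blast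
qed

lemma rep_cmult:
  assumes "rep n a b \<Phi>"
  shows "rep n (\<lambda>k x. c * a k x) b (\<lambda>x y. c * \<Phi> x y)"
    "(\<Sum>k<n. E (\<lambda>x. c * a k x) (b k)) = c * (\<Sum>k<n. E (a k) (b k))"
  using assms by (auto simp: rep_def C0inf_cmult E_cmult sum_distrib_left mult.assoc)

lemma rep_nonpos: "rep n a b \<Phi> \<Longrightarrow> (\<And>x y. 0 \<le> \<Phi> x y) \<Longrightarrow> (\<And>y. \<Phi> y y = 0) \<Longrightarrow> (\<Sum>k<n. E (a k) (b k)) \<le> 0"
  unfolding rep_def by (rule E_kernel_nonpos) auto

lemma rep_unique_le:
  assumes "rep n a b \<Phi>" "rep m c d \<Phi>"
  shows "(\<Sum>k<n. E (a k) (b k)) \<le> (\<Sum>k<m. E (c k) (d k))"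
proof -
  obtain f g where f: "rep (n + m) f g (\<lambda>x y. \<Phi> x y + (-1) * \<Phi> x y)"
    and g: "(\<Sum>k<n+m. E (f k) (g k)) = (\<Sum>k<n. E (a k) (b k)) + (\<Sum>k<m. E (\<lambda>x. (-1) * c k x) (d k))"
    using rep_add[OF assms(1) rep_cmult(1)[OF assms(2), of "-1"]] by (elim exE conjE)
  have "(\<Sum>k<n+m. E (f k) (g k)) \<le> 0" by (rule rep_nonpos[OF f]) auto
  then show ?thesis unfolding g rep_cmult(2)[OF assms(2)] by simp
qed

lemma EE_rep: "rep n a b \<Phi> \<Longrightarrow> EE \<Phi> = (\<Sum>k<n. E (a k) (b k))"
proof -
  assume r: "rep n a b \<Phi>"
  show ?thesis unfolding EE_def
  proof (rule some_equality)
    show "\<exists>n' a' b'. rep n' a' b' \<Phi> \<and> (\<Sum>k<n. E (a k) (b k)) = (\<Sum>k<n'. E (a' k) (b' k))" using r by blast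
    fix c assume "\<exists>n a b. rep n a b \<Phi> \<and> c = (\<Sum>k<n. E (a k) (b k))"
    then show "c = (\<Sum>k<n. E (a k) (b k))" using rep_unique_le r by (meson antisym)
  qed
qed

lemma T_add: "\<Phi> \<in> T \<Longrightarrow> \<Psi> \<in> T \<Longrightarrow> (\<lambda>x y. \<Phi> x y + \<Psi> x y) \<in> T"
  and EE_add: "\<Phi> \<in> T \<Longrightarrow> \<Psi> \<in> T \<Longrightarrow> EE (\<lambda>x y. \<Phi> x y + \<Psi> x y) = EE \<Phi> + EE \<Psi>"
proof -
  assume "\<Phi> \<in> T" "\<Psi> \<in> T"
  then obtain n a b m c d where r: "rep n a b \<Phi>" "rep m c d \<Psi>" unfolding T_def by blast
  from rep_add[OF this] obtain f g where fg: "rep (n + m) f g (\<lambda>x y. \<Phi> x y + \<Psi> x y)"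
    "(\<Sum>k<n+m. E (f k) (g k)) = (\<Sum>k<n. E (a k) (b k)) + (\<Sum>k<m. E (c k) (d k))" by blast
  show "(\<lambda>x y. \<Phi> x y + \<Psi> x y) \<in> T" using fg(1) unfolding T_def by blast
  show "EE (\<lambda>x y. \<Phi> x y + \<Psi> x y) = EE \<Phi> + EE \<Psi>"
    using fg(2) EE_rep[OF fg(1)] EE_rep[OF r(1)] EE_rep[OF r(2)] by simp
qed

lemma T_cmult: "\<Phi> \<in> T \<Longrightarrow> (\<lambda>x y. c * \<Phi> x y) \<in> T"
  and EE_cmult: "\<Phi> \<in> T \<Longrightarrow> EE (\<lambda>x y. c * \<Phi> x y) = c * EE \<Phi>"
proof -
  assume "\<Phi> \<in> T"
  then obtain n a b where r: "rep n a b \<Phi>" unfolding T_def by blast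
  note r' = rep_cmult[OF this, of c]
  show "(\<lambda>x y. c * \<Phi> x y) \<in> T" using r'(1) unfolding T_def by blast
  show "EE (\<lambda>x y. c * \<Phi> x y) = c * EE \<Phi>" using r'(2) EE_rep[OF r'(1)] EE_rep[OF r] by simp
qed

lemma T_diff: "\<Phi> \<in> T \<Longrightarrow> \<Psi> \<in> T \<Longrightarrow> (\<lambda>x y. \<Phi> x y - \<Psi> x y) \<in> T"
  and EE_diff: "\<Phi> \<in> T \<Longrightarrow> \<Psi> \<in> T \<Longrightarrow> EE (\<lambda>x y. \<Phi> x y - \<Psi> x y) = EE \<Phi> - EE \<Psi>"
  using T_add[of \<Phi> "\<lambda>x y. (-1) * \<Psi> x y"] EE_add[of \<Phi> "\<lambda>x y. (-1) * \<Psi> x y"]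
    T_cmult[of \<Psi> "-1"] EE_cmult[of \<Psi> "-1"] by simp_all

lemma T_tensor: "a \<in> C0inf U \<Longrightarrow> b \<in> C0inf U \<Longrightarrow> (\<lambda>x y. a x * b y) \<in> T"
  and EE_tensor: "a \<in> C0inf U \<Longrightarrow> b \<in> C0inf U \<Longrightarrow> EE (\<lambda>x y. a x * b y) = E a b"
proof -
  assume "a \<in> C0inf U" "b \<in> C0inf U"
  then have r: "rep 1 (\<lambda>_. a) (\<lambda>_. b) (\<lambda>x y. a x * b y)" by (simp add: rep_def)
  show "(\<lambda>x y. a x * b y) \<in> T" using r unfolding T_def by blast
  show "EE (\<lambda>x y. a x * b y) = E a b" using EE_rep[OF r] by simp
qed

lemma T_zero: "(\<lambda>x y. 0) \<in> T" and EE_zero: "EE (\<lambda>x y. 0) = 0"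
proof -
  have r: "rep 0 (\<lambda>_ _. 0) (\<lambda>_ _. 0) (\<lambda>x y. 0)" by (simp add: rep_def)
  show "(\<lambda>x y. 0) \<in> T" using r unfolding T_def by blast
  show "EE (\<lambda>x y. 0) = 0" using EE_rep[OF r] by simp
qed

lemma T_sum: "(\<And>i. i \<in> I \<Longrightarrow> \<Phi> i \<in> T) \<Longrightarrow> (\<lambda>x y. \<Sum>i\<in>I. \<Phi> i x y) \<in> T"
  by (induction I rule: infinite_finite_induct) (auto simp: T_zero intro: T_add)

lemma EE_sum: "(\<And>i. i \<in> I \<Longrightarrow> \<Phi> i \<in> T) \<Longrightarrow> EE (\<lambda>x y. \<Sum>i\<in>I. \<Phi> i x y) = (\<Sum>i\<in>I. EE (\<Phi> i))"
  by (induction I rule: infinite_finite_induct) (auto simp: EE_zero EE_add T_sum)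

lemma EE_nonpos: "\<Phi> \<in> T \<Longrightarrow> (\<And>x y. 0 \<le> \<Phi> x y) \<Longrightarrow> (\<And>y. \<Phi> y y = 0) \<Longrightarrow> EE \<Phi> \<le> 0"
  using rep_nonpos EE_rep unfolding T_def by force

lemma T_induct [consumes 1, case_names zero add]:
  assumes "\<Phi> \<in> T" and z: "P (\<lambda>x y. 0)"
    and s: "\<And>\<Phi> a b. \<Phi> \<in> T \<Longrightarrow> P \<Phi> \<Longrightarrow> a \<in> C0inf U \<Longrightarrow> b \<in> C0inf U \<Longrightarrow> P (\<lambda>x y. \<Phi> x y + a x * b y)"
  shows "P \<Phi>"
proof -
  obtain n a b where r: "rep n a b \<Phi>" using assms(1) unfolding T_def by blast
  then have C: "a k \<in> C0inf U" "b k \<in> C0inf U" for k by (auto simp: rep_def)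
  have "P (\<lambda>x y. \<Sum>k<n. a k x * b k y)" for n
  proof (induction n)
    case (Suc n)
    have "(\<lambda>x y. \<Sum>k<n. a k x * b k y) \<in> T" by (intro T_sum T_tensor C)
    from s[OF this Suc C(1)[of n] C(2)[of n]] show ?case by simp
  qed (simp add: z)
  then show ?thesis using r by (simp add: rep_def)
qed

lemma T_mult:
  assumes "\<Phi> \<in> T" and p: "smooth_fun p" and q: "smooth_fun q"
  shows "(\<lambda>x y. p x * q y * \<Phi> x y) \<in> T"
  using assms(1)
proof (induction rule: T_induct)
  case zero then show ?case by (simp add: T_zero)
next
  case (add \<Phi> a b)
  have "(\<lambda>x y. (p x * a x) * (q y * b y)) \<in> T" by (intro T_tensor C0inf_mult' add p q)
  from T_add[OF add.IH this] show ?case by (simp add: algebra_simps)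
qed

lemma T_support:
  assumes "\<Phi> \<in> T"
  shows "\<exists>F. compact F \<and> F \<subseteq> U \<and> (\<forall>x y. \<Phi> x y \<noteq> 0 \<longrightarrow> x \<in> F \<and> y \<in> F)"
  using assms
proof (induction rule: T_induct)
  case zero then show ?case by (auto intro!: exI[of _ "{}"])
next
  case (add \<Phi> a b)
  then obtain F where F: "compact F" "F \<subseteq> U" "\<And>x y. \<Phi> x y \<noteq> 0 \<Longrightarrow> x \<in> F \<and> y \<in> F" by blast
  have "\<Phi> x y + a x * b y \<noteq> 0 \<Longrightarrow> x \<in> F \<union> fsupp a \<union> fsupp b \<and> y \<in> F \<union> fsupp a \<union> fsupp b" for x y
  proof -
    assume "\<Phi> x y + a x * b y \<noteq> 0"
    then have "\<Phi> x y \<noteq> 0 \<or> (a x \<noteq> 0 \<and> b y \<noteq> 0)" by auto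
    then show ?thesis using F(3)[of x y] notin_fsupp[of x a] notin_fsupp[of y b] by blast
  qed
  then show ?case using F(1,2) C0infD(2,3)[OF add.hyps(2)] C0infD(2,3)[OF add.hyps(3)]
    by (intro exI[of _ "F \<union> fsupp a \<union> fsupp b"]) auto
qed

lemma T_continuous: "\<Phi> \<in> T \<Longrightarrow> continuous_on UNIV (\<lambda>p. \<Phi> (fst p) (snd p))"
proof (induction rule: T_induct)
  case (add \<Phi> a b)
  have "continuous_on UNIV (\<lambda>p::'a\<times>'a. a (fst p))" "continuous_on UNIV (\<lambda>p::'a\<times>'a. b (snd p))"
    using continuous_on_compose2[OF C0inf_continuous[OF add.hyps(2), of UNIV] continuous_on_fst[OF continuous_on_id]]
      continuous_on_compose2[OF C0inf_continuous[OF add.hyps(3), of UNIV] continuous_on_snd[OF continuous_on_id]] by auto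
  then show ?case using add.IH by (intro continuous_on_add continuous_on_mult)
qed simp

lemma T_measurable: "\<Phi> \<in> T \<Longrightarrow> (\<lambda>p. \<Phi> (fst p) (snd p)) \<in> borel_measurable J"
  using borel_measurable_continuous_onI[OF T_continuous] by (simp add: measurable_cong_sets[OF sets_J refl])

section \<open>Kernels away from the diagonal\<close>

definition JJ :: "('a \<Rightarrow> 'a \<Rightarrow> real) \<Rightarrow> real" where
  "JJ \<Phi> = (\<integral>p. \<Phi> (fst p) (snd p) \<partial>J)"

abbreviation Jint :: "('a \<Rightarrow> 'a \<Rightarrow> real) \<Rightarrow> bool" where
  "Jint \<Phi> \<equiv> integrable J (\<lambda>p. \<Phi> (fst p) (snd p))"

lemma JJ_add: "Jint \<Phi> \<Longrightarrow> Jint \<Psi> \<Longrightarrow> JJ (\<lambda>x y. \<Phi> x y + \<Psi> x y) = JJ \<Phi> + JJ \<Psi>"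
  by (simp add: JJ_def)

lemma JJ_diff: "Jint \<Phi> \<Longrightarrow> Jint \<Psi> \<Longrightarrow> JJ (\<lambda>x y. \<Phi> x y - \<Psi> x y) = JJ \<Phi> - JJ \<Psi>"
  by (simp add: JJ_def)

lemma JJ_cmult: "JJ (\<lambda>x y. c * \<Phi> x y) = c * JJ \<Phi>"
  by (simp add: JJ_def)

lemma JJ_sum: "(\<And>i. i \<in> I \<Longrightarrow> Jint (\<Phi> i)) \<Longrightarrow> JJ (\<lambda>x y. \<Sum>i\<in>I. \<Phi> i x y) = (\<Sum>i\<in>I. JJ (\<Phi> i))"
  by (simp add: JJ_def)

text \<open>Disjoint supports make \<open>u\<close> vanish on a neighbourhood of the support of
  \<open>v\<close>, so the pair is admissible with constant 0. As \<open>u y * v y = 0\<close>, the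
  killing term drops out and the integrand reduces to \<open>- 2 * u x * v y\<close>; this is the
  origin of the factor in \<open>B\<close>.\<close>

lemma jump_separated_tensor:
  assumes u: "u \<in> C0inf U" and v: "v \<in> C0inf U" and d: "fsupp u \<inter> fsupp v = {}"
  shows "Jint (\<lambda>x y. u x * v y)" "E u v = - 2 * JJ (\<lambda>x y. u x * v y)"
proof -
  have ex: "\<exists>W c. open W \<and> fsupp v \<subseteq> W \<and> (\<forall>x\<in>W. u x = c)"
    by (rule exI[of _ "- fsupp u"], rule exI[of _ 0]) (use d notin_fsupp in auto)
  have uv: "u y * v y = 0" for y using d notin_fsupp[of y u] notin_fsupp[of y v] by auto
  have eq: "2 * (u y - u x) * v y = - 2 * (u x * v y)" for x y
    using uv[of y] by (simp add: left_diff_distrib right_diff_distrib mult.assoc)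
  from jump_kill u v ex
  have 1: "integrable J (\<lambda>p. 2 * (u (snd p) - u (fst p)) * v (snd p))"
    "E u v = (\<integral>p. 2 * (u (snd p) - u (fst p)) * v (snd p) \<partial>J) + (\<integral>x. u x * v x \<partial>K)"
    unfolding jump_kill_def by blast+
  have "integrable J (\<lambda>p. (-1/2) * (- 2 * (u (fst p) * v (snd p))))"
    using 1(1) unfolding eq by (rule integrable_mult_right)
  then show "Jint (\<lambda>x y. u x * v y)" by simp
  show "E u v = - 2 * JJ (\<lambda>x y. u x * v y)"
    using 1(2) unfolding eq uv by (simp add: JJ_def)
qed

lemma jump_separated:
  assumes "\<Phi> \<in> T" and p: "smooth_fun p" and q: "smooth_fun q" and d: "fsupp p \<inter> fsupp q = {}"
  shows "Jint (\<lambda>x y. p x * q y * \<Phi> x y) \<and>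
    EE (\<lambda>x y. p x * q y * \<Phi> x y) = - 2 * JJ (\<lambda>x y. p x * q y * \<Phi> x y)"
  using assms(1)
proof (induction rule: T_induct)
  case zero then show ?case by (simp add: EE_zero JJ_def)
next
  case (add \<Phi> a b)
  let ?u = "\<lambda>x. p x * a x" and ?v = "\<lambda>y. q y * b y"
  have u: "?u \<in> C0inf U" and v: "?v \<in> C0inf U" using add p q by (auto intro: C0inf_mult')
  have "fsupp ?u \<subseteq> fsupp p" "fsupp ?v \<subseteq> fsupp q"
    by (rule fsupp_subset; simp add: notin_fsupp)+
  then have "fsupp ?u \<inter> fsupp ?v = {}" using d by blast
  note sep = jump_separated_tensor[OF u v this]
  have eq: "p x * q y * (\<Phi> x y + a x * b y) = p x * q y * \<Phi> x y + ?u x * ?v y" for x y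
    by (simp add: algebra_simps)
  have "Jint (\<lambda>x y. p x * q y * \<Phi> x y + ?u x * ?v y)"
    using sep(1) add.IH by simp
  moreover have "EE (\<lambda>x y. p x * q y * \<Phi> x y + ?u x * ?v y) = - 2 * JJ (\<lambda>x y. p x * q y * \<Phi> x y + ?u x * ?v y)"
    using EE_add[OF T_mult[OF add.hyps(1) p q] T_tensor[OF u v]] EE_tensor[OF u v] sep
      JJ_add[OF conjunct1[OF add.IH] sep(1)] add.IH by simp
  ultimately show ?case unfolding eq by (rule conjI)
qed

text \<open>A partition of unity into pieces supported in balls of radius
  \<open>\<epsilon> / 4\<close> cuts the kernel into finitely many parts with weights
  \<open>\<psi>\<^sub>k(x) \<psi>\<^sub>l(y)\<close>. If the two supports are disjoint, only
  \<open>J\<close> contributes; if they share a point, \<open>x\<close> and \<open>y\<close> are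
  each closer than \<open>\<epsilon> / 2\<close> to it. The weight \<theta> of the second kind is a
  finite sum of tensors, so both parts stay in \<open>T\<close>.\<close>

lemma near_diagonal_split:
  assumes \<Phi>: "\<Phi> \<in> T" and \<epsilon>: "\<epsilon> > 0"
  shows "\<exists>\<theta>. (\<forall>x y. 0 \<le> \<theta> x y \<and> \<theta> x y \<le> 1) \<and> (\<forall>x y. \<epsilon> \<le> dist x y \<longrightarrow> \<theta> x y = 0) \<and>
    (\<lambda>x y. \<theta> x y * \<Phi> x y) \<in> T \<and> (\<lambda>x y. (1 - \<theta> x y) * \<Phi> x y) \<in> T \<and>
    Jint (\<lambda>x y. (1 - \<theta> x y) * \<Phi> x y) \<and>
    EE (\<lambda>x y. (1 - \<theta> x y) * \<Phi> x y) = - 2 * JJ (\<lambda>x y. (1 - \<theta> x y) * \<Phi> x y)"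
proof -
  obtain F where F: "compact F" "F \<subseteq> U" "\<And>x y. \<Phi> x y \<noteq> 0 \<Longrightarrow> x \<in> F \<and> y \<in> F"
    using T_support[OF \<Phi>] by blast
  have cov: "F \<subseteq> \<Union> (range (\<lambda>x. ball x (\<epsilon> / 4)))"
  proof
    fix x :: 'a show "x \<in> \<Union> (range (\<lambda>x. ball x (\<epsilon> / 4)))" using \<epsilon> by (intro UnionI[of "ball x (\<epsilon> / 4)"]) auto
  qed
  obtain n \<psi> W where \<psi>: "\<And>k. k < n \<Longrightarrow> \<exists>V\<in>range (\<lambda>x. ball x (\<epsilon> / 4)). \<psi> k \<in> C0inf V" "\<And>k x. 0 \<le> \<psi> k x"
    "\<And>x. (\<Sum>k<n::nat. \<psi> k x) \<le> 1" "open W" "F \<subseteq> W" "\<And>x. x \<in> W \<Longrightarrow> (\<Sum>k<n. \<psi> k x) = 1"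
    by (rule smooth_partition[OF F(1) cov]) auto
  have "\<exists>z. \<psi> k \<in> C0inf (ball z (\<epsilon> / 4))" if "k < n" for k using \<psi>(1)[OF that] by auto
  then obtain z where z: "\<And>k. k < n \<Longrightarrow> \<psi> k \<in> C0inf (ball (z k) (\<epsilon> / 4))" by metis
  define P where "P = {..<n} \<times> {..<n}"
  define N where "N = {q\<in>P. fsupp (\<psi> (fst q)) \<inter> fsupp (\<psi> (snd q)) \<noteq> {}}"
  have fin: "finite P" by (simp add: P_def)
  define \<theta> where "\<theta> x y = (\<Sum>q\<in>N. \<psi> (fst q) x * \<psi> (snd q) y)" for x y
  have tot: "(\<Sum>q\<in>P. \<psi> (fst q) x * \<psi> (snd q) y) = (\<Sum>k<n. \<psi> k x) * (\<Sum>k<n. \<psi> k y)" for x y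
    unfolding P_def sum_product sum.cartesian_product by (simp add: case_prod_beta)
  have \<theta>0: "0 \<le> \<theta> x y" for x y unfolding \<theta>_def using \<psi>(2) by (intro sum_nonneg mult_nonneg_nonneg)
  have \<theta>1: "\<theta> x y \<le> 1" for x y
  proof -
    have "\<theta> x y \<le> (\<Sum>q\<in>P. \<psi> (fst q) x * \<psi> (snd q) y)" unfolding \<theta>_def
      using \<psi>(2) fin by (intro sum_mono2 mult_nonneg_nonneg) (auto simp: N_def)
    also have "\<dots> \<le> 1 * 1" unfolding tot
      using \<psi>(2,3) by (intro mult_mono sum_nonneg) auto
    finally show ?thesis by simp
  qed
  have \<theta>far: "\<theta> x y = 0" if far: "\<epsilon> \<le> dist x y" for x y
    unfolding \<theta>_def
  proof (rule sum.neutral, rule ballI)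
    fix q assume q: "q \<in> N"
    then obtain w where w: "w \<in> fsupp (\<psi> (fst q))" "w \<in> fsupp (\<psi> (snd q))" and k: "fst q < n" "snd q < n"
      by (auto simp: N_def P_def)
    have s: "dist (z k) t < \<epsilon> / 4" if "t \<in> fsupp (\<psi> k)" "k < n" for t k
      using C0infD(3)[OF z[OF that(2)]] that by auto
    show "\<psi> (fst q) x * \<psi> (snd q) y = 0"
    proof (rule ccontr)
      assume "\<psi> (fst q) x * \<psi> (snd q) y \<noteq> 0"
      then have "x \<in> fsupp (\<psi> (fst q))" "y \<in> fsupp (\<psi> (snd q))" using notin_fsupp by force+
      from s[OF this(1) k(1)] s[OF this(2) k(2)] s[OF w(1) k(1)] s[OF w(2) k(2)]
      show False using far dist_triangle[of x y w] dist_triangle[of x w "z (fst q)"] dist_triangle[of w y "z (snd q)"]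
        by (simp add: dist_commute)
    qed
  qed
  have sm: "smooth_fun (\<psi> k)" if "k < n" for k using C0infD(1)[OF z[OF that]] .
  have term_T: "(\<lambda>x y. \<psi> (fst q) x * \<psi> (snd q) y * \<Phi> x y) \<in> T" if "q \<in> P" for q
    using that by (intro T_mult \<Phi> sm) (auto simp: P_def)
  have "(\<lambda>x y. \<Sum>q\<in>N. \<psi> (fst q) x * \<psi> (snd q) y * \<Phi> x y) \<in> T"
    by (intro T_sum term_T) (auto simp: N_def)
  then have T1: "(\<lambda>x y. \<theta> x y * \<Phi> x y) \<in> T" by (simp add: \<theta>_def sum_distrib_right)
  \<comment> \<open>The partition sums to 1 only on \<open>W\<close>, but outside the support of the
    kernel both sides vanish.\<close>
  have eq: "(1 - \<theta> x y) * \<Phi> x y = (\<Sum>q\<in>P-N. \<psi> (fst q) x * \<psi> (snd q) y * \<Phi> x y)" for x y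
    proof (cases "\<Phi> x y = 0")
      case False
      then have "x \<in> W" "y \<in> W" using F(3) \<psi>(5) by blast+
      then have "(\<Sum>q\<in>P. \<psi> (fst q) x * \<psi> (snd q) y) = 1" unfolding tot by (simp add: \<psi>(6))
      moreover have "(\<Sum>q\<in>P. \<psi> (fst q) x * \<psi> (snd q) y) = \<theta> x y + (\<Sum>q\<in>P-N. \<psi> (fst q) x * \<psi> (snd q) y)"
        unfolding \<theta>_def using fin by (subst sum.subset_diff[of N P]) (auto simp: N_def)
      ultimately have "1 - \<theta> x y = (\<Sum>q\<in>P-N. \<psi> (fst q) x * \<psi> (snd q) y)" by linarith
      then show ?thesis by (simp add: sum_distrib_right)
    qed simp
  have sep: "Jint (\<lambda>x y. \<psi> (fst q) x * \<psi> (snd q) y * \<Phi> x y) \<and>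
    EE (\<lambda>x y. \<psi> (fst q) x * \<psi> (snd q) y * \<Phi> x y) = - 2 * JJ (\<lambda>x y. \<psi> (fst q) x * \<psi> (snd q) y * \<Phi> x y)"
    if "q \<in> P - N" for q
    using that by (intro jump_separated \<Phi> sm) (auto simp: P_def N_def)
  have T2: "(\<lambda>x y. (1 - \<theta> x y) * \<Phi> x y) \<in> T" unfolding eq by (intro T_sum term_T) auto
  have "Jint (\<lambda>x y. (1 - \<theta> x y) * \<Phi> x y)" unfolding eq using sep by (intro Bochner_Integration.integrable_sum) auto
  moreover have "EE (\<lambda>x y. (1 - \<theta> x y) * \<Phi> x y) = - 2 * JJ (\<lambda>x y. (1 - \<theta> x y) * \<Phi> x y)"
  proof -
    define \<Xi> where "\<Xi> q x y = \<psi> (fst q) x * \<psi> (snd q) y * \<Phi> x y" for q x y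
    have "EE (\<lambda>x y. \<Sum>q\<in>P-N. \<Xi> q x y) = (\<Sum>q\<in>P-N. EE (\<Xi> q))"
      by (rule EE_sum) (use term_T in \<open>auto simp: \<Xi>_def[abs_def]\<close>)
    also have "\<dots> = (\<Sum>q\<in>P-N. - 2 * JJ (\<Xi> q))"
      by (rule sum.cong) (use sep in \<open>auto simp: \<Xi>_def[abs_def]\<close>)
    also have "\<dots> = - 2 * JJ (\<lambda>x y. \<Sum>q\<in>P-N. \<Xi> q x y)"
      by (subst JJ_sum) (use sep in \<open>auto simp: \<Xi>_def sum_distrib_left\<close>)
    finally show ?thesis unfolding eq \<Xi>_def .
  qed
  ultimately show ?thesis using \<theta>0 \<theta>1 \<theta>far T1 T2 by (intro exI[of _ \<theta>] conjI allI impI)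
qed

lemma near_diagonal_splitting:
  assumes \<Phi>: "\<Phi> \<in> T"
  obtains \<theta> :: "nat \<Rightarrow> 'a \<Rightarrow> 'a \<Rightarrow> real" where "\<And>n x y. 0 \<le> \<theta> n x y" "\<And>n x y. \<theta> n x y \<le> 1"
    "\<And>n x y. 1 / real (Suc n) \<le> dist x y \<Longrightarrow> \<theta> n x y = 0"
    "\<And>p. fst p \<noteq> snd p \<Longrightarrow> eventually (\<lambda>n. \<theta> n (fst p) (snd p) = 0) sequentially"
    "\<And>n. (\<lambda>x y. \<theta> n x y * \<Phi> x y) \<in> T" "\<And>n. (\<lambda>x y. (1 - \<theta> n x y) * \<Phi> x y) \<in> T"
    "\<And>n. Jint (\<lambda>x y. (1 - \<theta> n x y) * \<Phi> x y)"
    "\<And>n. EE \<Phi> = EE (\<lambda>x y. \<theta> n x y * \<Phi> x y) - 2 * JJ (\<lambda>x y. (1 - \<theta> n x y) * \<Phi> x y)"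
proof -
  have "\<forall>n. \<exists>\<theta>. (\<forall>x y. 0 \<le> \<theta> x y \<and> \<theta> x y \<le> 1) \<and> (\<forall>x y. 1 / real (Suc n) \<le> dist x y \<longrightarrow> \<theta> x y = 0) \<and>
    (\<lambda>x y. \<theta> x y * \<Phi> x y) \<in> T \<and> (\<lambda>x y. (1 - \<theta> x y) * \<Phi> x y) \<in> T \<and>
    Jint (\<lambda>x y. (1 - \<theta> x y) * \<Phi> x y) \<and>
    EE (\<lambda>x y. (1 - \<theta> x y) * \<Phi> x y) = - 2 * JJ (\<lambda>x y. (1 - \<theta> x y) * \<Phi> x y)"
    by (intro allI near_diagonal_split[OF \<Phi>]) auto
  then obtain \<theta> where H: "\<forall>n. (\<forall>x y. 0 \<le> \<theta> n x y \<and> \<theta> n x y \<le> 1) \<and>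
    (\<forall>x y. 1 / real (Suc n) \<le> dist x y \<longrightarrow> \<theta> n x y = 0) \<and>
    (\<lambda>x y. \<theta> n x y * \<Phi> x y) \<in> T \<and> (\<lambda>x y. (1 - \<theta> n x y) * \<Phi> x y) \<in> T \<and>
    Jint (\<lambda>x y. (1 - \<theta> n x y) * \<Phi> x y) \<and>
    EE (\<lambda>x y. (1 - \<theta> n x y) * \<Phi> x y) = - 2 * JJ (\<lambda>x y. (1 - \<theta> n x y) * \<Phi> x y)"
    by (rule choice[THEN exE])
  have far: "\<theta> n x y = 0" if "1 / real (Suc n) \<le> dist x y" for n x y
    using spec[OF H, of n, THEN conjunct2, THEN conjunct1] that by simp
  note \<theta>T = spec[OF H, THEN conjunct2, THEN conjunct2, THEN conjunct1]
    spec[OF H, THEN conjunct2, THEN conjunct2, THEN conjunct2, THEN conjunct1]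
  note \<theta>J = spec[OF H, THEN conjunct2, THEN conjunct2, THEN conjunct2, THEN conjunct2]
  show ?thesis
  proof (rule that[of \<theta>])
    show "0 \<le> \<theta> n x y" "\<theta> n x y \<le> 1" for n x y using spec[OF H, of n, THEN conjunct1] by simp_all
    show "eventually (\<lambda>n. \<theta> n (fst p) (snd p) = 0) sequentially" if p: "fst p \<noteq> snd p" for p
    proof -
      obtain n0 where n0: "inverse (real (Suc n0)) < dist (fst p) (snd p)"
        using reals_Archimedean[of "dist (fst p) (snd p)"] p by auto
      show ?thesis
      proof (rule eventually_sequentiallyI[of n0])
        fix n assume "n0 \<le> n"
        then have "1 / real (Suc n) \<le> inverse (real (Suc n0))" by (simp add: inverse_eq_divide frac_le)
        then show "\<theta> n (fst p) (snd p) = 0" using n0 by (intro far) simp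
      qed
    qed
    show "EE \<Phi> = EE (\<lambda>x y. \<theta> n x y * \<Phi> x y) - 2 * JJ (\<lambda>x y. (1 - \<theta> n x y) * \<Phi> x y)" for n
    proof -
      have "(\<lambda>x y. \<theta> n x y * \<Phi> x y + (1 - \<theta> n x y) * \<Phi> x y) = \<Phi>" by (simp add: fun_eq_iff algebra_simps)
      then show ?thesis using EE_add[OF \<theta>T(1) \<theta>T(2), of n n] \<theta>J[of n] by simp
    qed
  qed (fact far \<theta>T \<theta>J[THEN conjunct1])+
qed

section \<open>Local integrability of the squared distance\<close>

definition quad :: "('a \<Rightarrow> real) \<Rightarrow> 'a \<Rightarrow> 'a \<Rightarrow> real" where
  "quad \<eta> x y = (dist x y)\<^sup>2 * \<eta> x * \<eta> y"

lemma quad_T: "\<eta> \<in> C0inf U \<Longrightarrow> quad \<eta> \<in> T"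
proof -
  assume \<eta>: "\<eta> \<in> C0inf U"
  note t = T_tensor[OF \<eta> \<eta>]
  have "(\<lambda>x y. \<Sum>i\<in>Basis. ((x \<bullet> i) * (x \<bullet> i)) * 1 * (\<eta> x * \<eta> y)
      + ((-2) * ((x \<bullet> i) * (y \<bullet> i) * (\<eta> x * \<eta> y)) + 1 * ((y \<bullet> i) * (y \<bullet> i)) * (\<eta> x * \<eta> y))) \<in> T"
    by (intro T_sum T_add T_cmult T_mult[OF t] smooth_mult smooth_inner' smooth_const)
  moreover have "(dist x y)\<^sup>2 = (\<Sum>i\<in>Basis. (x \<bullet> i) * (x \<bullet> i) + ((-2) * ((x \<bullet> i) * (y \<bullet> i)) + (y \<bullet> i) * (y \<bullet> i)))" for x y :: 'a
  proof -
    have "(dist x y)\<^sup>2 = (\<Sum>i\<in>Basis. ((x - y) \<bullet> i) * ((x - y) \<bullet> i))"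
      unfolding dist_norm power2_norm_eq_inner by (rule euclidean_inner)
    also have "\<dots> = (\<Sum>i\<in>Basis. (x \<bullet> i) * (x \<bullet> i) + ((-2) * ((x \<bullet> i) * (y \<bullet> i)) + (y \<bullet> i) * (y \<bullet> i)))"
      by (intro sum.cong refl) (simp add: inner_diff_left algebra_simps)
    finally show ?thesis .
  qed
  then have "quad \<eta> = (\<lambda>x y. \<Sum>i\<in>Basis. ((x \<bullet> i) * (x \<bullet> i)) * 1 * (\<eta> x * \<eta> y)
      + ((-2) * ((x \<bullet> i) * (y \<bullet> i) * (\<eta> x * \<eta> y)) + 1 * ((y \<bullet> i) * (y \<bullet> i)) * (\<eta> x * \<eta> y)))"
    unfolding quad_def by (simp add: fun_eq_iff sum_distrib_left algebra_simps)
  ultimately show ?thesis by simp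
qed

text \<open>The part near the diagonal has nonpositive \<open>EE\<close>, so the
  \<open>J\<close>-integral of the part away from it is at most \<open>- EE / 2\<close>, uniformly
  in \<open>n\<close>. Since \<open>J\<close> does not charge the diagonal, these parts converge to
  the whole kernel almost everywhere, and Fatou's lemma concludes.\<close>

lemma quad_Jint:
  assumes \<eta>: "\<eta> \<in> C0inf U" and \<eta>0: "\<And>x. 0 \<le> \<eta> x"
  shows "Jint (quad \<eta>)"
proof -
  let ?\<Phi> = "quad \<eta>"
  have T: "?\<Phi> \<in> T" by (rule quad_T[OF \<eta>])
  have nn: "0 \<le> ?\<Phi> x y" for x y using \<eta>0 by (simp add: quad_def)
  obtain \<theta> where \<theta>: "\<And>n x y. 0 \<le> \<theta> n x y" "\<And>n x y. \<theta> n x y \<le> 1"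
    "\<And>p. fst p \<noteq> snd p \<Longrightarrow> eventually (\<lambda>n. \<theta> n (fst p) (snd p) = 0) sequentially"
    "\<And>n::nat. (\<lambda>x y. \<theta> n x y * ?\<Phi> x y) \<in> T" "\<And>n. (\<lambda>x y. (1 - \<theta> n x y) * ?\<Phi> x y) \<in> T"
    "\<And>n. Jint (\<lambda>x y. (1 - \<theta> n x y) * ?\<Phi> x y)"
    "\<And>n. EE ?\<Phi> = EE (\<lambda>x y. \<theta> n x y * ?\<Phi> x y) - 2 * JJ (\<lambda>x y. (1 - \<theta> n x y) * ?\<Phi> x y)"
    by (rule near_diagonal_splitting[OF T]) (rule that)
  have bd: "(\<integral>\<^sup>+p. ennreal ((1 - \<theta> n (fst p) (snd p)) * ?\<Phi> (fst p) (snd p)) \<partial>J) \<le> ennreal (- EE ?\<Phi> / 2)" for n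
  proof -
    have "EE (\<lambda>x y. \<theta> n x y * ?\<Phi> x y) \<le> 0"
      using \<theta>(1) nn by (intro EE_nonpos \<theta>(4) mult_nonneg_nonneg) (auto simp: quad_def)
    then have "JJ (\<lambda>x y. (1 - \<theta> n x y) * ?\<Phi> x y) \<le> - EE ?\<Phi> / 2" using \<theta>(7)[of n] by simp
    moreover have "(\<integral>\<^sup>+p. ennreal ((1 - \<theta> n (fst p) (snd p)) * ?\<Phi> (fst p) (snd p)) \<partial>J)
        = ennreal (JJ (\<lambda>x y. (1 - \<theta> n x y) * ?\<Phi> x y))"
      unfolding JJ_def using \<theta>(2,6) nn by (intro nn_integral_eq_integral AE_I2 mult_nonneg_nonneg) auto
    ultimately show ?thesis by (simp add: ennreal_leI)
  qed
  have "(\<integral>\<^sup>+p. ennreal (?\<Phi> (fst p) (snd p)) \<partial>J)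
      = (\<integral>\<^sup>+p. liminf (\<lambda>n. ennreal ((1 - \<theta> n (fst p) (snd p)) * ?\<Phi> (fst p) (snd p))) \<partial>J)"
  proof (rule nn_integral_cong_AE, rule eventually_mono[OF AE_offdiag])
    fix p :: "'a \<times> 'a" assume p: "fst p \<noteq> snd p"
    have "eventually (\<lambda>n. ennreal ((1 - \<theta> n (fst p) (snd p)) * ?\<Phi> (fst p) (snd p)) = ennreal (?\<Phi> (fst p) (snd p))) sequentially"
      using \<theta>(3)[OF p] by eventually_elim simp
    then have "(\<lambda>n. ennreal ((1 - \<theta> n (fst p) (snd p)) * ?\<Phi> (fst p) (snd p))) \<longlonglongrightarrow> ennreal (?\<Phi> (fst p) (snd p))"
      by (rule tendsto_eventually)
    then show "ennreal (?\<Phi> (fst p) (snd p)) = liminf (\<lambda>n. ennreal ((1 - \<theta> n (fst p) (snd p)) * ?\<Phi> (fst p) (snd p)))"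
      by (simp add: lim_imp_Liminf)
  qed
  also have "\<dots> \<le> liminf (\<lambda>n. \<integral>\<^sup>+p. ennreal ((1 - \<theta> n (fst p) (snd p)) * ?\<Phi> (fst p) (snd p)) \<partial>J)"
    using T_measurable[OF \<theta>(5)] by (intro nn_integral_liminf) simp
  also have "\<dots> \<le> liminf (\<lambda>n::nat. ennreal (- EE ?\<Phi> / 2))"
    by (intro Liminf_mono always_eventually allI bd)
  also have "\<dots> < \<infinity>" by (simp add: Liminf_const)
  finally have "(\<integral>\<^sup>+p. ennreal (norm (?\<Phi> (fst p) (snd p))) \<partial>J) < \<infinity>" using nn by simp
  then show ?thesis by (intro integrableI_bounded T_measurable[OF T])
qed

lemma Jint_quad_bound:
  assumes "f \<in> borel_measurable borel" and F: "compact F" "F \<subseteq> U"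
    and b: "\<And>x y. \<bar>f (x, y)\<bar> \<le> c * (dist x y)\<^sup>2" "\<And>x y. x \<notin> F \<or> y \<notin> F \<Longrightarrow> f (x, y) = 0"
  shows "integrable J f"
proof -
  obtain \<eta> W where \<eta>: "\<eta> \<in> C0inf U" "\<And>x. 0 \<le> \<eta> x" "\<And>x. \<eta> x \<le> 1" "open W" "F \<subseteq> W" "\<And>x. x \<in> W \<Longrightarrow> \<eta> x = 1"
    using smooth_cutoff[of F U] F open_U by metis
  have "integrable J (\<lambda>p. c * quad \<eta> (fst p) (snd p))" using quad_Jint[OF \<eta>(1,2)] by simp
  then show ?thesis
  proof (rule Bochner_Integration.integrable_bound)
    show "f \<in> borel_measurable J" using assms(1) by (simp add: measurable_cong_sets[OF sets_J refl])
    have "\<bar>f p\<bar> \<le> \<bar>c * quad \<eta> (fst p) (snd p)\<bar>" for p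
    proof (cases "fst p \<in> F \<and> snd p \<in> F")
      case True
      then have "\<eta> (fst p) = 1" "\<eta> (snd p) = 1" using \<eta>(5,6) by blast+
      then show ?thesis using b(1)[of "fst p" "snd p"] by (simp add: quad_def)
    qed (use b(2)[of "fst p" "snd p"] in auto)
    then show "AE p in J. norm (f p) \<le> norm (c * quad \<eta> (fst p) (snd p))" by simp
  qed
qed

section \<open>The local functional \<open>B\<close> on kernels vanishing to second order\<close>

definition Q :: "('a \<Rightarrow> 'a \<Rightarrow> real) set" where
  "Q = {\<Phi>\<in>T. \<exists>c. \<forall>x y. \<bar>\<Phi> x y\<bar> \<le> c * (dist x y)\<^sup>2}"

definition B :: "('a \<Rightarrow> 'a \<Rightarrow> real) \<Rightarrow> real" where
  "B \<Phi> = - EE \<Phi> - 2 * JJ \<Phi>"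

lemma Q_T: "\<Phi> \<in> Q \<Longrightarrow> \<Phi> \<in> T"
  by (simp add: Q_def)

lemma Q_Jint: "\<Phi> \<in> Q \<Longrightarrow> Jint \<Phi>"
proof -
  assume \<Phi>: "\<Phi> \<in> Q"
  then obtain c where c: "\<And>x y. \<bar>\<Phi> x y\<bar> \<le> c * (dist x y)\<^sup>2" by (auto simp: Q_def)
  obtain F where F: "compact F" "F \<subseteq> U" "\<And>x y. \<Phi> x y \<noteq> 0 \<Longrightarrow> x \<in> F \<and> y \<in> F"
    using T_support[OF Q_T[OF \<Phi>]] by blast
  show ?thesis
    by (rule Jint_quad_bound[OF _ F(1,2), where c=c])
      (use F(3) c borel_measurable_continuous_onI[OF T_continuous[OF Q_T[OF \<Phi>]]] in auto)
qed

lemma Q_add: "\<Phi> \<in> Q \<Longrightarrow> \<Psi> \<in> Q \<Longrightarrow> (\<lambda>x y. \<Phi> x y + \<Psi> x y) \<in> Q"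
proof -
  assume "\<Phi> \<in> Q" "\<Psi> \<in> Q"
  then obtain c d where c: "\<And>x y. \<bar>\<Phi> x y\<bar> \<le> c * (dist x y)\<^sup>2" and d: "\<And>x y. \<bar>\<Psi> x y\<bar> \<le> d * (dist x y)\<^sup>2"
    and T: "\<Phi> \<in> T" "\<Psi> \<in> T" by (auto simp: Q_def)
  have "\<bar>\<Phi> x y + \<Psi> x y\<bar> \<le> (c + d) * (dist x y)\<^sup>2" for x y
    using c[of x y] d[of x y] by (simp add: distrib_right)
  then show ?thesis using T_add[OF T] unfolding Q_def by blast
qed

lemma Q_cmult: "\<Phi> \<in> Q \<Longrightarrow> (\<lambda>x y. c * \<Phi> x y) \<in> Q"
proof -
  assume "\<Phi> \<in> Q"
  then obtain d where d: "\<And>x y. \<bar>\<Phi> x y\<bar> \<le> d * (dist x y)\<^sup>2" and T: "\<Phi> \<in> T" by (auto simp: Q_def)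
  have "\<bar>c * \<Phi> x y\<bar> \<le> (\<bar>c\<bar> * d) * (dist x y)\<^sup>2" for x y
    using mult_left_mono[OF d[of x y], of "\<bar>c\<bar>"] by (simp add: abs_mult mult.assoc)
  then show ?thesis using T_cmult[OF T] unfolding Q_def by blast
qed

lemma Q_diff: "\<Phi> \<in> Q \<Longrightarrow> \<Psi> \<in> Q \<Longrightarrow> (\<lambda>x y. \<Phi> x y - \<Psi> x y) \<in> Q"
  using Q_add[OF _ Q_cmult[of \<Psi> "-1"], of \<Phi>] by simp

lemma B_add: "\<Phi> \<in> Q \<Longrightarrow> \<Psi> \<in> Q \<Longrightarrow> B (\<lambda>x y. \<Phi> x y + \<Psi> x y) = B \<Phi> + B \<Psi>"
  by (simp add: B_def EE_add JJ_add Q_T Q_Jint)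

lemma B_cmult: "\<Phi> \<in> Q \<Longrightarrow> B (\<lambda>x y. c * \<Phi> x y) = c * B \<Phi>"
  by (simp add: B_def EE_cmult JJ_cmult Q_T algebra_simps)

lemma B_diff: "\<Phi> \<in> Q \<Longrightarrow> \<Psi> \<in> Q \<Longrightarrow> B (\<lambda>x y. \<Phi> x y - \<Psi> x y) = B \<Phi> - B \<Psi>"
  by (simp add: B_def EE_diff JJ_diff Q_T Q_Jint)

lemma Q_sum: "(\<And>i. i \<in> I \<Longrightarrow> \<Phi> i \<in> Q) \<Longrightarrow> (\<lambda>x y. \<Sum>i\<in>I. \<Phi> i x y) \<in> Q"
proof (induction I rule: infinite_finite_induct)
  case (insert i I) then show ?case by (auto intro: Q_add)
qed (auto simp: Q_def T_zero intro!: exI[of _ 0])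

lemma B_zero: "B (\<lambda>x y. 0) = 0"
  by (simp add: B_def EE_zero JJ_def)

lemma B_sum: "(\<And>i. i \<in> I \<Longrightarrow> \<Phi> i \<in> Q) \<Longrightarrow> B (\<lambda>x y. \<Sum>i\<in>I. \<Phi> i x y) = (\<Sum>i\<in>I. B (\<Phi> i))"
  by (induction I rule: infinite_finite_induct) (auto simp: B_zero B_add Q_sum)

text \<open>The part away from the diagonal cancels, leaving \<open>B \<Phi> = - EE
  (\<theta>\<^sub>n \<Phi>) - 2 JJ (\<theta>\<^sub>n \<Phi>)\<close>. Once the support of
  \<open>\<theta>\<^sub>n\<close> is within \<epsilon> of the diagonal,
  \<open>\<theta>\<^sub>n \<Phi>\<close> is nonnegative everywhere and the first term has the right
  sign; the second tends to 0 by dominated convergence.\<close>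

lemma B_nonneg:
  assumes \<Phi>: "\<Phi> \<in> Q" and \<epsilon>: "\<epsilon> > 0" and near: "\<And>x y. dist x y < \<epsilon> \<Longrightarrow> 0 \<le> \<Phi> x y"
  shows "0 \<le> B \<Phi>"
proof -
  have T: "\<Phi> \<in> T" by (rule Q_T[OF \<Phi>])
  obtain c where c: "\<And>x y. \<bar>\<Phi> x y\<bar> \<le> c * (dist x y)\<^sup>2" using \<Phi> by (auto simp: Q_def)
  have diag: "\<Phi> y y = 0" for y using c[of y y] by simp
  obtain \<theta> where \<theta>: "\<And>n x y. 0 \<le> \<theta> n x y" "\<And>n x y. \<theta> n x y \<le> 1"
    "\<And>n x y. 1 / real (Suc n) \<le> dist x y \<Longrightarrow> \<theta> n x y = 0"
    "\<And>p. fst p \<noteq> snd p \<Longrightarrow> eventually (\<lambda>n. \<theta> n (fst p) (snd p) = 0) sequentially"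
    "\<And>n::nat. (\<lambda>x y. \<theta> n x y * \<Phi> x y) \<in> T" "\<And>n. Jint (\<lambda>x y. (1 - \<theta> n x y) * \<Phi> x y)"
    "\<And>n. EE \<Phi> = EE (\<lambda>x y. \<theta> n x y * \<Phi> x y) - 2 * JJ (\<lambda>x y. (1 - \<theta> n x y) * \<Phi> x y)"
    by (rule near_diagonal_splitting[OF T]) (rule that)
  have \<theta>b: "\<bar>\<theta> n x y * \<Phi> x y\<bar> \<le> \<bar>\<Phi> x y\<bar>" for n x y
    using \<theta>(1,2)[of n x y] by (simp add: abs_mult mult_left_le_one_le)
  have "(\<lambda>n. JJ (\<lambda>x y. \<theta> n x y * \<Phi> x y)) \<longlonglongrightarrow> JJ (\<lambda>x y. 0)"
    unfolding JJ_def
  proof (rule integral_dominated_convergence[where w="\<lambda>p. \<bar>\<Phi> (fst p) (snd p)\<bar>"])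
    show "integrable J (\<lambda>p. \<bar>\<Phi> (fst p) (snd p)\<bar>)" using Q_Jint[OF \<Phi>] by simp
    show "AE p in J. (\<lambda>n. \<theta> n (fst p) (snd p) * \<Phi> (fst p) (snd p)) \<longlonglongrightarrow> 0"
    proof (rule eventually_mono[OF AE_offdiag])
      fix p :: "'a \<times> 'a" assume "fst p \<noteq> snd p"
      from \<theta>(4)[OF this] have "eventually (\<lambda>n. \<theta> n (fst p) (snd p) * \<Phi> (fst p) (snd p) = 0) sequentially"
        by eventually_elim simp
      then show "(\<lambda>n. \<theta> n (fst p) (snd p) * \<Phi> (fst p) (snd p)) \<longlonglongrightarrow> 0" by (rule tendsto_eventually)
    qed
  qed (use T_measurable[OF \<theta>(5)] \<theta>b in auto)
  then have lim: "(\<lambda>n. - 2 * JJ (\<lambda>x y. \<theta> n x y * \<Phi> x y)) \<longlonglongrightarrow> - 2 * 0"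
    by (intro tendsto_mult tendsto_const) (simp add: JJ_def)
  obtain n0 where n0: "inverse (real (Suc n0)) < \<epsilon>" using reals_Archimedean[OF \<epsilon>] by blast
  have "- 2 * JJ (\<lambda>x y. \<theta> n x y * \<Phi> x y) \<le> B \<Phi>" if n: "n \<ge> n0" for n
  proof -
    have "1 / real (Suc n) \<le> inverse (real (Suc n0))" using n by (simp add: inverse_eq_divide frac_le)
    then have "0 \<le> \<theta> n x y * \<Phi> x y" for x y
      using near[of x y] \<theta>(1)[of n x y] \<theta>(3)[of n x y] n0 by (cases "dist x y < \<epsilon>") auto
    then have "EE (\<lambda>x y. \<theta> n x y * \<Phi> x y) \<le> 0" by (intro EE_nonpos \<theta>(5)) (auto simp: diag)
    moreover have "JJ \<Phi> = JJ (\<lambda>x y. \<theta> n x y * \<Phi> x y) + JJ (\<lambda>x y. (1 - \<theta> n x y) * \<Phi> x y)"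
    proof -
      have "Jint (\<lambda>x y. \<theta> n x y * \<Phi> x y)"
        using Q_Jint[OF \<Phi>] by (rule Bochner_Integration.integrable_bound) (use T_measurable[OF \<theta>(5)] \<theta>b in auto)
      from JJ_add[OF this \<theta>(6)[of n]] show ?thesis by (simp add: algebra_simps)
    qed
    ultimately show ?thesis using \<theta>(7)[of n] by (simp add: B_def)
  qed
  then have "- 2 * 0 \<le> B \<Phi>" by (intro LIMSEQ_le_const2[OF lim]) blast
  then show ?thesis by simp
qed

lemma B_local:
  assumes \<Phi>: "\<Phi> \<in> Q" and \<epsilon>: "\<epsilon> > 0" and near: "\<And>x y. dist x y < \<epsilon> \<Longrightarrow> \<Phi> x y = 0"
  shows "B \<Phi> = 0"
proof -
  have "0 \<le> B \<Phi>" by (rule B_nonneg[OF \<Phi> \<epsilon>]) (simp add: near)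
  moreover have "0 \<le> B (\<lambda>x y. (-1) * \<Phi> x y)" by (rule B_nonneg[OF Q_cmult[OF \<Phi>] \<epsilon>]) (simp add: near)
  ultimately show ?thesis using B_cmult[OF \<Phi>, of "-1"] by simp
qed

text \<open>At distance less than \<open>r / d\<close> from the diagonal the kernel is dominated by
  \<open>r * quad \<eta>\<close>, so \<open>B_nonneg\<close> bounds \<open>B \<Phi>\<close> and its
  negative by \<open>r * B (quad \<eta>)\<close>, for every \<open>r > 0\<close>. The sign is
  carried by \<open>s\<close>, and \<open>d = \<bar>c\<bar> + 1\<close> avoids a zero
  denominator.\<close>

lemma B_third_order:
  assumes \<Phi>: "\<Phi> \<in> Q" and c: "\<And>x y. \<bar>\<Phi> x y\<bar> \<le> c * (dist x y) ^ 3"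
  shows "B \<Phi> = 0"
proof -
  obtain F where F: "compact F" "F \<subseteq> U" "\<And>x y. \<Phi> x y \<noteq> 0 \<Longrightarrow> x \<in> F \<and> y \<in> F"
    using T_support[OF Q_T[OF \<Phi>]] by blast
  obtain \<eta> W where \<eta>: "\<eta> \<in> C0inf U" "\<And>x. 0 \<le> \<eta> x" "\<And>x. \<eta> x \<le> 1" "open W" "F \<subseteq> W" "\<And>x. x \<in> W \<Longrightarrow> \<eta> x = 1"
    using smooth_cutoff[of F U] F open_U by metis
  have q: "quad \<eta> \<in> Q" unfolding Q_def
  proof (intro CollectI conjI exI[of _ 1] allI quad_T \<eta>)
    fix x y
    have "\<eta> x * \<eta> y \<le> 1" "0 \<le> \<eta> x * \<eta> y"
      using mult_le_one[OF \<eta>(3)[of x] \<eta>(2)[of y] \<eta>(3)[of y]] \<eta>(2)[of x] \<eta>(2)[of y] by simp_all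
    then show "\<bar>quad \<eta> x y\<bar> \<le> 1 * (dist x y)\<^sup>2"
      by (simp add: quad_def mult.assoc abs_mult mult_left_le)
  qed
  define d where "d = \<bar>c\<bar> + 1"
  have d: "d > 0" "c \<le> d" by (auto simp: d_def)
  have key: "s * B \<Phi> \<le> r * B (quad \<eta>)" if r: "r > 0" and s: "\<bar>s\<bar> = 1" for r s :: real
  proof -
    have "0 \<le> B (\<lambda>x y. r * quad \<eta> x y - s * \<Phi> x y)"
    proof (rule B_nonneg[OF Q_diff[OF Q_cmult[OF q] Q_cmult[OF \<Phi>]], of "r / d"])
      show "0 < r / d" using r d by simp
      fix x y :: 'a assume xy: "dist x y < r / d"
      show "0 \<le> r * quad \<eta> x y - s * \<Phi> x y"
      proof (cases "\<Phi> x y = 0")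
        case True then show ?thesis using r \<eta>(2) by (simp add: quad_def)
      next
        case False
        then have "\<eta> x = 1" "\<eta> y = 1" using F(3) \<eta>(5,6) by blast+
        then have "quad \<eta> x y = (dist x y)\<^sup>2" by (simp add: quad_def)
        have "s * \<Phi> x y \<le> \<bar>\<Phi> x y\<bar>" using s by (metis abs_ge_self abs_mult mult_1)
        also have "\<dots> \<le> d * (dist x y) ^ 3" using c[of x y] d mult_right_mono[of c d "(dist x y) ^ 3"] by simp
        also have "\<dots> = (d * dist x y) * (dist x y)\<^sup>2" by (simp add: power3_eq_cube power2_eq_square)
        also have "\<dots> \<le> r * (dist x y)\<^sup>2" using xy d by (intro mult_right_mono) (auto simp: field_simps)
        finally show ?thesis unfolding \<open>quad \<eta> x y = (dist x y)\<^sup>2\<close> by simp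
      qed
    qed
    then show ?thesis using B_diff[OF Q_cmult[OF q] Q_cmult[OF \<Phi>], of r s] B_cmult[OF q, of r] B_cmult[OF \<Phi>, of s] by simp
  qed
  have eps: "s * B \<Phi> \<le> 0 + e" if e: "e > 0" and s: "\<bar>s\<bar> = 1" for e s :: real
  proof -
    have B0: "0 \<le> B (quad \<eta>)" by (rule B_nonneg[OF q, of 1]) (use \<eta>(2) in \<open>auto simp: quad_def\<close>)
    have "s * B \<Phi> \<le> e / (B (quad \<eta>) + 1) * B (quad \<eta>)" by (rule key) (use B0 e s in auto)
    also have "\<dots> \<le> e" using B0 e by (simp add: field_simps)
    finally show ?thesis by simp
  qed
  have "s * B \<Phi> \<le> 0" if s: "\<bar>s\<bar> = 1" for s :: real by (rule field_le_epsilon) (rule eps[OF _ s])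
  from this[of 1] this[of "-1"] show ?thesis by simp
qed

end

section \<open>The local part\<close>

context jump_form
begin

text \<open>Equality with 1 is required on a neighbourhood of \<open>F\<close>. This makes kernels
  built from two cut-offs agree near the diagonal, as \<open>B_local\<close> demands, and makes a
  cut-off constant near a support, as \<open>jump_kill\<close> demands.\<close>

definition cut :: "'a set \<Rightarrow> ('a \<Rightarrow> real) \<Rightarrow> bool" where
  "cut F \<eta> \<longleftrightarrow> \<eta> \<in> C0inf U \<and> (\<exists>W. open W \<and> F \<subseteq> W \<and> (\<forall>x\<in>W. \<eta> x = 1))"

lemma cut_exists: "compact F \<Longrightarrow> F \<subseteq> U \<Longrightarrow> \<exists>\<eta>. cut F \<eta>"
proof -
  assume F: "compact F" "F \<subseteq> U"
  obtain \<eta> W where "\<eta> \<in> C0inf U" "\<And>x. 0 \<le> \<eta> x" "\<And>x. \<eta> x \<le> 1" "open W" "F \<subseteq> W" "\<And>x. x \<in> W \<Longrightarrow> \<eta> x = 1"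
    using smooth_cutoff[OF F open_U] by metis
  then show ?thesis unfolding cut_def by (intro exI[of _ \<eta>] conjI exI[of _ W] ballI)
qed

lemma cut_mono: "cut F \<eta> \<Longrightarrow> F' \<subseteq> F \<Longrightarrow> cut F' \<eta>"
  unfolding cut_def by blast

lemma cut_C0inf: "cut F \<eta> \<Longrightarrow> \<eta> \<in> C0inf U"
  by (simp add: cut_def)

lemma cut_eq: "cut F \<eta> \<Longrightarrow> x \<in> F \<Longrightarrow> \<eta> x = 1"
  unfolding cut_def by blast

lemma cut_near:
  assumes F: "compact F" and c: "cut F \<eta>"
  shows "\<exists>\<epsilon>>0. \<forall>x y. y \<in> F \<longrightarrow> dist x y < \<epsilon> \<longrightarrow> \<eta> x = 1"
proof -
  obtain W where W: "open W" "F \<subseteq> W" "\<forall>x\<in>W. \<eta> x = 1" using c unfolding cut_def by blast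
  have "closed (- W)" "F \<inter> - W = {}" using W by auto
  then obtain d where d: "d > 0" "\<forall>x\<in>F. \<forall>y\<in>- W. d \<le> dist x y"
    using separate_compact_closed[OF F] by blast
  have "\<eta> x = 1" if "y \<in> F" "dist x y < d" for x y
  proof (cases "x \<in> W")
    case False
    then have "d \<le> dist y x" using d(2) that(1) by blast
    then show ?thesis using that(2) by (simp add: dist_commute)
  qed (use W in blast)
  then show ?thesis using d(1) by blast
qed

text \<open>The second-order Taylor monomial at \<open>y\<close>, weighted by \<open>w y\<close>;
  the factor \<open>\<eta> x\<close> only brings the kernel into \<open>T\<close>.\<close>

definition sk :: "'a \<Rightarrow> 'a \<Rightarrow> ('a \<Rightarrow> real) \<Rightarrow> ('a \<Rightarrow> real) \<Rightarrow> 'a \<Rightarrow> 'a \<Rightarrow> real" where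
  "sk \<xi> \<zeta> \<eta> w x y = ((x - y) \<bullet> \<xi>) * ((x - y) \<bullet> \<zeta>) * (\<eta> x * w y)"

lemma sk_Q:
  assumes \<eta>: "\<eta> \<in> C0inf U" and w: "w \<in> C0inf U"
  shows "sk \<xi> \<zeta> \<eta> w \<in> Q"
proof -
  note t = T_tensor[OF \<eta> w]
  have "(\<lambda>x y. (((x \<bullet> \<xi>) * (x \<bullet> \<zeta>)) * 1 * (\<eta> x * w y) + 1 * ((y \<bullet> \<xi>) * (y \<bullet> \<zeta>)) * (\<eta> x * w y))
      - ((x \<bullet> \<xi>) * (y \<bullet> \<zeta>) * (\<eta> x * w y) + (x \<bullet> \<zeta>) * (y \<bullet> \<xi>) * (\<eta> x * w y))) \<in> T"
    by (intro T_add T_diff T_mult[OF t] smooth_mult smooth_inner' smooth_const)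
  moreover have "sk \<xi> \<zeta> \<eta> w = (\<lambda>x y. (((x \<bullet> \<xi>) * (x \<bullet> \<zeta>)) * 1 * (\<eta> x * w y) + 1 * ((y \<bullet> \<xi>) * (y \<bullet> \<zeta>)) * (\<eta> x * w y))
      - ((x \<bullet> \<xi>) * (y \<bullet> \<zeta>) * (\<eta> x * w y) + (x \<bullet> \<zeta>) * (y \<bullet> \<xi>) * (\<eta> x * w y)))"
    by (simp add: sk_def fun_eq_iff inner_diff_left algebra_simps)
  ultimately have T: "sk \<xi> \<zeta> \<eta> w \<in> T" by simp
  obtain B1 where B1: "B1 > 0" "\<And>x. \<bar>\<eta> x\<bar> \<le> B1" using C0inf_bounded[OF \<eta>] by blast
  obtain B2 where B2: "B2 > 0" "\<And>x. \<bar>w x\<bar> \<le> B2" using C0inf_bounded[OF w] by blast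
  have "\<bar>sk \<xi> \<zeta> \<eta> w x y\<bar> \<le> (norm \<xi> * norm \<zeta> * (B1 * B2)) * (dist x y)\<^sup>2" for x y
  proof -
    have "\<bar>sk \<xi> \<zeta> \<eta> w x y\<bar> = \<bar>(x - y) \<bullet> \<xi>\<bar> * \<bar>(x - y) \<bullet> \<zeta>\<bar> * (\<bar>\<eta> x\<bar> * \<bar>w y\<bar>)"
      by (simp add: sk_def abs_mult)
    also have "\<dots> \<le> (dist x y * norm \<xi>) * (dist x y * norm \<zeta>) * (B1 * B2)"
      using B1 B2 unfolding dist_norm by (intro mult_mono Cauchy_Schwarz_ineq2) auto
    finally show ?thesis by (simp add: power2_eq_square mult_ac)
  qed
  then show ?thesis using T unfolding Q_def by blast
qed

definition nu :: "'a \<Rightarrow> 'a \<Rightarrow> ('a \<Rightarrow> real) \<Rightarrow> real" where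
  "nu \<xi> \<zeta> w = B (sk \<xi> \<zeta> (SOME \<eta>. cut (fsupp w) \<eta>) w)"

text \<open>Where \<open>w y\<close> is nonzero and \<open>x\<close> is close to \<open>y\<close>,
  both cut-offs equal 1, so the difference of the kernels vanishes near the diagonal and
  \<open>B_local\<close> applies. This legitimates the choice made in \<open>nu\<close>.\<close>

lemma B_sk_indep:
  assumes w: "w \<in> C0inf U" and c: "cut (fsupp w) \<eta>" "cut (fsupp w) \<eta>'"
  shows "B (sk \<xi> \<zeta> \<eta> w) = B (sk \<xi> \<zeta> \<eta>' w)"
proof -
  note q = sk_Q[OF cut_C0inf[OF c(1)] w, of \<xi> \<zeta>] sk_Q[OF cut_C0inf[OF c(2)] w, of \<xi> \<zeta>]
  obtain d d' where d: "d > 0" "\<And>x y. y \<in> fsupp w \<Longrightarrow> dist x y < d \<Longrightarrow> \<eta> x = 1"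
    and d': "d' > 0" "\<And>x y. y \<in> fsupp w \<Longrightarrow> dist x y < d' \<Longrightarrow> \<eta>' x = 1"
    using cut_near[OF C0infD(2)[OF w] c(1)] cut_near[OF C0infD(2)[OF w] c(2)] by blast
  have "B (\<lambda>x y. sk \<xi> \<zeta> \<eta> w x y - sk \<xi> \<zeta> \<eta>' w x y) = 0"
  proof (rule B_local[OF Q_diff[OF q], of "min d d'"])
    show "0 < min d d'" using d(1) d'(1) by simp
    fix x y :: 'a assume xy: "dist x y < min d d'"
    show "sk \<xi> \<zeta> \<eta> w x y - sk \<xi> \<zeta> \<eta>' w x y = 0"
    proof (cases "y \<in> fsupp w")
      case True
      then show ?thesis using d(2)[OF True, of x] d'(2)[OF True, of x] xy by (simp add: sk_def)
    qed (simp add: sk_def notin_fsupp)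
  qed
  then show ?thesis using B_diff[OF q] by simp
qed

lemma nu_eq: "w \<in> C0inf U \<Longrightarrow> cut (fsupp w) \<eta> \<Longrightarrow> nu \<xi> \<zeta> w = B (sk \<xi> \<zeta> \<eta> w)"
  unfolding nu_def by (rule B_sk_indep) (assumption | rule someI[of "cut (fsupp w)"])+

lemma common_cut:
  assumes "f \<in> C0inf U" "g \<in> C0inf U"
  obtains \<eta> where "cut (fsupp f) \<eta>" "cut (fsupp g) \<eta>" "cut (fsupp f \<union> fsupp g) \<eta>"
proof -
  obtain \<eta> where "cut (fsupp f \<union> fsupp g) \<eta>"
    using cut_exists[of "fsupp f \<union> fsupp g"] C0infD(2,3)[OF assms(1)] C0infD(2,3)[OF assms(2)] by auto
  then show ?thesis using cut_mono that by blast
qed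

lemma nu_add: "f \<in> C0inf U \<Longrightarrow> g \<in> C0inf U \<Longrightarrow> nu \<xi> \<zeta> (\<lambda>x. f x + g x) = nu \<xi> \<zeta> f + nu \<xi> \<zeta> g"
proof -
  assume f: "f \<in> C0inf U" and g: "g \<in> C0inf U"
  obtain \<eta> where c: "cut (fsupp f) \<eta>" "cut (fsupp g) \<eta>" "cut (fsupp f \<union> fsupp g) \<eta>" using common_cut[OF f g] .
  have "fsupp (\<lambda>x. f x + g x) \<subseteq> fsupp f \<union> fsupp g" by (rule fsupp_subset) (auto simp: notin_fsupp)
  then have c': "cut (fsupp (\<lambda>x. f x + g x)) \<eta>" using cut_mono[OF c(3)] by blast
  have "sk \<xi> \<zeta> \<eta> (\<lambda>x. f x + g x) = (\<lambda>x y. sk \<xi> \<zeta> \<eta> f x y + sk \<xi> \<zeta> \<eta> g x y)"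
    by (simp add: sk_def fun_eq_iff algebra_simps)
  then show ?thesis
    using nu_eq[OF C0inf_add[OF f g] c'] nu_eq[OF f c(1)] nu_eq[OF g c(2)]
      B_add[OF sk_Q[OF cut_C0inf[OF c(1)] f] sk_Q[OF cut_C0inf[OF c(1)] g]] by simp
qed

lemma nu_cmult: "f \<in> C0inf U \<Longrightarrow> nu \<xi> \<zeta> (\<lambda>x. c * f x) = c * nu \<xi> \<zeta> f"
proof -
  assume f: "f \<in> C0inf U"
  obtain \<eta> where c: "cut (fsupp f) \<eta>" using cut_exists C0infD(2,3)[OF f] by blast
  have "fsupp (\<lambda>x. c * f x) \<subseteq> fsupp f" by (rule fsupp_subset) (auto simp: notin_fsupp)
  then have c': "cut (fsupp (\<lambda>x. c * f x)) \<eta>" using cut_mono[OF c] by blast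
  have "sk \<xi> \<zeta> \<eta> (\<lambda>x. c * f x) = (\<lambda>x y. c * sk \<xi> \<zeta> \<eta> f x y)"
    by (simp add: sk_def fun_eq_iff algebra_simps)
  then show ?thesis
    using nu_eq[OF C0inf_cmult[OF f] c'] nu_eq[OF f c] B_cmult[OF sk_Q[OF cut_C0inf[OF c] f]] by simp
qed

lemma nu_nonneg: "f \<in> C0inf U \<Longrightarrow> (\<And>x. 0 \<le> f x) \<Longrightarrow> 0 \<le> nu \<xi> \<xi> f"
proof -
  assume f: "f \<in> C0inf U" and f0: "\<And>x. 0 \<le> f x"
  obtain \<eta> where c: "cut (fsupp f) \<eta>" using cut_exists C0infD(2,3)[OF f] by blast
  obtain d where d: "d > 0" "\<And>x y. y \<in> fsupp f \<Longrightarrow> dist x y < d \<Longrightarrow> \<eta> x = 1"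
    using cut_near[OF C0infD(2)[OF f] c] by blast
  have "0 \<le> B (sk \<xi> \<xi> \<eta> f)"
  proof (rule B_nonneg[OF sk_Q[OF cut_C0inf[OF c] f] d(1)])
    fix x y :: 'a assume "dist x y < d"
    then show "0 \<le> sk \<xi> \<xi> \<eta> f x y"
      using d(2)[of y x] f0[of y] notin_fsupp[of y f] by (cases "y \<in> fsupp f") (auto simp: sk_def)
  qed
  then show ?thesis using nu_eq[OF f c] by simp
qed

lemma nu_commute: "nu \<xi> \<zeta> w = nu \<zeta> \<xi> w"
proof -
  have "sk \<xi> \<zeta> \<eta> w = sk \<zeta> \<xi> \<eta> w" for \<eta> by (simp add: sk_def fun_eq_iff mult.commute)
  then show ?thesis by (simp add: nu_def)
qed

text \<open>Only the functionals \<open>nu \<xi> \<xi>\<close> are positive. Polarization exhibits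
  the mixed ones as differences of two of these, which is how \<open>nuM\<close> obtains its pair of
  measures; the halved vectors absorb the factor 1/4.\<close>

lemma nu_polarize: "w \<in> C0inf U \<Longrightarrow>
  nu ((1/2) *\<^sub>R (\<xi> + \<zeta>)) ((1/2) *\<^sub>R (\<xi> + \<zeta>)) w - nu ((1/2) *\<^sub>R (\<xi> - \<zeta>)) ((1/2) *\<^sub>R (\<xi> - \<zeta>)) w = nu \<xi> \<zeta> w"
proof -
  assume w: "w \<in> C0inf U"
  obtain \<eta> where c: "cut (fsupp w) \<eta>" using cut_exists C0infD(2,3)[OF w] by blast
  note q = sk_Q[OF cut_C0inf[OF c] w]
  have "(\<lambda>x y. sk ((1/2) *\<^sub>R (\<xi> + \<zeta>)) ((1/2) *\<^sub>R (\<xi> + \<zeta>)) \<eta> w x y - sk ((1/2) *\<^sub>R (\<xi> - \<zeta>)) ((1/2) *\<^sub>R (\<xi> - \<zeta>)) \<eta> w x y)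
      = sk \<xi> \<zeta> \<eta> w"
    by (simp add: sk_def fun_eq_iff inner_add_right inner_diff_right algebra_simps)
  then show ?thesis using B_diff[OF q q] nu_eq[OF w c] by metis
qed

lemma nu_quadratic: "w \<in> C0inf U \<Longrightarrow>
  (\<Sum>i\<in>Basis. \<Sum>j\<in>Basis. (\<xi> \<bullet> i) * (\<xi> \<bullet> j) * nu i j w) = nu \<xi> \<xi> w"
proof -
  assume w: "w \<in> C0inf U"
  obtain \<eta> where c: "cut (fsupp w) \<eta>" using cut_exists C0infD(2,3)[OF w] by blast
  note q = sk_Q[OF cut_C0inf[OF c] w]
  have eq: "sk \<xi> \<xi> \<eta> w = (\<lambda>x y. \<Sum>i\<in>Basis. \<Sum>j\<in>Basis. ((\<xi> \<bullet> i) * (\<xi> \<bullet> j)) * sk i j \<eta> w x y)"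
  proof (intro ext)
    fix x y :: 'a
    have e: "(x - y) \<bullet> \<xi> = (\<Sum>i\<in>Basis. ((x - y) \<bullet> i) * (\<xi> \<bullet> i))" by (rule euclidean_inner)
    have "sk \<xi> \<xi> \<eta> w x y = (\<Sum>i\<in>Basis. ((x - y) \<bullet> i) * (\<xi> \<bullet> i)) * (\<Sum>j\<in>Basis. ((x - y) \<bullet> j) * (\<xi> \<bullet> j)) * (\<eta> x * w y)"
      unfolding sk_def e ..
    then show "sk \<xi> \<xi> \<eta> w x y = (\<Sum>i\<in>Basis. \<Sum>j\<in>Basis. ((\<xi> \<bullet> i) * (\<xi> \<bullet> j)) * sk i j \<eta> w x y)"
      by (simp add: sum_distrib_left sum_distrib_right sk_def mult_ac)
  qed
  have "B (\<lambda>x y. \<Sum>i\<in>Basis. \<Sum>j\<in>Basis. ((\<xi> \<bullet> i) * (\<xi> \<bullet> j)) * sk i j \<eta> w x y)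
      = (\<Sum>i\<in>Basis. B (\<lambda>x y. \<Sum>j\<in>Basis. ((\<xi> \<bullet> i) * (\<xi> \<bullet> j)) * sk i j \<eta> w x y))"
    by (rule B_sum) (intro Q_sum Q_cmult q)
  also have "\<dots> = (\<Sum>i\<in>Basis. \<Sum>j\<in>Basis. B (\<lambda>x y. ((\<xi> \<bullet> i) * (\<xi> \<bullet> j)) * sk i j \<eta> w x y))"
    by (rule sum.cong[OF refl], rule B_sum) (intro Q_cmult q)
  also have "\<dots> = (\<Sum>i\<in>Basis. \<Sum>j\<in>Basis. (\<xi> \<bullet> i) * (\<xi> \<bullet> j) * B (sk i j \<eta> w))"
    by (simp add: B_cmult[OF q])
  finally show ?thesis unfolding eq[symmetric] nu_eq[OF w c] by simp
qed

section \<open>From positive functionals to signed measures\<close>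

lemma nu_positive: "positive_functional U (nu \<xi> \<xi>)"
  by unfold_locales (auto simp: open_U nu_add nu_cmult nu_nonneg)

definition N :: "'a \<Rightarrow> 'a measure" where
  "N \<xi> = positive_functional.M U (nu \<xi> \<xi>)"

lemma radon_N: "radon_on U (N \<xi>)"
  unfolding N_def by (rule positive_functional.radon_M[OF nu_positive])

lemma integral_N: "w \<in> C0inf U \<Longrightarrow> integral\<^sup>L (N \<xi>) w = nu \<xi> \<xi> w"
  unfolding N_def by (rule positive_functional.integral_C0inf[OF nu_positive])

definition nuM :: "'a \<Rightarrow> 'a \<Rightarrow> 'a measure \<times> 'a measure" where
  "nuM i j = (N ((1/2) *\<^sub>R (i + j)), N ((1/2) *\<^sub>R (i - j)))"

lemma signed_int_nuM: "w \<in> C0inf U \<Longrightarrow> signed_int (nuM i j) w = nu i j w"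
  using integral_N[of w "(1/2) *\<^sub>R (i + j)"] integral_N[of w "(1/2) *\<^sub>R (i - j)"] nu_polarize[of w i j]
  by (simp add: signed_int_def nuM_def)

text \<open>Symmetry and positivity are known for \<open>nu\<close> on test functions. One sequence
  approximates \<open>F\<close> for all the measures \<open>N\<close> simultaneously, so both
  survive the limit.\<close>

lemma signed_val_nuM:
  assumes F: "compact F" "F \<subseteq> U"
  shows "signed_val (nuM i j) F = signed_val (nuM j i) F"
    "0 \<le> (\<Sum>i\<in>Basis. \<Sum>j\<in>Basis. (\<xi> \<bullet> i) * (\<xi> \<bullet> j) * signed_val (nuM i j) F)"
proof -
  obtain f where f: "\<And>n. f n \<in> C0inf U" "\<And>n x. 0 \<le> f n x"
    "\<And>M. radon_on U M \<Longrightarrow> (\<lambda>n::nat. integral\<^sup>L M (f n)) \<longlonglongrightarrow> measure M F"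
    using radon_compact_approx[OF F open_U] by blast
  have lim: "(\<lambda>n. nu i j (f n)) \<longlonglongrightarrow> signed_val (nuM i j) F" for i j
  proof -
    have "(\<lambda>n. signed_int (nuM i j) (f n)) \<longlonglongrightarrow> signed_val (nuM i j) F"
      unfolding signed_int_def signed_val_def nuM_def fst_conv snd_conv
      by (intro tendsto_diff f(3) radon_N)
    then show ?thesis by (simp add: signed_int_nuM[OF f(1)])
  qed
  show "signed_val (nuM i j) F = signed_val (nuM j i) F"
    using lim[of i j] lim[of j i] unfolding nu_commute[of i j] by (rule LIMSEQ_unique)
  have "(\<lambda>n. \<Sum>i\<in>Basis. \<Sum>j\<in>Basis. (\<xi> \<bullet> i) * (\<xi> \<bullet> j) * nu i j (f n))
     \<longlonglongrightarrow> (\<Sum>i\<in>Basis. \<Sum>j\<in>Basis. (\<xi> \<bullet> i) * (\<xi> \<bullet> j) * signed_val (nuM i j) F)"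
    by (intro tendsto_sum tendsto_mult tendsto_const lim)
  then show "0 \<le> (\<Sum>i\<in>Basis. \<Sum>j\<in>Basis. (\<xi> \<bullet> i) * (\<xi> \<bullet> j) * signed_val (nuM i j) F)"
    by (rule LIMSEQ_le_const) (simp add: nu_quadratic[OF f(1)] nu_nonneg[OF f(1,2)])
qed

lemma nu_bound:
  assumes w: "w \<in> C0inf U" and F: "compact F" "F \<subseteq> U" "fsupp w \<subseteq> F" and e: "\<And>x. \<bar>w x\<bar> \<le> e"
  shows "\<bar>nu i j w\<bar> \<le> (measure (fst (nuM i j)) F + measure (snd (nuM i j)) F) * e"
proof -
  have "\<bar>signed_int (nuM i j) w\<bar> \<le> e * measure (fst (nuM i j)) F + e * measure (snd (nuM i j)) F"
    unfolding signed_int_def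
    by (rule order_trans[OF abs_triangle_ineq4])
       (intro add_mono radon_integral_le[OF _ w F e], auto simp: nuM_def radon_N)
  then show ?thesis by (simp add: signed_int_nuM[OF w] algebra_simps)
qed

end

section \<open>Neighbourhoods and integrability\<close>

lemma Udelta_subset: "Udelta U \<delta> \<subseteq> U"
  by (auto simp: Udelta_def)

text \<open>A ball is connected: if it met both \<open>U\<close> and the complement, it would
  contain a frontier point at distance at most \<delta> from \<open>x\<close>.\<close>

lemma Udelta_cball:
  assumes "x \<in> Udelta U \<delta>" "0 \<le> \<delta>"
  shows "cball x \<delta> \<subseteq> U"
proof
  fix y assume y: "y \<in> cball x \<delta>"
  have xU: "x \<in> U" using assms(1) Udelta_subset by blast
  show "y \<in> U"
  proof (rule ccontr)
    assume "y \<notin> U"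
    moreover have "x \<in> cball x \<delta>" using assms(2) by simp
    ultimately have "cball x \<delta> \<inter> U \<noteq> {}" "cball x \<delta> - U \<noteq> {}" using xU y by blast+
    from connected_Int_frontier[OF connected_cball this] obtain z where z: "z \<in> cball x \<delta>" "z \<in> frontier U"
      by blast
    then have "infdist x (frontier U) > \<delta>" using assms(1) by (auto simp: Udelta_def split: if_splits)
    moreover have "infdist x (frontier U) \<le> dist x z" by (rule infdist_le[OF z(2)])
    ultimately show False using z(1) by simp
  qed
qed

locale jump_form_delta = jump_form +
  fixes \<delta> :: real
  assumes delta: "0 < \<delta>"
begin

abbreviation V where "V \<equiv> Udelta U \<delta>"

text \<open>The closed \<delta>-neighbourhood of \<open>F\<close>, as the image of a product under
  addition, so that compactness of \<open>F\<close> carries over.\<close>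

definition nbd :: "'a set \<Rightarrow> 'a set" where
  "nbd F = (\<lambda>p. fst p + snd p) ` (F \<times> cball 0 \<delta>)"

lemma nbdI: "y \<in> F \<Longrightarrow> dist x y \<le> \<delta> \<Longrightarrow> x \<in> nbd F"
  unfolding nbd_def by (rule image_eqI[of _ _ "(y, x - y)"]) (auto simp: dist_norm norm_minus_commute)

lemma nbd_mono: "F \<subseteq> G \<Longrightarrow> nbd F \<subseteq> nbd G"
  unfolding nbd_def by blast

lemma subset_nbd: "F \<subseteq> nbd F"
  using nbdI[of _ F] delta by auto

lemma compact_nbd: "compact F \<Longrightarrow> compact (nbd F)"
  unfolding nbd_def by (intro compact_continuous_image continuous_intros compact_Times compact_cball)

lemma nbd_subset: "F \<subseteq> V \<Longrightarrow> nbd F \<subseteq> U"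
proof
  fix x assume F: "F \<subseteq> V" and "x \<in> nbd F"
  then obtain y d where y: "y \<in> F" "norm d \<le> \<delta>" "x = y + d" by (auto simp: nbd_def)
  then have "x \<in> cball y \<delta>" by (simp add: dist_norm)
  moreover have "cball y \<delta> \<subseteq> U" by (rule Udelta_cball) (use y(1) F delta in auto)
  ultimately show "x \<in> U" by blast
qed

definition near :: "'a \<Rightarrow> 'a \<Rightarrow> real" where
  "near x y = (if dist x y \<le> \<delta> then 1 else 0)"

lemma near_measurable: "(\<lambda>p. near (fst p) (snd p)) \<in> borel_measurable borel"
proof -
  have "closed {p::'a\<times>'a. dist (fst p) (snd p) \<le> \<delta>}" by (intro closed_Collect_le continuous_intros)
  then have "{p::'a\<times>'a. dist (fst p) (snd p) \<le> \<delta>} \<in> sets borel" by (rule borel_closed)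
  then have "(\<lambda>p. indicat_real {p::'a\<times>'a. dist (fst p) (snd p) \<le> \<delta>} p) \<in> borel_measurable borel" by simp
  moreover have "(\<lambda>p. near (fst p) (snd p)) = (\<lambda>p. indicat_real {p::'a\<times>'a. dist (fst p) (snd p) \<le> \<delta>} p)"
    by (auto simp: near_def fun_eq_iff indicator_def)
  ultimately show ?thesis by simp
qed

lemma measurable_fst: "f \<in> borel_measurable borel \<Longrightarrow> (\<lambda>p::'a\<times>'a. f (fst p) :: real) \<in> borel_measurable borel"
  by (rule measurable_compose[of fst borel borel f]) (auto intro!: borel_measurable_continuous_onI continuous_intros)

lemma measurable_snd: "f \<in> borel_measurable borel \<Longrightarrow> (\<lambda>p::'a\<times>'a. f (snd p) :: real) \<in> borel_measurable borel"
  by (rule measurable_compose[of snd borel borel f]) (auto intro!: borel_measurable_continuous_onI continuous_intros)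

lemma measurable_inner: "(\<lambda>p::'a\<times>'a. (fst p - snd p) \<bullet> i) \<in> borel_measurable borel"
  "(\<lambda>p::'a\<times>'a. (snd p - fst p) \<bullet> i) \<in> borel_measurable borel"
  by (auto intro!: borel_measurable_continuous_onI continuous_intros)

lemma tail_bounds:
  "\<delta> < d \<Longrightarrow> 1 \<le> (1 / min 1 (\<delta>\<^sup>2)) * min 1 (d\<^sup>2)"
  "0 \<le> d \<Longrightarrow> d \<le> \<delta> \<Longrightarrow> d\<^sup>2 \<le> max 1 (\<delta>\<^sup>2) * min 1 (d\<^sup>2)"
proof -
  assume d: "\<delta> < d"
  have "\<delta>\<^sup>2 \<le> d\<^sup>2" using d delta by (intro power_mono) auto
  moreover have "0 < min 1 (\<delta>\<^sup>2)" using delta by simp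
  ultimately show "1 \<le> (1 / min 1 (\<delta>\<^sup>2)) * min 1 (d\<^sup>2)" by (simp add: field_simps min_def)
next
  assume d: "0 \<le> d" "d \<le> \<delta>"
  then have *: "d\<^sup>2 \<le> \<delta>\<^sup>2" by (intro power_mono)
  show "d\<^sup>2 \<le> max 1 (\<delta>\<^sup>2) * min 1 (d\<^sup>2)"
  proof (cases "d\<^sup>2 \<le> 1")
    case True
    then have "1 * d\<^sup>2 \<le> max 1 (\<delta>\<^sup>2) * d\<^sup>2" by (intro mult_right_mono) auto
    then show ?thesis using True by (simp add: min_def)
  next
    case False then show ?thesis using * by (simp add: min_def)
  qed
qed

text \<open>Here \<open>x\<close> ranges over all of \<open>U\<close>, so \<open>quad\<close> alone
  is no majorant. The missing part comes from \<open>jump_kill\<close> for \<kappa> and \<eta>, with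
  \<kappa> equal to 1 near the support of \<eta>: it makes
  \<open>(1 - \<kappa> x) * \<eta> y\<close> integrable. For \<open>y\<close> in \<open>F\<close>
  this is 1 if \<open>x\<close> is outside the support of \<kappa>, and \<open>quad \<zeta>\<close>
  is the squared distance if \<open>x\<close> is inside.\<close>

lemma Jint_tail:
  assumes f: "f \<in> borel_measurable borel" and F: "compact F" "F \<subseteq> U"
    and b: "\<And>x y. \<bar>f (x, y)\<bar> \<le> c * min 1 ((dist x y)\<^sup>2)" "\<And>x y. y \<notin> F \<Longrightarrow> f (x, y) = 0"
  shows "integrable J f"
proof -
  obtain \<eta> W where \<eta>: "\<eta> \<in> C0inf U" "\<And>x. 0 \<le> \<eta> x" "\<And>x. \<eta> x \<le> 1" "open W" "F \<subseteq> W" "\<And>x. x \<in> W \<Longrightarrow> \<eta> x = 1"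
    using smooth_cutoff[of F U] F open_U by metis
  obtain \<kappa> W2 where \<kappa>: "\<kappa> \<in> C0inf U" "\<And>x. 0 \<le> \<kappa> x" "\<And>x. \<kappa> x \<le> 1" "open W2" "fsupp \<eta> \<subseteq> W2" "\<And>x. x \<in> W2 \<Longrightarrow> \<kappa> x = 1"
    using smooth_cutoff[of "fsupp \<eta>" U] C0infD(2,3)[OF \<eta>(1)] open_U by metis
  have G: "compact (fsupp \<kappa> \<union> F)" "fsupp \<kappa> \<union> F \<subseteq> U" using C0infD(2,3)[OF \<kappa>(1)] F by auto
  obtain \<zeta> W3 where \<zeta>: "\<zeta> \<in> C0inf U" "\<And>x. 0 \<le> \<zeta> x" "\<And>x. \<zeta> x \<le> 1" "open W3" "fsupp \<kappa> \<union> F \<subseteq> W3" "\<And>x. x \<in> W3 \<Longrightarrow> \<zeta> x = 1"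
    using smooth_cutoff[OF G open_U] by metis
  have "\<exists>W c. open W \<and> fsupp \<eta> \<subseteq> W \<and> (\<forall>x\<in>W. \<kappa> x = c)"
    using \<kappa>(4,5,6) by (intro exI[of _ W2] exI[of _ 1]) auto
  then have i1: "integrable J (\<lambda>p. 2 * (\<kappa> (snd p) - \<kappa> (fst p)) * \<eta> (snd p))"
    using jump_kill \<kappa>(1) \<eta>(1) unfolding jump_kill_def by blast
  have "\<kappa> y * \<eta> y = \<eta> y" for y using \<kappa>(5,6) notin_fsupp[of y \<eta>] by (cases "y \<in> fsupp \<eta>") auto
  then have e1: "2 * (\<kappa> y - \<kappa> x) * \<eta> y = 2 * ((1 - \<kappa> x) * \<eta> y)" for x y
    unfolding mult.assoc left_diff_distrib by simp
  have "integrable J (\<lambda>p. (1/2) * (2 * ((1 - \<kappa> (fst p)) * \<eta> (snd p))))"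
    using i1 unfolding e1 by (rule integrable_mult_right)
  then have i1': "integrable J (\<lambda>p. (1 - \<kappa> (fst p)) * \<eta> (snd p))" by simp
  define g where "g p = (1 - \<kappa> (fst p)) * \<eta> (snd p) + quad \<zeta> (fst p) (snd p)" for p
  have "integrable J g" unfolding g_def[abs_def] using i1' quad_Jint[OF \<zeta>(1,2)] by simp
  then have "integrable J (\<lambda>p. \<bar>c\<bar> * g p)" by simp
  then show ?thesis
  proof (rule Bochner_Integration.integrable_bound)
    show "f \<in> borel_measurable J" using f by (simp add: measurable_cong_sets[OF sets_J refl])
    have g0: "0 \<le> g p" for p unfolding g_def quad_def using \<eta>(2) \<kappa>(3) \<zeta>(2) by (intro add_nonneg_nonneg mult_nonneg_nonneg) auto
    have "\<bar>f (x, y)\<bar> \<le> \<bar>c\<bar> * g (x, y)" for x y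
    proof (cases "y \<in> F")
      case True
      have g: "min 1 ((dist x y)\<^sup>2) \<le> g (x, y)"
      proof (cases "x \<in> fsupp \<kappa>")
        case True
        then have "\<zeta> x = 1" "\<zeta> y = 1" using \<zeta>(5,6) \<open>y \<in> F\<close> by blast+
        then have "g (x, y) = (1 - \<kappa> x) * \<eta> y + (dist x y)\<^sup>2" by (simp add: g_def quad_def)
        moreover have "0 \<le> (1 - \<kappa> x) * \<eta> y" using \<eta>(2) \<kappa>(3) by (intro mult_nonneg_nonneg) auto
        ultimately show ?thesis by simp
      next
        case False
        then have "g (x, y) = 1 + quad \<zeta> x y" using notin_fsupp[of x \<kappa>] \<eta>(5,6) \<open>y \<in> F\<close> by (auto simp: g_def)
        moreover have "0 \<le> quad \<zeta> x y" using \<zeta>(2) by (simp add: quad_def)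
        ultimately show ?thesis by simp
      qed
      have "\<bar>f (x, y)\<bar> \<le> \<bar>c\<bar> * min 1 ((dist x y)\<^sup>2)"
        by (rule order_trans[OF b(1)]) (intro mult_right_mono, auto)
      also have "\<dots> \<le> \<bar>c\<bar> * g (x, y)" using g by (intro mult_left_mono) auto
      finally show ?thesis .
    next
      case False then show ?thesis using b(2) g0[of "(x, y)"] by simp
    qed
    then have "\<bar>f p\<bar> \<le> \<bar>c\<bar> * g p" for p by (cases p) simp
    moreover have "\<bar>\<bar>c\<bar> * g p\<bar> = \<bar>c\<bar> * g p" for p using g0[of p] by (simp add: abs_mult)
    ultimately show "AE p in J. norm (f p) \<le> norm (\<bar>c\<bar> * g p)" by simp
  qed
qed

section \<open>The first-order part\<close>

text \<open>For \<open>w = \<partial>\<^sub>i u v\<close>, summing \<open>k3\<close> over \<open>i\<close> gives the integrand of the first jump term of the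
  decomposition (\<open>k4\<close> below is the second one); \<open>kR\<close> is the error made in replacing the truncation
  \<open>|x - y| \<le> \<delta>\<close> by the cut-off \<open>\<eta>(x)\<close>.\<close>

definition k1 :: "'a \<Rightarrow> ('a \<Rightarrow> real) \<Rightarrow> ('a \<Rightarrow> real) \<Rightarrow> 'a \<Rightarrow> 'a \<Rightarrow> real" where
  "k1 i \<eta> w x y = ((x - y) \<bullet> i) * (\<eta> x * w y)"

definition kR :: "'a \<Rightarrow> ('a \<Rightarrow> real) \<Rightarrow> ('a \<Rightarrow> real) \<Rightarrow> 'a \<Rightarrow> 'a \<Rightarrow> real" where
  "kR i \<eta> w x y = ((x - y) \<bullet> i) * (\<eta> x - near x y) * w y"

definition k3 :: "'a \<Rightarrow> ('a \<Rightarrow> real) \<Rightarrow> 'a \<Rightarrow> 'a \<Rightarrow> real" where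
  "k3 i w x y = ((y - x) \<bullet> i) * (w y - w x) * near x y"

lemma k1_eq: "k1 i \<eta> w = (\<lambda>x y. (\<eta> x * (x \<bullet> i)) * w y - \<eta> x * ((y \<bullet> i) * w y))"
  by (simp add: k1_def fun_eq_iff inner_diff_left algebra_simps)

lemma k1_T: "\<eta> \<in> C0inf U \<Longrightarrow> w \<in> C0inf U \<Longrightarrow> k1 i \<eta> w \<in> T"
  unfolding k1_eq by (intro T_diff T_tensor C0inf_mult C0inf_mult' smooth_inner')

lemma EE_k1: "\<eta> \<in> C0inf U \<Longrightarrow> w \<in> C0inf U \<Longrightarrow>
  EE (k1 i \<eta> w) = E (\<lambda>x. \<eta> x * (x \<bullet> i)) w - E \<eta> (\<lambda>x. (x \<bullet> i) * w x)"
proof -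
  assume \<eta>: "\<eta> \<in> C0inf U" and w: "w \<in> C0inf U"
  have a: "(\<lambda>x. \<eta> x * (x \<bullet> i)) \<in> C0inf U" by (rule C0inf_mult[OF \<eta> smooth_inner'])
  have b: "(\<lambda>x. (x \<bullet> i) * w x) \<in> C0inf U" by (rule C0inf_mult'[OF w smooth_inner'])
  show ?thesis unfolding k1_eq EE_diff[OF T_tensor[OF a w] T_tensor[OF \<eta> b]] EE_tensor[OF a w] EE_tensor[OF \<eta> b] ..
qed

text \<open>For \<open>y\<close> in \<open>F\<close> and \<open>dist x y \<le> \<delta>\<close>, the
  point \<open>x\<close> is in \<open>nbd F\<close>, where \<eta> is 1, so the kernel vanishes. At
  larger distance \<open>near\<close> is 0 and \<open>\<eta> x\<close> keeps the rest bounded. The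
  indicator in place of \<open>w\<close> gives one constant for all functions supported in
  \<open>F\<close>.\<close>

lemma kR_indicator_Jint:
  assumes F: "compact F" "F \<subseteq> V" and c: "cut (nbd F) \<eta>"
  shows "integrable J (\<lambda>p. kR i \<eta> (indicator F) (fst p) (snd p))"
proof -
  have \<eta>: "\<eta> \<in> C0inf U" by (rule cut_C0inf[OF c])
  obtain B0 where B0: "B0 > 0" "\<And>x. \<bar>\<eta> x\<bar> \<le> B0" using C0inf_bounded[OF \<eta>] by blast
  have "(\<lambda>x. \<eta> x * (x \<bullet> i)) \<in> C0inf U" by (intro C0inf_mult \<eta>) simp
  then obtain B1 where B1: "B1 > 0" "\<And>x. \<bar>\<eta> x * (x \<bullet> i)\<bar> \<le> B1" using C0inf_bounded by blast
  obtain B2 where B2: "B2 > 0" "\<And>y. y \<in> F \<Longrightarrow> norm y \<le> B2"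
    using compact_imp_bounded[OF F(1)] bounded_pos by metis
  define C where "C = B1 + B0 * (B2 * norm i)"
  have C: "C \<ge> 0" unfolding C_def using B0(1) B1(1) B2(1) by simp
  show ?thesis
  proof (rule Jint_tail[OF _ F(1), where c="C * (1 / min 1 (\<delta>\<^sup>2))"])
    show "F \<subseteq> U" using F(2) Udelta_subset by blast
    have "indicat_real F \<in> borel_measurable borel" using borel_compact[OF F(1)] by simp
    then show "(\<lambda>p. kR i \<eta> (indicator F) (fst p) (snd p)) \<in> borel_measurable borel"
      unfolding kR_def
      by (intro borel_measurable_times borel_measurable_diff measurable_inner near_measurable
          measurable_fst measurable_snd C0inf_measurable[OF \<eta>])
    fix x y :: 'a
    show "\<bar>kR i \<eta> (indicator F) (fst (x, y)) (snd (x, y))\<bar> \<le> C * (1 / min 1 (\<delta>\<^sup>2)) * min 1 ((dist x y)\<^sup>2)"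
    proof (cases "y \<in> F \<and> \<delta> < dist x y")
      case True
      then have "kR i \<eta> (indicator F) x y = \<eta> x * (x \<bullet> i) - \<eta> x * (y \<bullet> i)"
        by (simp add: kR_def near_def inner_diff_left algebra_simps)
      then have "\<bar>kR i \<eta> (indicator F) x y\<bar> \<le> \<bar>\<eta> x * (x \<bullet> i)\<bar> + \<bar>\<eta> x\<bar> * \<bar>y \<bullet> i\<bar>"
        by (simp add: abs_mult[symmetric])
      also have "\<dots> \<le> C" unfolding C_def
      proof (intro add_mono B1 mult_mono B0)
        have "\<bar>y \<bullet> i\<bar> \<le> norm y * norm i" by (rule Cauchy_Schwarz_ineq2)
        also have "\<dots> \<le> B2 * norm i" using B2(2) True by (intro mult_right_mono) auto
        finally show "\<bar>y \<bullet> i\<bar> \<le> B2 * norm i" .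
      qed (use B0 in auto)
      also have "C * 1 \<le> C * ((1 / min 1 (\<delta>\<^sup>2)) * min 1 ((dist x y)\<^sup>2))"
        using tail_bounds(1) True C by (intro mult_left_mono) auto
      finally show ?thesis by (simp add: mult.assoc)
    next
      case False
      then have "kR i \<eta> (indicator F) x y = 0"
      proof (cases "y \<in> F")
        case True
        then have "dist x y \<le> \<delta>" using False by simp
        then have "\<eta> x = 1" using cut_eq[OF c nbdI[OF True]] by simp
        then show ?thesis using \<open>dist x y \<le> \<delta>\<close> by (simp add: kR_def near_def)
      qed (simp add: kR_def)
      then show ?thesis using C delta by simp
    qed
    show "kR i \<eta> (indicator F) (fst (x, y)) (snd (x, y)) = 0" if "y \<notin> F" using that by (simp add: kR_def)
  qed
qed

lemma kR_bound:
  assumes F: "compact F" "F \<subseteq> V" and c: "cut (nbd F) \<eta>" and w: "w \<in> C0inf U" "fsupp w \<subseteq> F" and e: "\<And>x. \<bar>w x\<bar> \<le> e"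
  shows "Jint (kR i \<eta> w)" "\<bar>JJ (kR i \<eta> w)\<bar> \<le> (\<integral>p. \<bar>kR i \<eta> (indicator F) (fst p) (snd p)\<bar> \<partial>J) * e"
proof -
  have int: "integrable J (\<lambda>p. e * \<bar>kR i \<eta> (indicator F) (fst p) (snd p)\<bar>)"
    using kR_indicator_Jint[OF F c, of i] by simp
  have e0: "0 \<le> e" using e[of undefined] by simp
  have b: "\<bar>kR i \<eta> w x y\<bar> \<le> e * \<bar>kR i \<eta> (indicator F) x y\<bar>" for x y
  proof (cases "y \<in> F")
    case True
    have "\<bar>kR i \<eta> w x y\<bar> = \<bar>w y\<bar> * \<bar>kR i \<eta> (indicator F) x y\<bar>" using True by (simp add: kR_def abs_mult)
    also have "\<dots> \<le> e * \<bar>kR i \<eta> (indicator F) x y\<bar>" using e by (intro mult_right_mono) auto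
    finally show ?thesis .
  next
    case False
    then have "w y = 0" using w(2) notin_fsupp by blast
    then show ?thesis using e0 by (simp add: kR_def)
  qed
  have m: "(\<lambda>p. kR i \<eta> w (fst p) (snd p)) \<in> borel_measurable J"
    unfolding kR_def measurable_cong_sets[OF sets_J refl]
    by (intro borel_measurable_times borel_measurable_diff measurable_inner near_measurable
          measurable_fst measurable_snd C0inf_measurable[OF cut_C0inf[OF c]] C0inf_measurable[OF w(1)])
  show I: "Jint (kR i \<eta> w)"
    by (rule Bochner_Integration.integrable_bound[OF int m]) (use b e0 in \<open>simp add: abs_mult\<close>)
  have "\<bar>JJ (kR i \<eta> w)\<bar> \<le> (\<integral>p. \<bar>kR i \<eta> w (fst p) (snd p)\<bar> \<partial>J)"
    unfolding JJ_def by (rule integral_abs_bound)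
  also have "\<dots> \<le> (\<integral>p. e * \<bar>kR i \<eta> (indicator F) (fst p) (snd p)\<bar> \<partial>J)"
    by (rule integral_mono) (use I int b in auto)
  finally show "\<bar>JJ (kR i \<eta> w)\<bar> \<le> (\<integral>p. \<bar>kR i \<eta> (indicator F) (fst p) (snd p)\<bar> \<partial>J) * e"
    by (simp add: mult.commute)
qed

definition sq :: "'a set \<Rightarrow> 'a \<Rightarrow> 'a \<Rightarrow> real" where
  "sq G x y = (dist x y)\<^sup>2 * indicator G x * indicator G y"

lemma sq_Jint: "compact G \<Longrightarrow> G \<subseteq> U \<Longrightarrow> Jint (sq G)"
proof -
  assume G: "compact G" "G \<subseteq> U"
  have "indicat_real G \<in> borel_measurable borel" using borel_compact[OF G(1)] by simp
  moreover have "(\<lambda>p::'a\<times>'a. (dist (fst p) (snd p))\<^sup>2) \<in> borel_measurable borel"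
    by (intro borel_measurable_continuous_onI continuous_intros)
  ultimately have "(\<lambda>p. sq G (fst p) (snd p)) \<in> borel_measurable borel"
    unfolding sq_def by (intro borel_measurable_times measurable_fst measurable_snd)
  then show ?thesis
    by (rule Jint_quad_bound[OF _ G, where c=1]) (auto simp: sq_def indicator_def)
qed

text \<open>The increment of \<open>w\<close> supplies the second factor \<open>dist x y\<close>,
  and the truncation keeps both points in \<open>nbd F\<close> as soon as one lies in
  \<open>F\<close>. The bound is linear in the Lipschitz constant of \<open>w\<close>, which is what
  continuity of \<open>Psi\<close> requires.\<close>

lemma k3_bound:
  assumes F: "compact F" "F \<subseteq> V" and w: "w \<in> C0inf U" "fsupp w \<subseteq> F"
    and L: "\<And>x y. \<bar>w x - w y\<bar> \<le> L * dist x y" and i: "norm i = 1"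
  shows "Jint (k3 i w)" "\<bar>JJ (k3 i w)\<bar> \<le> JJ (sq (nbd F)) * L"
proof -
  note G = compact_nbd[OF F(1)] nbd_subset[OF F(2)]
  have int: "integrable J (\<lambda>p. L * sq (nbd F) (fst p) (snd p))" using sq_Jint[OF G] by simp
  have b: "\<bar>k3 i w x y\<bar> \<le> L * sq (nbd F) x y" for x y
  proof (cases "dist x y \<le> \<delta> \<and> (x \<in> F \<or> y \<in> F)")
    case True
    then have "x \<in> nbd F" "y \<in> nbd F"
      using nbdI[of y F x] nbdI[of x F y] subset_nbd[of F] by (auto simp: dist_commute)
    then have s: "sq (nbd F) x y = (dist x y)\<^sup>2" by (simp add: sq_def)
    have "\<bar>k3 i w x y\<bar> = \<bar>(y - x) \<bullet> i\<bar> * \<bar>w y - w x\<bar>" using True by (simp add: k3_def near_def abs_mult)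
    also have "\<dots> \<le> dist x y * (L * dist x y)"
      using L[of y x] Cauchy_Schwarz_ineq2[of "y - x" i] i
      by (intro mult_mono) (auto simp: dist_norm norm_minus_commute)
    finally show ?thesis unfolding s by (simp add: power2_eq_square mult_ac)
  next
    case False
    have "k3 i w x y = 0"
    proof (cases "dist x y \<le> \<delta>")
      case True
      then have "x \<notin> fsupp w" "y \<notin> fsupp w" using False w(2) by auto
      then show ?thesis by (simp add: k3_def notin_fsupp)
    qed (simp add: k3_def near_def)
    moreover have "0 \<le> L * sq (nbd F) x y"
    proof (cases "x = y")
      case False
      then have "0 < dist x y" by simp
      moreover have "0 \<le> L * dist x y" using L[of x y] by linarith
      ultimately have "0 \<le> L" using zero_le_mult_iff by force
      then show ?thesis by (simp add: sq_def)
    qed (simp add: sq_def)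
    ultimately show ?thesis by simp
  qed
  have m: "(\<lambda>p. k3 i w (fst p) (snd p)) \<in> borel_measurable J"
    unfolding k3_def measurable_cong_sets[OF sets_J refl]
    by (intro borel_measurable_times borel_measurable_diff measurable_inner near_measurable
          measurable_fst measurable_snd C0inf_measurable[OF w(1)])
  show I: "Jint (k3 i w)"
    by (rule Bochner_Integration.integrable_bound[OF int m])
      (use b in \<open>auto intro!: always_eventually intro: order_trans[OF _ abs_ge_self]\<close>)
  have "\<bar>JJ (k3 i w)\<bar> \<le> (\<integral>p. \<bar>k3 i w (fst p) (snd p)\<bar> \<partial>J)"
    unfolding JJ_def by (rule integral_abs_bound)
  also have "\<dots> \<le> (\<integral>p. L * sq (nbd F) (fst p) (snd p) \<partial>J)"
    by (rule integral_mono) (use I int b in auto)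
  finally show "\<bar>JJ (k3 i w)\<bar> \<le> JJ (sq (nbd F)) * L" by (simp add: JJ_def mult.commute)
qed

lemma k3_Jint: "w \<in> C0inf V \<Longrightarrow> norm i = 1 \<Longrightarrow> Jint (k3 i w)"
proof -
  assume w: "w \<in> C0inf V" and i: "norm i = 1"
  obtain L where "\<And>x y. \<bar>w x - w y\<bar> \<le> L * dist x y" using C0inf_lipschitz[OF w] by blast
  then show ?thesis
    by (intro k3_bound(1)[OF C0infD(2,3)[OF w] C0inf_mono[OF Udelta_subset w] order_refl _ i])
qed

lemma kR_Jint:
  assumes w: "w \<in> C0inf V" and c: "cut (nbd (fsupp w)) \<eta>"
  shows "Jint (kR i \<eta> w)"
proof -
  obtain e where "\<And>x. \<bar>w x\<bar> \<le> e" using C0inf_bounded[OF w] by blast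
  then show ?thesis
    by (intro kR_bound(1)[OF C0infD(2,3)[OF w] c C0inf_mono[OF Udelta_subset w] order_refl])
qed

text \<open>With \<open>A\<close> the local part of \<open>E\<close> and \<open>\<eta> = 1\<close> near the \<open>\<delta>\<close>-neighbourhood of the support of \<open>w\<close>,
  the formula is \<open>A(\<eta> x\<^sub>i, w) - 1/2 \<Sum>\<^sub>j \<integral> \<partial>\<^sub>j w d\<nu>\<^sub>i\<^sub>j\<close>: the value forced on \<open>\<Psi>\<^sub>i\<close> by
  taking \<open>u = \<eta> x\<^sub>i\<close> in the decomposition.\<close>

definition psi :: "('a \<Rightarrow> real) \<Rightarrow> 'a \<Rightarrow> ('a \<Rightarrow> real) \<Rightarrow> real" where
  "psi \<eta> i w = EE (k1 i \<eta> w) + 2 * JJ (kR i \<eta> w) - JJ (k3 i w) - 1/2 * (\<Sum>j\<in>Basis. nu i j (pd j w))"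

definition Psi :: "'a \<Rightarrow> ('a \<Rightarrow> real) \<Rightarrow> real" where
  "Psi i w = psi (SOME \<eta>. cut (nbd (fsupp w)) \<eta>) i w"

text \<open>Let \<open>D\<close> be the difference of the two kernels \<open>k1\<close>. It vanishes
  near the diagonal, so \<open>B D = 0\<close>, that is, \<open>EE D = - 2 * JJ D\<close>. Since the
  \<open>near\<close> terms cancel, \<open>D\<close> is also the difference of the kernels
  \<open>kR\<close>; the changes of the first two terms of \<open>psi\<close> compensate each
  other.\<close>

lemma psi_indep:
  assumes w: "w \<in> C0inf V" and c: "cut (nbd (fsupp w)) \<eta>" "cut (nbd (fsupp w)) \<eta>'"
  shows "psi \<eta> i w = psi \<eta>' i w"
proof -
  have wU: "w \<in> C0inf U" by (rule C0inf_mono[OF Udelta_subset w])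
  note \<eta> = cut_C0inf[OF c(1)] cut_C0inf[OF c(2)]
  define D where "D x y = k1 i \<eta> w x y - k1 i \<eta>' w x y" for x y
  have DT: "D \<in> T" unfolding D_def[abs_def] by (intro T_diff k1_T \<eta> wU)
  obtain d d' where d: "d > 0" "\<And>x y. y \<in> fsupp w \<Longrightarrow> dist x y < d \<Longrightarrow> \<eta> x = 1"
    and d': "d' > 0" "\<And>x y. y \<in> fsupp w \<Longrightarrow> dist x y < d' \<Longrightarrow> \<eta>' x = 1"
    using cut_near[OF C0infD(2)[OF w] cut_mono[OF c(1) subset_nbd]]
      cut_near[OF C0infD(2)[OF w] cut_mono[OF c(2) subset_nbd]] by blast
  define r where "r = min d d'"
  have r: "0 < r" using d(1) d'(1) by (simp add: r_def)
  have D0: "D x y = 0" if "dist x y < r" for x y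
    using d(2)[of y x] d'(2)[of y x] that notin_fsupp[of y w] by (cases "y \<in> fsupp w") (auto simp: D_def k1_def r_def)
  obtain B0 where B0: "B0 > 0" "\<And>x. \<bar>\<eta> x - \<eta>' x\<bar> \<le> B0" using C0inf_bounded[OF C0inf_diff[OF \<eta>]] by blast
  obtain B1 where B1: "B1 > 0" "\<And>x. \<bar>w x\<bar> \<le> B1" using C0inf_bounded[OF w] by blast
  \<comment> \<open>The kernel is only of first order in \<open>dist x y\<close>, but it is zero for
    \<open>dist x y < r\<close>; elsewhere the missing factor is at least 1 in the form
    \<open>dist x y / r\<close>.\<close>
  have "\<bar>D x y\<bar> \<le> (norm i * (B0 * B1) / r) * (dist x y)\<^sup>2" for x y
  proof (cases "dist x y < r")
    case True then show ?thesis using D0 B0(1) B1(1) r by simp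
  next
    case False
    have "D x y = ((x - y) \<bullet> i) * ((\<eta> x - \<eta>' x) * w y)" by (simp add: D_def k1_def algebra_simps)
    then have "\<bar>D x y\<bar> = \<bar>(x - y) \<bullet> i\<bar> * (\<bar>\<eta> x - \<eta>' x\<bar> * \<bar>w y\<bar>)" by (simp add: abs_mult)
    also have "\<dots> \<le> (dist x y * norm i) * (B0 * B1)"
      using B0 B1 unfolding dist_norm by (intro mult_mono Cauchy_Schwarz_ineq2) auto
    also have "\<dots> = (norm i * (B0 * B1) / r) * (dist x y * r)" using r by simp
    also have "\<dots> \<le> (norm i * (B0 * B1) / r) * (dist x y * dist x y)"
      using False r B0(1) B1(1) by (intro mult_left_mono) auto
    finally show ?thesis by (simp add: power2_eq_square)
  qed
  then have DQ: "D \<in> Q" using DT unfolding Q_def by blast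
  have "B D = 0" by (rule B_local[OF DQ r D0])
  then have "EE D = - 2 * JJ D" by (simp add: B_def)
  moreover have "EE D = EE (k1 i \<eta> w) - EE (k1 i \<eta>' w)"
    unfolding D_def[abs_def] by (rule EE_diff[OF k1_T[OF \<eta>(1) wU] k1_T[OF \<eta>(2) wU]])
  moreover have "JJ D = JJ (kR i \<eta> w) - JJ (kR i \<eta>' w)"
  proof -
    have "D = (\<lambda>x y. kR i \<eta> w x y - kR i \<eta>' w x y)" by (simp add: D_def k1_def kR_def fun_eq_iff algebra_simps)
    then show ?thesis using JJ_diff[OF kR_Jint[OF w c(1)] kR_Jint[OF w c(2)]] by simp
  qed
  ultimately show ?thesis by (simp add: psi_def)
qed

lemma Psi_eq: "w \<in> C0inf V \<Longrightarrow> cut (nbd (fsupp w)) \<eta> \<Longrightarrow> Psi i w = psi \<eta> i w"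
  unfolding Psi_def by (rule psi_indep) (assumption | rule someI[of "cut (nbd (fsupp w))"])+

lemma psi_lincomb:
  assumes f: "f \<in> C0inf V" and g: "g \<in> C0inf V" and cf: "cut (nbd (fsupp f)) \<eta>" and cg: "cut (nbd (fsupp g)) \<eta>"
    and i: "norm i = 1"
  shows "psi \<eta> i (\<lambda>x. a * f x + b * g x) = a * psi \<eta> i f + b * psi \<eta> i g"
proof -
  have fU: "f \<in> C0inf U" and gU: "g \<in> C0inf U" using C0inf_mono[OF Udelta_subset] f g by blast+
  have \<eta>: "\<eta> \<in> C0inf U" by (rule cut_C0inf[OF cf])
  have 1: "EE (k1 i \<eta> (\<lambda>x. a * f x + b * g x)) = a * EE (k1 i \<eta> f) + b * EE (k1 i \<eta> g)"
  proof -
    have "k1 i \<eta> (\<lambda>x. a * f x + b * g x) = (\<lambda>x y. a * k1 i \<eta> f x y + b * k1 i \<eta> g x y)"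
      by (simp add: k1_def fun_eq_iff algebra_simps)
    then show ?thesis
      using EE_add[OF T_cmult[OF k1_T[OF \<eta> fU]] T_cmult[OF k1_T[OF \<eta> gU]], of a i b i]
        EE_cmult[OF k1_T[OF \<eta> fU], of a i] EE_cmult[OF k1_T[OF \<eta> gU], of b i] by simp
  qed
  have 2: "JJ (kR i \<eta> (\<lambda>x. a * f x + b * g x)) = a * JJ (kR i \<eta> f) + b * JJ (kR i \<eta> g)"
  proof -
    have "kR i \<eta> (\<lambda>x. a * f x + b * g x) x y = a * kR i \<eta> f x y + b * kR i \<eta> g x y" for x y
      by (simp add: kR_def algebra_simps)
    then show ?thesis using kR_Jint[OF f cf, of i] kR_Jint[OF g cg, of i] by (simp add: JJ_def)
  qed
  have 3: "JJ (k3 i (\<lambda>x. a * f x + b * g x)) = a * JJ (k3 i f) + b * JJ (k3 i g)"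
  proof -
    have "k3 i (\<lambda>x. a * f x + b * g x) x y = a * k3 i f x y + b * k3 i g x y" for x y
      by (simp add: k3_def algebra_simps)
    then show ?thesis using k3_Jint[OF f i] k3_Jint[OF g i] by (simp add: JJ_def)
  qed
  have 4: "nu i j (pd j (\<lambda>x. a * f x + b * g x)) = a * nu i j (pd j f) + b * nu i j (pd j g)" if "j \<in> Basis" for j
  proof -
    note s = C0infD(1)[OF fU] C0infD(1)[OF gU]
    have "pd j (\<lambda>x. a * f x + b * g x) = (\<lambda>x. a * pd j f x + b * pd j g x)"
      by (simp add: pd_add pd_cmult smooth_cmult s)
    then show ?thesis
      using nu_add[OF C0inf_cmult[OF C0inf_pd[OF fU that]] C0inf_cmult[OF C0inf_pd[OF gU that]]]
        nu_cmult[OF C0inf_pd[OF fU that]] nu_cmult[OF C0inf_pd[OF gU that]] by simp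
  qed
  have "(\<Sum>j\<in>Basis. nu i j (pd j (\<lambda>x. a * f x + b * g x)))
      = a * (\<Sum>j\<in>Basis. nu i j (pd j f)) + b * (\<Sum>j\<in>Basis. nu i j (pd j g))"
    by (simp add: 4 sum.distrib sum_distrib_left)
  then show ?thesis unfolding psi_def 1 2 3 by (simp add: algebra_simps)
qed

text \<open>Serves the last three terms of \<open>psi\<close>, which are distributions of order at
  most one with bounds in the sup norms of \<open>w\<close> and its first derivatives. Only the term
  with \<open>EE\<close> draws on the continuity assumed of \<open>E\<close>.\<close>

lemma tendsto_of_uniform_bound:
  fixes fs :: "nat \<Rightarrow> 'a \<Rightarrow> real"
  assumes conv: "smooth_conv fs f"
    and bd: "\<And>n e. (\<And>x. \<bar>fs n x - f x\<bar> \<le> e) \<Longrightarrow> (\<And>j x. j \<in> Basis \<Longrightarrow> \<bar>pd j (fs n) x - pd j f x\<bar> \<le> e) \<Longrightarrow>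
      \<bar>a n - l\<bar> \<le> C * e"
  shows "a \<longlonglongrightarrow> l"
proof (rule LIMSEQ_I)
  fix r :: real assume r: "0 < r"
  define e where "e = r / (\<bar>C\<bar> + 1)"
  have e: "e > 0" using r by (simp add: e_def)
  have "\<forall>\<^sub>F n in sequentially. \<forall>x\<in>UNIV. dist (fs n x) (f x) < e"
    using smooth_conv_uniform[OF conv] e by (auto simp: uniform_limit_iff)
  moreover have "\<forall>\<^sub>F n in sequentially. \<forall>j\<in>Basis. \<forall>x\<in>UNIV. dist (pd j (fs n) x) (pd j f x) < e"
    by (rule eventually_ball_finite[OF finite_Basis])
      (use smooth_conv_uniform[OF smooth_conv_pd[OF conv]] e in \<open>auto simp: uniform_limit_iff\<close>)
  ultimately have "\<forall>\<^sub>F n in sequentially. norm (a n - l) < r"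
  proof eventually_elim
    case (elim n)
    have "\<bar>a n - l\<bar> \<le> C * e"
      by (rule bd) (use elim in \<open>auto simp: dist_real_def less_imp_le\<close>)
    also have "\<dots> \<le> \<bar>C\<bar> * e" using e by (intro mult_right_mono) auto
    also have "\<dots> < (\<bar>C\<bar> + 1) * e" using e by simp
    also have "\<dots> = r" by (simp add: e_def)
    finally show ?case by simp
  qed
  then show "\<exists>no. \<forall>n\<ge>no. norm (a n - l) < r" by (simp add: eventually_sequentially)
qed

lemma Psi_generalized:
  assumes sc: "smooth_continuous_form U E" and i: "i \<in> Basis"
  shows "generalized_function V (Psi i)"
  unfolding generalized_function_def
proof (intro conjI ballI allI impI)
  have i1: "norm i = 1" using i by simp
  fix f g a b assume f: "f \<in> C0inf V" and g: "g \<in> C0inf V"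
  define F where "F = fsupp f \<union> fsupp g"
  have F: "compact F" "F \<subseteq> V" using C0infD(2,3)[OF f] C0infD(2,3)[OF g] by (auto simp: F_def)
  obtain \<eta> where c: "cut (nbd F) \<eta>" using cut_exists[OF compact_nbd[OF F(1)] nbd_subset[OF F(2)]] by blast
  have cs: "cut (nbd (fsupp h)) \<eta>" if "fsupp h \<subseteq> F" for h using cut_mono[OF c nbd_mono[OF that]] .
  have fg: "(\<lambda>x. a * f x + b * g x) \<in> C0inf V" by (intro C0inf_add C0inf_cmult f g)
  have "fsupp (\<lambda>x. a * f x + b * g x) \<subseteq> F" unfolding F_def by (rule fsupp_subset) (auto simp: notin_fsupp)
  then show "Psi i (\<lambda>x. a * f x + b * g x) = a * Psi i f + b * Psi i g"
    using Psi_eq[OF fg cs] Psi_eq[OF f cs] Psi_eq[OF g cs] psi_lincomb[OF f g cs cs i1] by (simp add: F_def)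
next
  have i1: "norm i = 1" using i by simp
  fix Ob fs f assume Ob: "rel_compact_open Ob V" and H: "(\<forall>n. fs n \<in> C0inf Ob) \<and> f \<in> C0inf Ob \<and> smooth_conv fs f"
  then have fs: "fs n \<in> C0inf Ob" and f: "f \<in> C0inf Ob" and conv: "smooth_conv fs f" for n by auto
  \<comment> \<open>All supports lie in this one compact subset of \<open>V\<close>, so a single
    cut-off \<eta> computes \<open>Psi\<close> along the whole sequence.\<close>
  define F where "F = closure Ob"
  have F: "compact F" "F \<subseteq> V" using Ob by (auto simp: rel_compact_open_def F_def)
  have ObF: "Ob \<subseteq> F" by (simp add: F_def closure_subset)
  have ObU: "rel_compact_open Ob U" using Ob Udelta_subset by (auto simp: rel_compact_open_def)
  have toV: "h \<in> C0inf V" and toU: "h \<in> C0inf U" and sup: "fsupp h \<subseteq> F" if "h \<in> C0inf Ob" for h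
  proof -
    show s: "fsupp h \<subseteq> F" using C0infD(3)[OF that] ObF by blast
    show "h \<in> C0inf V" using C0inf_mono[of Ob V h] that ObF F(2) by blast
    then show "h \<in> C0inf U" using C0inf_mono[OF Udelta_subset] by blast
  qed
  obtain \<eta> where c: "cut (nbd F) \<eta>" using cut_exists[OF compact_nbd[OF F(1)] nbd_subset[OF F(2)]] by blast
  have \<eta>: "\<eta> \<in> C0inf U" by (rule cut_C0inf[OF c])
  have cs: "cut (nbd (fsupp h)) \<eta>" if "h \<in> C0inf Ob" for h using cut_mono[OF c nbd_mono[OF sup[OF that]]] .
  have df: "(\<lambda>x. fs n x - f x) \<in> C0inf Ob" for n by (intro C0inf_diff fs f)
  have E_conv: "(\<lambda>n. E g (hs n)) \<longlonglongrightarrow> E g h" if "\<And>n. hs n \<in> C0inf Ob" "h \<in> C0inf Ob" "smooth_conv hs h" "g \<in> C0inf U" for g hs h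
    using sc ObU that unfolding smooth_continuous_form_def by blast
  have c1: "(\<lambda>n. EE (k1 i \<eta> (fs n))) \<longlonglongrightarrow> EE (k1 i \<eta> f)"
  proof -
    define q where "q x = \<eta> x * (x \<bullet> i)" for x
    have q: "q \<in> C0inf U" unfolding q_def[abs_def] by (intro C0inf_mult \<eta>) simp
    \<comment> \<open>On the support of \<open>h\<close> the cut-off is 1, so the coordinate may be
      replaced by \<open>q\<close>, a compactly supported multiplier as in
      \<open>smooth_conv_mult\<close>.\<close>
    have qm: "(\<lambda>x. (x \<bullet> i) * h x) = (\<lambda>x. q x * h x)" if "h \<in> C0inf Ob" for h
    proof
      fix x show "(x \<bullet> i) * h x = q x * h x"
        using cut_eq[OF c, of x] sup[OF that] subset_nbd[of F] notin_fsupp[of x h]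
        by (cases "x \<in> fsupp h") (auto simp: q_def)
    qed
    have 1: "(\<lambda>n. E q (fs n)) \<longlonglongrightarrow> E q f" by (rule E_conv[OF fs f conv q])
    have 2: "(\<lambda>n. E \<eta> (\<lambda>x. q x * fs n x)) \<longlonglongrightarrow> E \<eta> (\<lambda>x. q x * f x)"
      by (rule E_conv[OF _ _ smooth_conv_mult[OF q C0infD(1)[OF fs] C0infD(1)[OF f] conv] \<eta>])
        (intro C0inf_mult' fs f C0infD(1)[OF q])+
    show ?thesis
      unfolding EE_k1[OF \<eta> toU[OF fs]] EE_k1[OF \<eta> toU[OF f]] qm[OF fs] qm[OF f] q_def[symmetric]
      by (rule tendsto_diff[OF 1 2])
  qed
  have c2: "(\<lambda>n. JJ (kR i \<eta> (fs n))) \<longlonglongrightarrow> JJ (kR i \<eta> f)"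
  proof (rule tendsto_of_uniform_bound[OF conv, where C="\<integral>p. \<bar>kR i \<eta> (indicator F) (fst p) (snd p)\<bar> \<partial>J"])
    fix n e assume e: "\<And>x. \<bar>fs n x - f x\<bar> \<le> e"
    have "kR i \<eta> (\<lambda>x. fs n x - f x) x y = kR i \<eta> (fs n) x y - kR i \<eta> f x y" for x y
      by (simp add: kR_def algebra_simps)
    then have "JJ (kR i \<eta> (fs n)) - JJ (kR i \<eta> f) = JJ (kR i \<eta> (\<lambda>x. fs n x - f x))"
      using kR_Jint[OF toV[OF fs] cs[OF fs], of i n] kR_Jint[OF toV[OF f] cs[OF f], of i] by (simp add: JJ_def)
    then show "\<bar>JJ (kR i \<eta> (fs n)) - JJ (kR i \<eta> f)\<bar> \<le> (\<integral>p. \<bar>kR i \<eta> (indicator F) (fst p) (snd p)\<bar> \<partial>J) * e"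
      using kR_bound(2)[OF F c toU[OF df] sup[OF df] e] by simp
  qed
  have c3: "(\<lambda>n. JJ (k3 i (fs n))) \<longlonglongrightarrow> JJ (k3 i f)"
  proof (rule tendsto_of_uniform_bound[OF conv, where C="JJ (sq (nbd F)) * real DIM('a)"])
    fix n e assume e: "\<And>j x. j \<in> Basis \<Longrightarrow> \<bar>pd j (fs n) x - pd j f x\<bar> \<le> e"
    note sm = C0infD(1)[OF fs] C0infD(1)[OF f]
    have "pd j (\<lambda>x. fs n x + (-1) * f x) = (\<lambda>x. pd j (fs n) x + (-1) * pd j f x)" for j
      by (subst pd_add[OF sm(1) smooth_cmult[OF sm(2)]], subst pd_cmult[OF sm(2)]) (rule refl)
    then have pdj: "pd j (\<lambda>x. fs n x - f x) x = pd j (fs n) x - pd j f x" for j x by simp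
    have L: "\<bar>(fs n x - f x) - (fs n y - f y)\<bar> \<le> (real DIM('a) * e) * dist x y" for x y
      using smooth_lipschitz[OF C0infD(1)[OF df], where B="\<lambda>_. e", of n x y] e by (simp add: pdj)
    have "k3 i (\<lambda>x. fs n x - f x) x y = k3 i (fs n) x y - k3 i f x y" for x y
      by (simp add: k3_def algebra_simps)
    then have "JJ (k3 i (fs n)) - JJ (k3 i f) = JJ (k3 i (\<lambda>x. fs n x - f x))"
      using k3_Jint[OF toV[OF fs] i1, of n] k3_Jint[OF toV[OF f] i1] by (simp add: JJ_def)
    then show "\<bar>JJ (k3 i (fs n)) - JJ (k3 i f)\<bar> \<le> JJ (sq (nbd F)) * real DIM('a) * e"
      using k3_bound(2)[OF F toU[OF df] sup[OF df] L i1] by (simp add: mult.assoc)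
  qed
  have c4: "(\<lambda>n. nu i j (pd j (fs n))) \<longlonglongrightarrow> nu i j (pd j f)" if j: "j \<in> Basis" for j
  proof (rule tendsto_of_uniform_bound[OF conv, where C="measure (fst (nuM i j)) F + measure (snd (nuM i j)) F"])
    fix n e assume e: "\<And>j x. j \<in> Basis \<Longrightarrow> \<bar>pd j (fs n) x - pd j f x\<bar> \<le> e"
    note p = C0inf_pd[OF fs j] C0inf_pd[OF f j]
    have d: "(\<lambda>x. pd j (fs n) x + (-1) * pd j f x) \<in> C0inf Ob" by (intro C0inf_add C0inf_cmult p)
    have "nu i j (\<lambda>x. pd j (fs n) x + (-1) * pd j f x) = nu i j (pd j (fs n)) - nu i j (pd j f)"
      using nu_add[OF toU[OF p(1)] C0inf_cmult[OF toU[OF p(2)]], of i j n "-1"] nu_cmult[OF toU[OF p(2)], of i j "-1"] by simp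
    then show "\<bar>nu i j (pd j (fs n)) - nu i j (pd j f)\<bar> \<le> (measure (fst (nuM i j)) F + measure (snd (nuM i j)) F) * e"
      using nu_bound[OF toU[OF d] F(1) order_trans[OF F(2) Udelta_subset] sup[OF d], of e i j] e[OF j] by simp
  qed
  have "(\<lambda>n. psi \<eta> i (fs n)) \<longlonglongrightarrow> psi \<eta> i f" unfolding psi_def
    by (intro tendsto_add tendsto_diff tendsto_mult tendsto_const tendsto_sum c1 c2 c3 c4)
  then show "(\<lambda>n. Psi i (fs n)) \<longlonglongrightarrow> Psi i f"
    unfolding Psi_eq[OF toV[OF fs] cs[OF fs]] Psi_eq[OF toV[OF f] cs[OF f]] .
qed

end

section \<open>The decomposition\<close>

context jump_form_delta
begin

definition k4 :: "('a \<Rightarrow> real) \<Rightarrow> ('a \<Rightarrow> real) \<Rightarrow> 'a \<Rightarrow> 'a \<Rightarrow> real" where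
  "k4 u v x y = 2 * (u y - u x - (\<Sum>i\<in>Basis. ((y - x) \<bullet> i) * pd i u y) * near x y) * v y"

lemma sum_inner_swap: "(\<Sum>i\<in>Basis. ((y - x) \<bullet> i) * g i) = - (\<Sum>i\<in>Basis. ((x - y) \<bullet> i) * g i)" for x y :: 'a and g :: "'a \<Rightarrow> real"
  unfolding sum_negf[symmetric] by (intro sum.cong refl) (simp add: inner_diff_left algebra_simps)

text \<open>Within distance \<delta> the kernel is a first-order Taylor remainder, hence of order
  \<open>(dist x y)\<^sup>2\<close>; beyond it the gradient term is cut off and the kernel is
  bounded. The constants \<open>?a\<close> and \<open>?b\<close> express both bounds through
  \<open>min 1 ((dist x y)\<^sup>2)\<close>, as in \<open>Jint_tail\<close>.\<close>

lemma k4_Jint: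
  assumes u: "u \<in> C0inf V" and v: "v \<in> C0inf V"
  shows "Jint (k4 u v)"
proof -
  obtain C where C: "C \<ge> 0" "\<And>x y. \<bar>u x - u y - (\<Sum>i\<in>Basis. ((x - y) \<bullet> i) * pd i u y)\<bar> \<le> C * (dist x y)\<^sup>2"
    using C0inf_taylor1[OF u] by blast
  obtain B1 where B1: "B1 > 0" "\<And>x. \<bar>u x\<bar> \<le> B1" using C0inf_bounded[OF u] by blast
  obtain B2 where B2: "B2 > 0" "\<And>x. \<bar>v x\<bar> \<le> B2" using C0inf_bounded[OF v] by blast
  let ?a = "2 * C * B2 * max 1 (\<delta>\<^sup>2)" and ?b = "4 * B1 * B2 * (1 / min 1 (\<delta>\<^sup>2))"
  have ab: "0 \<le> ?a" "0 \<le> ?b" using C(1) B1(1) B2(1) delta by auto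
  show ?thesis
  proof (rule Jint_tail[OF _ C0infD(2)[OF v], where c="?a + ?b"])
    show "fsupp v \<subseteq> U" using C0infD(3)[OF v] Udelta_subset by blast
    show "(\<lambda>p. k4 u v (fst p) (snd p)) \<in> borel_measurable borel"
      unfolding k4_def
      by (intro borel_measurable_times borel_measurable_diff borel_measurable_sum borel_measurable_const
          measurable_inner near_measurable measurable_fst measurable_snd C0inf_measurable[OF u]
          C0inf_measurable[OF v] C0inf_measurable[OF C0inf_pd[OF u]])
    fix x y :: 'a
    have m0: "0 \<le> min 1 ((dist x y)\<^sup>2)" by simp
    have "\<bar>k4 u v x y\<bar> \<le> (?a + ?b) * min 1 ((dist x y)\<^sup>2)"
    proof (cases "dist x y \<le> \<delta>")
      case True
      define t where "t = u x - u y - (\<Sum>i\<in>Basis. ((x - y) \<bullet> i) * pd i u y)"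
      have "k4 u v x y = - (2 * (t * v y))"
        unfolding k4_def sum_inner_swap[of y x] t_def using True by (simp add: near_def algebra_simps)
      then have "\<bar>k4 u v x y\<bar> = 2 * (\<bar>t\<bar> * \<bar>v y\<bar>)" by (simp only: abs_minus_cancel abs_mult abs_numeral)
      also have "\<dots> \<le> 2 * ((C * (dist x y)\<^sup>2) * B2)"
        using C B2 unfolding t_def by (intro mult_left_mono mult_mono) auto
      also have "\<dots> = (2 * C * B2) * (dist x y)\<^sup>2" by simp
      also have "\<dots> \<le> (2 * C * B2) * (max 1 (\<delta>\<^sup>2) * min 1 ((dist x y)\<^sup>2))"
        using tail_bounds(2)[of "dist x y"] True C(1) B2(1) by (intro mult_left_mono) auto
      also have "\<dots> \<le> (?a + ?b) * min 1 ((dist x y)\<^sup>2)"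
        using mult_nonneg_nonneg[OF ab(2) m0] by (simp add: distrib_right mult.assoc)
      finally show ?thesis .
    next
      case False
      have "k4 u v x y = 2 * ((u y - u x) * v y)" using False by (simp add: k4_def near_def)
      then have "\<bar>k4 u v x y\<bar> = 2 * (\<bar>u y - u x\<bar> * \<bar>v y\<bar>)" by (simp only: abs_mult abs_numeral)
      also have "\<dots> \<le> 2 * ((B1 + B1) * B2)"
        using B1 B2 abs_triangle_ineq4[of "u y" "u x"]
        by (intro mult_left_mono mult_mono order_trans[OF abs_triangle_ineq4] add_mono) auto
      also have "\<dots> = (4 * B1 * B2) * 1" by simp
      also have "\<dots> \<le> (4 * B1 * B2) * ((1 / min 1 (\<delta>\<^sup>2)) * min 1 ((dist x y)\<^sup>2))"
        using tail_bounds(1)[of "dist x y"] False B1(1) B2(1) by (intro mult_left_mono) auto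
      also have "\<dots> \<le> (?a + ?b) * min 1 ((dist x y)\<^sup>2)"
        using mult_nonneg_nonneg[OF ab(1) m0] by (simp add: distrib_right mult.assoc)
      finally show ?thesis .
    qed
    then show "\<bar>k4 u v (fst (x, y)) (snd (x, y))\<bar> \<le> (?a + ?b) * min 1 ((dist x y)\<^sup>2)" by simp
    show "k4 u v (fst (x, y)) (snd (x, y)) = 0" if "y \<notin> fsupp v" using that by (simp add: k4_def notin_fsupp)
  qed
qed

lemma decomposition:
  assumes u: "u \<in> C0inf V" and v: "v \<in> C0inf V"
  shows "E u v = 1/2 * (\<Sum>i\<in>Basis. \<Sum>j\<in>Basis. nu i j (\<lambda>x. pd i u x * pd j v x))
    + (\<Sum>i\<in>Basis. Psi i (\<lambda>x. pd i u x * v x))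
    + (\<Sum>i\<in>Basis. JJ (k3 i (\<lambda>x. pd i u x * v x))) + JJ (k4 u v) + (\<integral>x. u x * v x \<partial>K)"
proof -
  have uU: "u \<in> C0inf U" and vU: "v \<in> C0inf U" using C0inf_mono[OF Udelta_subset] u v by blast+
  define F where "F = fsupp u \<union> fsupp v"
  have F: "compact F" "F \<subseteq> V" using C0infD(2,3)[OF u] C0infD(2,3)[OF v] by (auto simp: F_def)
  obtain \<eta> where c: "cut (nbd F) \<eta>" using cut_exists[OF compact_nbd[OF F(1)] nbd_subset[OF F(2)]] by blast
  have \<eta>: "\<eta> \<in> C0inf U" by (rule cut_C0inf[OF c])
  have cs: "cut (nbd (fsupp h)) \<eta>" if "fsupp h \<subseteq> F" for h using cut_mono[OF c nbd_mono[OF that]] .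
  have c0: "cut (fsupp h) \<eta>" if "fsupp h \<subseteq> F" for h using cut_mono[OF c] that subset_nbd by blast
  have \<eta>1: "\<eta> x = 1" if "x \<in> F" for x using cut_eq[OF c] subset_nbd that by blast
  have \<eta>u: "\<eta> x * u x = u x" for x using \<eta>1[of x] notin_fsupp[of x u] by (cases "x \<in> fsupp u") (auto simp: F_def)
  define w where "w i x = pd i u x * v x" for i x
  define z where "z i j x = pd j (pd i u) x * v x" for i j x
  have w: "w i \<in> C0inf V" if "i \<in> Basis" for i
    unfolding w_def[abs_def] by (rule C0inf_mult[OF C0inf_pd[OF u that] C0infD(1)[OF v]])
  have z: "z i j \<in> C0inf V" if "i \<in> Basis" "j \<in> Basis" for i j
    unfolding z_def[abs_def] by (rule C0inf_mult[OF C0inf_pd[OF C0inf_pd[OF u that(1)] that(2)] C0infD(1)[OF v]])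
  have ws: "fsupp (w i) \<subseteq> F" and zs: "fsupp (z i j) \<subseteq> F" for i j
    using fsupp_subset[OF closed_fsupp[of v], of "w i"] fsupp_subset[OF closed_fsupp[of v], of "z i j"]
    by (auto simp: F_def w_def z_def notin_fsupp)
  have uv: "(\<lambda>x. u x * v x) \<in> C0inf U" by (rule C0inf_mult[OF uU C0infD(1)[OF v]])
  have toU: "h \<in> C0inf U" if "h \<in> C0inf V" for h using C0inf_mono[OF Udelta_subset that] .

  define S1 where "S1 x y = (\<Sum>i\<in>Basis. k1 i \<eta> (w i) x y)" for x y
  define S2 where "S2 x y = (\<Sum>i\<in>Basis. \<Sum>j\<in>Basis. sk i j \<eta> (z i j) x y)" for x y
  \<comment> \<open>The first-order Taylor remainder
    \<open>\<eta> x * v y * (u x - u y - ...)\<close> in tensor form; as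
    \<open>\<eta> * u = u\<close>, its leading term is the plain tensor \<open>u x * v y\<close>,
    whose \<open>EE\<close> is \<open>E u v\<close>.\<close>
  define P where "P x y = (u x * v y - \<eta> x * (u y * v y)) - S1 x y" for x y
  have S1T: "S1 \<in> T" unfolding S1_def[abs_def] by (intro T_sum k1_T \<eta> toU w)
  have PT: "P \<in> T" unfolding P_def[abs_def] by (intro T_diff T_tensor uU vU \<eta> uv S1T)
  have S2Q: "S2 \<in> Q" unfolding S2_def[abs_def] by (intro Q_sum sk_Q \<eta> toU z)
  have P_taylor: "P x y = \<eta> x * v y * (u x - u y - (\<Sum>i\<in>Basis. ((x - y) \<bullet> i) * pd i u y))" for x y
  proof -
    have "S1 x y = \<eta> x * v y * (\<Sum>i\<in>Basis. ((x - y) \<bullet> i) * pd i u y)"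
      by (simp add: S1_def k1_def w_def sum_distrib_left mult_ac)
    moreover have "u x * v y = \<eta> x * u x * v y" by (simp add: \<eta>u)
    ultimately show ?thesis by (simp add: P_def algebra_simps)
  qed
  have S2_taylor: "S2 x y = \<eta> x * v y * (\<Sum>i\<in>Basis. \<Sum>j\<in>Basis. ((x - y) \<bullet> i) * ((x - y) \<bullet> j) * pd j (pd i u) y)" for x y
    by (simp add: S2_def sk_def z_def sum_distrib_left mult_ac)
  obtain B0 where B0: "B0 > 0" "\<And>x. \<bar>\<eta> x\<bar> \<le> B0" using C0inf_bounded[OF \<eta>] by blast
  obtain B1 where B1: "B1 > 0" "\<And>x. \<bar>v x\<bar> \<le> B1" using C0inf_bounded[OF v] by blast
  have \<eta>v: "\<bar>\<eta> x * v y * t\<bar> \<le> (B0 * B1 * C) * r" if "\<bar>t\<bar> \<le> C * r" for x y t C r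
  proof -
    have "\<bar>\<eta> x * v y * t\<bar> = \<bar>\<eta> x\<bar> * \<bar>v y\<bar> * \<bar>t\<bar>" by (simp add: abs_mult)
    also have "\<dots> \<le> B0 * B1 * (C * r)" using B0 B1 that by (intro mult_mono) auto
    finally show ?thesis by (simp add: mult.assoc)
  qed
  obtain C1 where C1: "\<And>x y. \<bar>u x - u y - (\<Sum>i\<in>Basis. ((x - y) \<bullet> i) * pd i u y)\<bar> \<le> C1 * (dist x y)\<^sup>2"
    using C0inf_taylor1[OF u] by blast
  have PQ: "P \<in> Q" unfolding Q_def
    using PT \<eta>v[OF C1] by (intro CollectI conjI exI[of _ "B0 * B1 * C1"]) (auto simp: P_taylor)
  obtain C2 where C2: "\<And>x y. \<bar>u x - u y - (\<Sum>i\<in>Basis. ((x - y) \<bullet> i) * pd i u y)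
    - 1/2 * (\<Sum>i\<in>Basis. \<Sum>j\<in>Basis. ((x - y) \<bullet> i) * ((x - y) \<bullet> j) * pd j (pd i u) y)\<bar> \<le> C2 * (dist x y) ^ 3"
    using C0inf_taylor2[OF u] by blast
  \<comment> \<open>\<open>P\<close> minus half of \<open>S2\<close> is the second-order remainder
    times \<open>\<eta> x * v y\<close>, of third order at the diagonal.\<close>
  have "B (\<lambda>x y. P x y - 1/2 * S2 x y) = 0"
  proof (rule B_third_order[OF Q_diff[OF PQ Q_cmult[OF S2Q]]])
    fix x y
    have "P x y - 1/2 * S2 x y = \<eta> x * v y * (u x - u y - (\<Sum>i\<in>Basis. ((x - y) \<bullet> i) * pd i u y)
      - 1/2 * (\<Sum>i\<in>Basis. \<Sum>j\<in>Basis. ((x - y) \<bullet> i) * ((x - y) \<bullet> j) * pd j (pd i u) y))"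
      unfolding P_taylor S2_taylor by (simp add: algebra_simps)
    then show "\<bar>P x y - 1/2 * S2 x y\<bar> \<le> (B0 * B1 * C2) * (dist x y) ^ 3" using \<eta>v[OF C2] by simp
  qed
  then have BP: "B P = 1/2 * B S2" using B_diff[OF PQ Q_cmult[OF S2Q], of "1/2"] B_cmult[OF S2Q, of "1/2"] by simp
  have BS2: "B S2 = (\<Sum>i\<in>Basis. \<Sum>j\<in>Basis. nu i j (z i j))"
  proof -
    have "B S2 = (\<Sum>i\<in>Basis. B (\<lambda>x y. \<Sum>j\<in>Basis. sk i j \<eta> (z i j) x y))"
      unfolding S2_def[abs_def] by (rule B_sum) (intro Q_sum sk_Q \<eta> toU z)
    also have "\<dots> = (\<Sum>i\<in>Basis. \<Sum>j\<in>Basis. B (sk i j \<eta> (z i j)))"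
      by (intro sum.cong refl B_sum sk_Q \<eta> toU z)
    also have "\<dots> = (\<Sum>i\<in>Basis. \<Sum>j\<in>Basis. nu i j (z i j))"
      by (intro sum.cong refl nu_eq[symmetric] toU z c0 zs)
    finally show ?thesis .
  qed
  have EP: "EE P = E u v - E \<eta> (\<lambda>x. u x * v x) - (\<Sum>i\<in>Basis. EE (k1 i \<eta> (w i)))"
  proof -
    have "EE S1 = (\<Sum>i\<in>Basis. EE (k1 i \<eta> (w i)))"
      unfolding S1_def[abs_def] by (rule EE_sum) (intro k1_T \<eta> toU w)
    then show ?thesis unfolding P_def[abs_def]
      using EE_diff[OF T_diff[OF T_tensor[OF uU vU] T_tensor[OF \<eta> uv]] S1T]
        EE_diff[OF T_tensor[OF uU vU] T_tensor[OF \<eta> uv]] EE_tensor[OF uU vU] EE_tensor[OF \<eta> uv] by simp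
  qed

  \<comment> \<open>The order-zero term: \<eta> is constant near the support of
    \<open>u * v\<close>, so \<open>jump_kill\<close> evaluates \<open>E \<eta> (u * v)\<close>
    exactly. The integral over \<open>K\<close> arises here, where
    \<open>\<eta> * (u * v) = u * v\<close>.\<close>
  define G where "G x y = (\<eta> y - \<eta> x) * (u y * v y)" for x y
  have uvs: "fsupp (\<lambda>x. u x * v x) \<subseteq> F"
    using fsupp_subset[OF closed_fsupp[of v], of "\<lambda>x. u x * v x"] by (auto simp: F_def notin_fsupp)
  have "\<exists>W c. open W \<and> fsupp (\<lambda>x. u x * v x) \<subseteq> W \<and> (\<forall>x\<in>W. \<eta> x = c)"
    using c0[OF uvs] unfolding cut_def by blast
  then have jk: "integrable J (\<lambda>p. 2 * (\<eta> (snd p) - \<eta> (fst p)) * (u (snd p) * v (snd p)))"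
    "E \<eta> (\<lambda>x. u x * v x) = (\<integral>p. 2 * (\<eta> (snd p) - \<eta> (fst p)) * (u (snd p) * v (snd p)) \<partial>J) + (\<integral>x. \<eta> x * (u x * v x) \<partial>K)"
    using jump_kill \<eta> uv unfolding jump_kill_def by blast+
  have "integrable J (\<lambda>p. (1/2) * (2 * (\<eta> (snd p) - \<eta> (fst p)) * (u (snd p) * v (snd p))))"
    using jk(1) by (rule integrable_mult_right)
  moreover have "G x y = (1/2) * (2 * (\<eta> y - \<eta> x) * (u y * v y))" for x y unfolding G_def mult.assoc by simp
  ultimately have GJ: "Jint G" by (simp only:)
  have \<eta>uv: "\<eta> x * (u x * v x) = u x * v x" for x using \<eta>u[of x] by (simp add: mult.assoc[symmetric])
  have EG: "E \<eta> (\<lambda>x. u x * v x) = 2 * JJ G + (\<integral>x. u x * v x \<partial>K)"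
  proof -
    have "2 * (\<eta> y - \<eta> x) * (u y * v y) = 2 * G x y" for x y unfolding G_def mult.assoc ..
    from jk(2)[unfolded this \<eta>uv] show ?thesis by (simp add: JJ_def)
  qed

  \<comment> \<open>\<open>G\<close> and \<open>P\<close> are each \<open>J\<close>-integrable, and
    their difference is the prescribed integrand \<open>k4\<close> up to the exchange of
    \<open>\<eta> x\<close> for the sharp truncation, which is \<open>kR\<close>.\<close>
  have pw: "2 * G x y - 2 * P x y = k4 u v x y + 2 * (\<Sum>i\<in>Basis. kR i \<eta> (w i) x y)" for x y
  proof -
    define s where "s = (\<Sum>i\<in>Basis. ((x - y) \<bullet> i) * pd i u y)"
    have P': "P x y = u x * v y - \<eta> x * (u y * v y) - \<eta> x * v y * s"
      by (simp add: P_def S1_def k1_def w_def s_def sum_distrib_left mult_ac)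
    have R': "(\<Sum>i\<in>Basis. kR i \<eta> (w i) x y) = (\<eta> x - near x y) * v y * s"
      by (simp add: kR_def w_def s_def sum_distrib_left mult_ac)
    have k4': "k4 u v x y = 2 * (u y - u x + s * near x y) * v y"
      unfolding k4_def sum_inner_swap[of y x] s_def[symmetric] by simp
    have "2 * G x y = 2 * (u y * v y - \<eta> x * (u y * v y))"
      using \<eta>uv[of y] by (simp add: G_def left_diff_distrib)
    then show ?thesis unfolding P' R' k4' by (simp add: algebra_simps)
  qed
  have RJ: "Jint (kR i \<eta> (w i))" if "i \<in> Basis" for i by (rule kR_Jint[OF w[OF that] cs[OF ws]])
  have jump: "2 * JJ G - 2 * JJ P = JJ (k4 u v) + 2 * (\<Sum>i\<in>Basis. JJ (kR i \<eta> (w i)))"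
  proof -
    have "2 * JJ G - 2 * JJ P = (\<integral>p. 2 * G (fst p) (snd p) - 2 * P (fst p) (snd p) \<partial>J)"
      using GJ Q_Jint[OF PQ] by (simp add: JJ_def)
    also have "\<dots> = (\<integral>p. k4 u v (fst p) (snd p) + 2 * (\<Sum>i\<in>Basis. kR i \<eta> (w i) (fst p) (snd p)) \<partial>J)"
      by (simp only: pw)
    also have "\<dots> = JJ (k4 u v) + 2 * (\<Sum>i\<in>Basis. JJ (kR i \<eta> (w i)))"
      using k4_Jint[OF u v] RJ by (simp add: JJ_def)
    finally show ?thesis .
  qed

  \<comment> \<open>The product rule splits
    \<open>\<partial>\<^sub>j (\<partial>\<^sub>i u v)\<close> into \<open>z i j\<close> and
    \<open>\<partial>\<^sub>i u \<partial>\<^sub>j v\<close>. The first part matches the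
    second-order term of \<open>E u v\<close>; the second part, moved to the other side, is the
    local term of the decomposition.\<close>
  have Psi: "Psi i (w i) = EE (k1 i \<eta> (w i)) + 2 * JJ (kR i \<eta> (w i)) - JJ (k3 i (w i))
      - 1/2 * (\<Sum>j\<in>Basis. nu i j (z i j)) - 1/2 * (\<Sum>j\<in>Basis. nu i j (\<lambda>x. pd i u x * pd j v x))"
    if i: "i \<in> Basis" for i
  proof -
    have "nu i j (pd j (w i)) = nu i j (z i j) + nu i j (\<lambda>x. pd i u x * pd j v x)" if j: "j \<in> Basis" for j
    proof -
      have "pd j (w i) = (\<lambda>x. z i j x + pd i u x * pd j v x)"
        unfolding w_def[abs_def] z_def
        by (rule pd_mult[OF C0infD(1)[OF C0inf_pd[OF u i]] C0infD(1)[OF v]])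
      moreover have "(\<lambda>x. pd i u x * pd j v x) \<in> C0inf U"
        by (rule C0inf_mult[OF C0inf_pd[OF uU i] C0infD(1)[OF C0inf_pd[OF vU j]]])
      ultimately show ?thesis using nu_add[OF toU[OF z[OF i j]]] by simp
    qed
    then have "(\<Sum>j\<in>Basis. nu i j (pd j (w i)))
        = (\<Sum>j\<in>Basis. nu i j (z i j)) + (\<Sum>j\<in>Basis. nu i j (\<lambda>x. pd i u x * pd j v x))"
      by (simp add: sum.distrib)
    then show ?thesis unfolding Psi_eq[OF w[OF i] cs[OF ws]] psi_def by (simp add: algebra_simps)
  qed
  have "(\<Sum>i\<in>Basis. Psi i (w i)) = (\<Sum>i\<in>Basis. EE (k1 i \<eta> (w i))) + 2 * (\<Sum>i\<in>Basis. JJ (kR i \<eta> (w i)))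
      - (\<Sum>i\<in>Basis. JJ (k3 i (w i))) - 1/2 * (\<Sum>i\<in>Basis. \<Sum>j\<in>Basis. nu i j (z i j))
      - 1/2 * (\<Sum>i\<in>Basis. \<Sum>j\<in>Basis. nu i j (\<lambda>x. pd i u x * pd j v x))"
    by (simp add: Psi sum.distrib sum_subtractf sum_distrib_left)
  moreover have "E u v = 2 * JJ G + (\<integral>x. u x * v x \<partial>K) + (\<Sum>i\<in>Basis. EE (k1 i \<eta> (w i))) - 2 * JJ P
      - 1/2 * (\<Sum>i\<in>Basis. \<Sum>j\<in>Basis. nu i j (z i j))"
    using BP BS2 EP EG by (simp add: B_def)
  ultimately show ?thesis using jump by (simp add: w_def[abs_def])
qed

end

theorem theorem1p4:
  fixes U :: "'a::euclidean_space set"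
    and m :: "'a measure"
    and D :: "('a \<Rightarrow> real) set"
    and E :: "('a \<Rightarrow> real) \<Rightarrow> ('a \<Rightarrow> real) \<Rightarrow> real"
    and J :: "('a \<times> 'a) measure"
    and K :: "'a measure"
    and \<delta> :: real
  assumes "open U"
    and "radon_on U m" and "full_support U m"
    and "semi_dirichlet_form m D E"
    and "C0inf U \<subseteq> D"
    and "smooth_continuous_form U E"
    and "jump_kill U E J K"
    and "\<delta> > 0" and "Udelta U \<delta> \<noteq> {}"
  shows "\<exists>(\<nu> :: 'a \<Rightarrow> 'a \<Rightarrow> 'a measure \<times> 'a measure) (\<Psi> :: 'a \<Rightarrow> ('a \<Rightarrow> real) \<Rightarrow> real).
    (\<forall>i\<in>Basis. \<forall>j\<in>Basis. radon_on U (fst (\<nu> i j)) \<and> radon_on U (snd (\<nu> i j))) \<and>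
    (\<forall>F. compact F \<and> F \<subseteq> U \<longrightarrow>
       (\<forall>i\<in>Basis. \<forall>j\<in>Basis. signed_val (\<nu> i j) F = signed_val (\<nu> j i) F) \<and>
       (\<forall>\<xi>::'a. (\<Sum>i\<in>Basis. \<Sum>j\<in>Basis. (\<xi> \<bullet> i) * (\<xi> \<bullet> j) * signed_val (\<nu> i j) F) \<ge> 0)) \<and>
    (\<forall>i\<in>Basis. generalized_function (Udelta U \<delta>) (\<Psi> i)) \<and>
    (\<forall>u\<in>C0inf (Udelta U \<delta>). \<forall>v\<in>C0inf (Udelta U \<delta>).
       integrable J (\<lambda>p. (\<Sum>i\<in>Basis. ((snd p - fst p) \<bullet> i) *
           (pd i u (snd p) * v (snd p) - pd i u (fst p) * v (fst p)))
           * indicator {p. dist (fst p) (snd p) \<le> \<delta>} p) \<and>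
       integrable J (\<lambda>p. 2 * (u (snd p) - u (fst p)
           - (\<Sum>i\<in>Basis. ((snd p - fst p) \<bullet> i) * pd i u (snd p))
             * indicator {p. dist (fst p) (snd p) \<le> \<delta>} p) * v (snd p)) \<and>
       E u v =
         1/2 * (\<Sum>i\<in>Basis. \<Sum>j\<in>Basis. signed_int (\<nu> i j) (\<lambda>x. pd i u x * pd j v x))
       + (\<Sum>i\<in>Basis. \<Psi> i (\<lambda>x. pd i u x * v x))
       + (\<integral>p. (\<Sum>i\<in>Basis. ((snd p - fst p) \<bullet> i) *
           (pd i u (snd p) * v (snd p) - pd i u (fst p) * v (fst p)))
           * indicator {p. dist (fst p) (snd p) \<le> \<delta>} p \<partial>J)
       + (\<integral>p. 2 * (u (snd p) - u (fst p)
           - (\<Sum>i\<in>Basis. ((snd p - fst p) \<bullet> i) * pd i u (snd p))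
             * indicator {p. dist (fst p) (snd p) \<le> \<delta>} p) * v (snd p) \<partial>J)
       + (\<integral>x. u x * v x \<partial>K))"
proof -
  obtain \<alpha> C where "sdform m D E \<alpha> C" by (rule semi_dirichlet_formE[OF assms(4)])
  then interpret sd: sdform m D E \<alpha> C .
  have inD: "f \<in> D" if "f \<in> C0inf U" for f using assms(5) that by blast
  interpret jump_form_delta U E J K \<delta>
  proof
    show "open U" "jump_kill U E J K" "0 < \<delta>" by (fact assms)+
    fix n :: nat and a b :: "nat \<Rightarrow> 'a \<Rightarrow> real"
    assume a: "\<And>k. a k \<in> C0inf U" and b: "\<And>k. b k \<in> C0inf U"
      and pos: "\<And>x y. 0 \<le> (\<Sum>k<n. a k x * b k y)" "\<And>y. (\<Sum>k<n. a k y * b k y) = 0"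
    show "(\<Sum>k<n. E (a k) (b k)) \<le> 0"
    proof (rule sd.kernel_nonpos[OF inD[OF a] inD[OF b] _ C0inf_continuous[OF b] pos])
      show "\<exists>B. \<forall>x. \<bar>a k x\<bar> \<le> B" for k using C0inf_bounded[OF a] by blast
    qed
  qed (auto intro: inD sd.E_simps)
  have near: "indicator {p. dist (fst p) (snd p) \<le> \<delta>} p = near (fst p) (snd p)" for p :: "'a \<times> 'a"
    by (simp add: near_def)
  have k3: "(\<Sum>i\<in>Basis. ((snd p - fst p) \<bullet> i) * (pd i u (snd p) * v (snd p) - pd i u (fst p) * v (fst p)))
      * near (fst p) (snd p) = (\<Sum>i\<in>Basis. k3 i (\<lambda>x. pd i u x * v x) (fst p) (snd p))"
    for u v :: "'a \<Rightarrow> real" and p by (simp add: k3_def sum_distrib_right)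
  have k4: "2 * (u (snd p) - u (fst p) - (\<Sum>i\<in>Basis. ((snd p - fst p) \<bullet> i) * pd i u (snd p)) * near (fst p) (snd p)) * v (snd p)
      = k4 u v (fst p) (snd p)" for u v :: "'a \<Rightarrow> real" and p
    by (simp add: k4_def)
  show ?thesis
    unfolding near k3 k4
  proof (intro exI[of _ nuM] exI[of _ Psi] conjI ballI allI impI)
    fix i j :: 'a
    show "radon_on U (fst (nuM i j))" "radon_on U (snd (nuM i j))" by (simp_all add: nuM_def radon_N)
  next
    fix F :: "'a set" and i j :: 'a assume "compact F \<and> F \<subseteq> U"
    then show "signed_val (nuM i j) F = signed_val (nuM j i) F" using signed_val_nuM(1) by blast
  next
    fix F :: "'a set" and \<xi> :: 'a assume "compact F \<and> F \<subseteq> U"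
    then show "0 \<le> (\<Sum>i\<in>Basis. \<Sum>j\<in>Basis. (\<xi> \<bullet> i) * (\<xi> \<bullet> j) * signed_val (nuM i j) F)"
      using signed_val_nuM(2) by blast
  next
    fix i :: 'a assume "i \<in> Basis"
    then show "generalized_function V (Psi i)" by (rule Psi_generalized[OF assms(6)])
  next
    fix u v assume u: "u \<in> C0inf V" and v: "v \<in> C0inf V"
    have I3: "Jint (k3 i (\<lambda>x. pd i u x * v x))" if "i \<in> Basis" for i
      by (rule k3_Jint[OF C0inf_mult[OF C0inf_pd[OF u that] C0infD(1)[OF v]]]) (use that in simp)
    show "integrable J (\<lambda>p. \<Sum>i\<in>Basis. k3 i (\<lambda>x. pd i u x * v x) (fst p) (snd p))"
      by (rule Bochner_Integration.integrable_sum) (rule I3)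
    show "integrable J (\<lambda>p. k4 u v (fst p) (snd p))" by (rule k4_Jint[OF u v])
    have uU: "u \<in> C0inf U" and vU: "v \<in> C0inf U" using C0inf_mono[OF Udelta_subset] u v by blast+
    have si: "signed_int (nuM i j) (\<lambda>x. pd i u x * pd j v x) = nu i j (\<lambda>x. pd i u x * pd j v x)"
      if "i \<in> Basis" "j \<in> Basis" for i j
      by (rule signed_int_nuM[OF C0inf_mult[OF C0inf_pd[OF uU that(1)] C0infD(1)[OF C0inf_pd[OF vU that(2)]]]])
    have "(\<integral>p. (\<Sum>i\<in>Basis. k3 i (\<lambda>x. pd i u x * v x) (fst p) (snd p)) \<partial>J)
        = (\<Sum>i\<in>Basis. JJ (k3 i (\<lambda>x. pd i u x * v x)))"
      unfolding JJ_def by (rule Bochner_Integration.integral_sum) (rule I3)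
    then show "E u v = 1/2 * (\<Sum>i\<in>Basis. \<Sum>j\<in>Basis. signed_int (nuM i j) (\<lambda>x. pd i u x * pd j v x))
       + (\<Sum>i\<in>Basis. Psi i (\<lambda>x. pd i u x * v x))
       + (\<integral>p. (\<Sum>i\<in>Basis. k3 i (\<lambda>x. pd i u x * v x) (fst p) (snd p)) \<partial>J)
       + (\<integral>p. k4 u v (fst p) (snd p) \<partial>J) + (\<integral>x. u x * v x \<partial>K)"
      using decomposition[OF u v] by (simp add: si JJ_def)
  qed
qed

end
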